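(* Let $\Gamma$ be a connected simplicial graph with $\mathrm{girth}(\Gamma)>20$, let $\mathcal{G}=\{G_v\}_{v\in V(\Gamma)}$ be a collection of non-trivial groups, and let $\Gamma^e$ be the extension graph of the graph product $\Gamma\mathcal{G}$. Then the following hold. (1) $\Gamma$ is hyperbolic if and only if $\Gamma^e$ is hyperbolic. (2) If $\Gamma$ is uniformly fine and hyperbolic, then $\Gamma^e$ is tight in the sense of Bowditch. (3) If $\Gamma$ is fine and every $G_v$ ($v\in V(\Gamma)$) is a non-trivial finite group, then $\Gamma^e$ is fine.
   Context: Graphs are simplicial (no loops, no multiple edges). A connected graph $X$ is regarded as a geodesic metric space with the graph metric $d_X$ (every edge has length 1). A circuit is a closed path $(p_0,\dots,p_n)$ with $n>2$, $p_0=p_n$ and no other repeated vertices; $\mathrm{girth}(X)$ is the minimal length of a circuit in $X$, and $\infty$ if there is none. Graph product: $\Gamma\mathcal{G}$ is the quotient of the free product $\ast_{v\in V(\Gamma)}G_v$ by the normal subgroup generated by all commutators $[g_v,g_w]$ with $(v,w)\in E(\Gamma)$, $g_v\in G_v$, $g_w\in G_w$. Each $G_v$ is identified with a subgroup of $\Gamma\mathcal{G}$. Extension graph $\Gamma^e$: its vertices are the subgroups $gG_vg^{-1}$ of $\Gamma\mathcal{G}$ ($v\in V(\Gamma)$, $g\in\Gamma\mathcal{G}$), and two distinct vertices $gG_vg^{-1}$, $hG_wh^{-1}$ are adjacent iff they commute elementwise. When $\Gamma$ is connected, so is $\Gamma^e$. Hyperbolic means Gromov hyperbolic. Fineness: for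 an edge $e$ of a graph $X$ and $n\in\mathbb{N}$ let $\mathscr{C}_X(e,n)$ be the set of circuits in $X$ that contain $e$ and have length at most $n$. $X$ is fine if $|\mathscr{C}_X(e,n)|<\infty$ for all $e\in E(X)$, $n\in\mathbb{N}$; $X$ is uniformly fine if there is $f:\mathbb{N}\to\mathbb{N}$ with $|\mathscr{C}_X(e,n)|\le f(n)$ for all $e\in E(X)$, $n\in\mathbb{N}$. Tightness: let $X$ be a $\delta$-hyperbolic graph, and let $\delta_0>0$ be a constant, depending only on $\delta$, such that whenever $c\in V(X)$ lies on some geodesic from $a\in V(X)$ to $b\in V(X)$, every geodesic from $a$ to $b$ passes through the closed ball $\mathcal{N}_X(c,\delta_0)$. $X$ is tight in the sense of Bowditch if for each $(a,b)\in V(X)^2$ there is a set $\mathcal{T}(a,b)$ of geodesic edge paths from $a$ to $b$ such that, writing $V_{\mathcal{T}}(a,b)$ for the union of the vertex sets of the paths in $\mathcal{T}(a,b)$ and $V_{\mathcal{T}}(a,b;r)=\bigcup\{V_{\mathcal{T}}(a',b')\mid d_X(a,a')\le r,\ d_X(b,b')\le r\}$, one has: (i) there is $P_0\in\mathbb{N}$ such that $|V_{\mathcal{T}}(a,b)\cap\mathcal{N}_X(c,\delta_0)|\le P_0$ for all $a,b\in V(X)$ and $c\in V_{\mathcal{T}}(a,b)$; (ii) there are $P_1,k_1\in\mathbb{N}$ such that for all $r\in\mathbb{N}$, $a,b\in V(X)$ and $c\in V_{\mathcal{T}}(a,b)$ with $d_X(c,\{a,b\})\ge r+k_1$, one has $|V_{\mathcal{T}}(a,b;r)\cap\mathcal{N}_X(c,\delta_0)|\le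 P_1$. *)

theory Defs
  imports Complex_Main "HOL-Library.Extended_Nat" "HOL-Algebra.Coset"
begin

section \<open>Graphs\<close>

record 'a ugraph =
  verts :: "'a set"
  edges :: "'a set set"

definition simplicial_graph :: "'a ugraph \<Rightarrow> bool" where
  "simplicial_graph X \<longleftrightarrow>
     (\<forall>e\<in>edges X. \<exists>u\<in>verts X. \<exists>v\<in>verts X. u \<noteq> v \<and> e = {u, v})"

text \<open>An edge path \<open>(p\<^sub>0, \<dots>, p\<^sub>n)\<close> is the list of its \<open>n + 1\<close> vertices; its length is
  \<open>n = length p - 1\<close>.\<close>

definition edge_path :: "'a ugraph \<Rightarrow> 'a list \<Rightarrow> bool" where
  "edge_path X p \<longleftrightarrow>
     p \<noteq> [] \<and> set p \<subseteq> verts X \<and> successively (\<lambda>u v. {u, v} \<in> edges X) p"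

definition edge_path_betw :: "'a ugraph \<Rightarrow> 'a \<Rightarrow> 'a \<Rightarrow> 'a list \<Rightarrow> bool" where
  "edge_path_betw X a b p \<longleftrightarrow> edge_path X p \<and> hd p = a \<and> last p = b"

definition connected_graph :: "'a ugraph \<Rightarrow> bool" where
  "connected_graph X \<longleftrightarrow> (\<forall>a\<in>verts X. \<forall>b\<in>verts X. \<exists>p. edge_path_betw X a b p)"

text \<open>The graph metric on vertices; the value is only meaningful when \<open>a\<close> and \<open>b\<close> are joined by
  an edge path.\<close>

definition gdist :: "'a ugraph \<Rightarrow> 'a \<Rightarrow> 'a \<Rightarrow> nat" where
  "gdist X a b = (LEAST n. \<exists>p. edge_path_betw X a b p \<and> length p = Suc n)"

definition geodesic_edge_path :: "'a ugraph \<Rightarrow> 'a \<Rightarrow> 'a \<Rightarrow> 'a list \<Rightarrow> bool" where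
  "geodesic_edge_path X a b p \<longleftrightarrow> edge_path_betw X a b p \<and> length p = Suc (gdist X a b)"

definition circuit :: "'a ugraph \<Rightarrow> 'a list \<Rightarrow> bool" where
  "circuit X p \<longleftrightarrow>
     edge_path X p \<and> length p - 1 > 2 \<and> hd p = last p \<and> distinct (butlast p)"

definition girth :: "'a ugraph \<Rightarrow> enat" where
  "girth X = Inf {enat (length p - 1) | p. circuit X p}"

definition circuits_through :: "'a ugraph \<Rightarrow> 'a set \<Rightarrow> nat \<Rightarrow> 'a list set" where
  "circuits_through X e n =
     {p. circuit X p \<and> (\<exists>i. Suc i < length p \<and> {p ! i, p ! Suc i} = e) \<and> length p - 1 \<le> n}"

definition fine_graph :: "'a ugraph \<Rightarrow> bool" where
  "fine_graph X \<longleftrightarrow> (\<forall>e\<in>edges X. \<forall>n. finite (circuits_through X e n))"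

definition uniformly_fine_graph :: "'a ugraph \<Rightarrow> bool" where
  "uniformly_fine_graph X \<longleftrightarrow>
     (\<exists>f :: nat \<Rightarrow> nat. \<forall>e\<in>edges X. \<forall>n.
        finite (circuits_through X e n) \<and> card (circuits_through X e n) \<le> f n)"


section \<open>Graphs as geodesic metric spaces\<close>

text \<open>Points of the geometric realization are written in barycentric coordinates, that is, as
  functions from the vertices to the reals: \<open>edge_point u v t\<close> is the point at distance \<open>t\<close>
  from \<open>u\<close> on the edge \<open>{u, v}\<close>.\<close>

definition vertex_point :: "'a \<Rightarrow> 'a \<Rightarrow> real" where
  "vertex_point v = (\<lambda>_. 0)(v := 1)"

definition edge_point :: "'a \<Rightarrow> 'a \<Rightarrow> real \<Rightarrow> 'a \<Rightarrow> real" where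
  "edge_point u v t = (\<lambda>_. 0)(u := 1 - t, v := t)"

definition realization :: "'a ugraph \<Rightarrow> ('a \<Rightarrow> real) set" where
  "realization X = vertex_point ` verts X \<union>
     {edge_point u v t | u v t. {u, v} \<in> edges X \<and> 0 \<le> t \<and> t \<le> 1}"

text \<open>The path metric with edges of length 1: a shortest path from \<open>p\<close> to \<open>q\<close> either runs inside an
  edge containing both, or leaves \<open>p\<close> through an endpoint \<open>u\<close> of the edge carrying \<open>p\<close> (at
  distance \<open>1 - p u\<close>) and reaches \<open>q\<close> through an endpoint \<open>w\<close> of the edge carrying \<open>q\<close>.
  The infimum is over a finite set.\<close>

definition rdist :: "'a ugraph \<Rightarrow> ('a \<Rightarrow> real) \<Rightarrow> ('a \<Rightarrow> real) \<Rightarrow> real" where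
  "rdist X p q = Inf (
     {\<bar>s - t\<bar> | u v s t. {u, v} \<in> edges X \<and> 0 \<le> s \<and> s \<le> 1 \<and> 0 \<le> t \<and> t \<le> 1 \<and>
         p = edge_point u v s \<and> q = edge_point u v t} \<union>
     {(1 - p u) + real (gdist X u w) + (1 - q w) | u w. 0 < p u \<and> 0 < q w})"

definition gromov_product :: "('b \<Rightarrow> 'b \<Rightarrow> real) \<Rightarrow> 'b \<Rightarrow> 'b \<Rightarrow> 'b \<Rightarrow> real" where
  "gromov_product d w x y = (d x w + d y w - d x y) / 2"

definition gromov_hyperbolic :: "real \<Rightarrow> 'b set \<Rightarrow> ('b \<Rightarrow> 'b \<Rightarrow> real) \<Rightarrow> bool" where
  "gromov_hyperbolic \<delta> M d \<longleftrightarrow>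
     (\<forall>w\<in>M. \<forall>x\<in>M. \<forall>y\<in>M. \<forall>z\<in>M.
        gromov_product d w x z \<ge> min (gromov_product d w x y) (gromov_product d w y z) - \<delta>)"

definition hyperbolic_graph :: "'a ugraph \<Rightarrow> bool" where
  "hyperbolic_graph X \<longleftrightarrow>
     connected_graph X \<and> (\<exists>\<delta>\<ge>0. gromov_hyperbolic \<delta> (realization X) (rdist X))"

definition geodesic :: "'a ugraph \<Rightarrow> ('a \<Rightarrow> real) \<Rightarrow> ('a \<Rightarrow> real) \<Rightarrow> real \<Rightarrow> (real \<Rightarrow> 'a \<Rightarrow> real) \<Rightarrow> bool"
  where
  "geodesic X p q L \<gamma> \<longleftrightarrow>
     0 \<le> L \<and> \<gamma> ` {0..L} \<subseteq> realization X \<and> \<gamma> 0 = p \<and> \<gamma> L = q \<and>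
     (\<forall>s\<in>{0..L}. \<forall>t\<in>{0..L}. rdist X (\<gamma> s) (\<gamma> t) = \<bar>s - t\<bar>)"


section \<open>Tightness\<close>

definition tightness_constant :: "'a ugraph \<Rightarrow> real \<Rightarrow> bool" where
  "tightness_constant X \<delta>0 \<longleftrightarrow> \<delta>0 > 0 \<and>
     (\<forall>a\<in>verts X. \<forall>b\<in>verts X. \<forall>c\<in>verts X.
        (\<exists>L \<gamma>. geodesic X (vertex_point a) (vertex_point b) L \<gamma> \<and> vertex_point c \<in> \<gamma> ` {0..L}) \<longrightarrow>
        (\<forall>L \<gamma>. geodesic X (vertex_point a) (vertex_point b) L \<gamma> \<longrightarrow>
           (\<exists>t\<in>{0..L}. rdist X (vertex_point c) (\<gamma> t) \<le> \<delta>0)))"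

definition vertex_ball :: "'a ugraph \<Rightarrow> 'a \<Rightarrow> real \<Rightarrow> 'a set" where
  "vertex_ball X c \<rho> = {x \<in> verts X. real (gdist X c x) \<le> \<rho>}"

definition path_verts :: "('a \<Rightarrow> 'a \<Rightarrow> 'a list set) \<Rightarrow> 'a \<Rightarrow> 'a \<Rightarrow> 'a set" where
  "path_verts T a b = (\<Union>p\<in>T a b. set p)"

definition path_verts_near ::
  "'a ugraph \<Rightarrow> ('a \<Rightarrow> 'a \<Rightarrow> 'a list set) \<Rightarrow> 'a \<Rightarrow> 'a \<Rightarrow> nat \<Rightarrow> 'a set" where
  "path_verts_near X T a b r =
     \<Union>{path_verts T a' b' | a' b'.
        a' \<in> verts X \<and> b' \<in> verts X \<and> gdist X a a' \<le> r \<and> gdist X b b' \<le> r}"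

text \<open>The sets \<open>T a b\<close> are required to be nonempty: with empty sets the condition would be void.\<close>

definition tight_wrt :: "'a ugraph \<Rightarrow> real \<Rightarrow> bool" where
  "tight_wrt X \<delta>0 \<longleftrightarrow>
     (\<exists>T. (\<forall>a\<in>verts X. \<forall>b\<in>verts X. T a b \<noteq> {} \<and> (\<forall>p\<in>T a b. geodesic_edge_path X a b p)) \<and>
       (\<exists>P0::nat. \<forall>a\<in>verts X. \<forall>b\<in>verts X. \<forall>c\<in>path_verts T a b.
          finite (path_verts T a b \<inter> vertex_ball X c \<delta>0) \<and>
          card (path_verts T a b \<inter> vertex_ball X c \<delta>0) \<le> P0) \<and>
       (\<exists>P1 k1 :: nat. \<forall>r. \<forall>a\<in>verts X. \<forall>b\<in>verts X. \<forall>c\<in>path_verts T a b.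
          min (gdist X c a) (gdist X c b) \<ge> r + k1 \<longrightarrow>
          finite (path_verts_near X T a b r \<inter> vertex_ball X c \<delta>0) \<and>
          card (path_verts_near X T a b r \<inter> vertex_ball X c \<delta>0) \<le> P1))"

text \<open>Every constant with the bigon property is allowed, so in particular any choice that depends
  only on the hyperbolicity constant is covered. Since \<open>tight_wrt X\<close> passes from a constant to
  every smaller one, the condition is the same whether the bigon property is asked of \<open>X\<close>
  only or of all graphs with the same hyperbolicity constant.\<close>

definition tight_graph :: "'a ugraph \<Rightarrow> bool" where
  "tight_graph X \<longleftrightarrow>
     hyperbolic_graph X \<and> (\<forall>\<delta>0. tightness_constant X \<delta>0 \<longrightarrow> tight_wrt X \<delta>0)"


section \<open>Graph products and extension graphs\<close>

text \<open>The free product of the groups \<open>G v\<close>, \<open>v \<in> V\<close>: words in syllables \<open>(v, g)\<close> modulo deleting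
  trivial syllables and multiplying adjacent syllables from the same group.\<close>

definition syllable_words :: "'v set \<Rightarrow> ('v \<Rightarrow> ('g, 'm) monoid_scheme) \<Rightarrow> ('v \<times> 'g) list set" where
  "syllable_words V G = lists (SIGMA v:V. carrier (G v))"

inductive word_eq ::
  "'v set \<Rightarrow> ('v \<Rightarrow> ('g, 'm) monoid_scheme) \<Rightarrow> ('v \<times> 'g) list \<Rightarrow> ('v \<times> 'g) list \<Rightarrow> bool"
  for V G where
  refl: "x \<in> syllable_words V G \<Longrightarrow> word_eq V G x x"
| sym: "word_eq V G x y \<Longrightarrow> word_eq V G y x"
| trans: "word_eq V G x y \<Longrightarrow> word_eq V G y z \<Longrightarrow> word_eq V G x z"
| unit: "x \<in> syllable_words V G \<Longrightarrow> y \<in> syllable_words V G \<Longrightarrow> v \<in> V \<Longrightarrow>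
    word_eq V G (x @ [(v, \<one>\<^bsub>G v\<^esub>)] @ y) (x @ y)"
| merge: "x \<in> syllable_words V G \<Longrightarrow> y \<in> syllable_words V G \<Longrightarrow> v \<in> V \<Longrightarrow>
    g \<in> carrier (G v) \<Longrightarrow> h \<in> carrier (G v) \<Longrightarrow>
    word_eq V G (x @ [(v, g), (v, h)] @ y) (x @ [(v, g \<otimes>\<^bsub>G v\<^esub> h)] @ y)"

definition word_class ::
  "'v set \<Rightarrow> ('v \<Rightarrow> ('g, 'm) monoid_scheme) \<Rightarrow> ('v \<times> 'g) list \<Rightarrow> ('v \<times> 'g) list set" where
  "word_class V G x = {y. word_eq V G x y}"

definition free_product ::
  "'v set \<Rightarrow> ('v \<Rightarrow> ('g, 'm) monoid_scheme) \<Rightarrow> ('v \<times> 'g) list set monoid" where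
  "free_product V G =
     \<lparr>carrier = word_class V G ` syllable_words V G,
      mult = (\<lambda>A B. \<Union>x\<in>A. \<Union>y\<in>B. word_class V G (x @ y)),
      one = word_class V G []\<rparr>"

definition normal_closure :: "('a, 'b) monoid_scheme \<Rightarrow> 'a set \<Rightarrow> 'a set" where
  "normal_closure H S = \<Inter>{N. N \<lhd> H \<and> S \<subseteq> N}"

definition graph_product_relators ::
  "'v ugraph \<Rightarrow> ('v \<Rightarrow> ('g, 'm) monoid_scheme) \<Rightarrow> ('v \<times> 'g) list set set" where
  "graph_product_relators \<Gamma> G =
     (let F = free_product (verts \<Gamma>) G; c = word_class (verts \<Gamma>) G in
      {c [(v, g)] \<otimes>\<^bsub>F\<^esub> c [(w, h)] \<otimes>\<^bsub>F\<^esub> inv\<^bsub>F\<^esub> c [(v, g)] \<otimes>\<^bsub>F\<^esub> inv\<^bsub>F\<^esub> c [(w, h)] | v w g h.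
         {v, w} \<in> edges \<Gamma> \<and> g \<in> carrier (G v) \<and> h \<in> carrier (G w)})"

definition graph_product ::
  "'v ugraph \<Rightarrow> ('v \<Rightarrow> ('g, 'm) monoid_scheme) \<Rightarrow> ('v \<times> 'g) list set set monoid" where
  "graph_product \<Gamma> G =
     free_product (verts \<Gamma>) G Mod
       normal_closure (free_product (verts \<Gamma>) G) (graph_product_relators \<Gamma> G)"

text \<open>The vertex group \<open>G v\<close>, as a subgroup of the graph product.\<close>

definition vertex_group ::
  "'v ugraph \<Rightarrow> ('v \<Rightarrow> ('g, 'm) monoid_scheme) \<Rightarrow> 'v \<Rightarrow> ('v \<times> 'g) list set set set" where
  "vertex_group \<Gamma> G v =
     (let F = free_product (verts \<Gamma>) G in
      (\<lambda>g. normal_closure F (graph_product_relators \<Gamma> G) #>\<^bsub>F\<^esub> word_class (verts \<Gamma>) G [(v, g)])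
        ` carrier (G v))"

definition extension_verts ::
  "'v ugraph \<Rightarrow> ('v \<Rightarrow> ('g, 'm) monoid_scheme) \<Rightarrow> ('v \<times> 'g) list set set set set" where
  "extension_verts \<Gamma> G =
     (let P = graph_product \<Gamma> G in
      {(\<lambda>x. g \<otimes>\<^bsub>P\<^esub> x \<otimes>\<^bsub>P\<^esub> inv\<^bsub>P\<^esub> g) ` vertex_group \<Gamma> G v | v g. v \<in> verts \<Gamma> \<and> g \<in> carrier P})"

definition extension_graph ::
  "'v ugraph \<Rightarrow> ('v \<Rightarrow> ('g, 'm) monoid_scheme) \<Rightarrow> ('v \<times> 'g) list set set set ugraph" where
  "extension_graph \<Gamma> G =
     \<lparr>verts = extension_verts \<Gamma> G,
      edges = {{A, B} | A B. A \<in> extension_verts \<Gamma> G \<and> B \<in> extension_verts \<Gamma> G \<and> A \<noteq> B \<and>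
        (\<forall>a\<in>A. \<forall>b\<in>B. a \<otimes>\<^bsub>graph_product \<Gamma> G\<^esub> b = b \<otimes>\<^bsub>graph_product \<Gamma> G\<^esub> a)}\<rparr>"

end

theory Submission
  imports Defs "HOL-Algebra.Bij"
begin

text \<open>
  Let \<open>P\<close> be the graph product. The extension graph is the union of the translates of \<open>\<Gamma>\<close>, one
  for each chamber \<open>g\<close> of \<open>P\<close>, and each translate is an isometric copy of \<open>\<Gamma>\<close>, because sending
  \<open>g G\<^sub>v g\<^sup>-\<^sup>1\<close> to \<open>v\<close> is a retraction. The proof rests on the way in which the copies are glued.

  \<^emph>\<open>Stars separate.\<close> Let \<open>z = g G\<^sub>v g\<^sup>-\<^sup>1\<close>. For \<open>s \<noteq> 1\<close> in \<open>G\<^sub>v\<close>, the copies of \<open>g\<close> and \<open>g s\<close> share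
  the star of \<open>v\<close>, and beyond it they lie on different sides of the star of \<open>z\<close> (\<open>chamber_step\<close>). No normal
  form theorem is needed for this: \<open>P\<close> acts on \<open>P \<times> G\<^sub>v\<close> from the right by letting a letter \<open>t\<close> of
  \<open>G\<^sub>v\<close> change the second coordinate exactly when the first one lies in the subgroup generated by the
  star of \<open>v\<close>. That this respects the defining relations is immediate, and the second coordinate of the
  image of the base point is the side of \<open>z\<close> on which an element lies (\<open>sector\<close>).

  \<^emph>\<open>Circuits are cut by shortcuts.\<close> Moving a chamber across a star brings it closer to everything
  beyond the star and leaves its distance to the star unchanged. Hence a finite set of vertices lies in one copy
  unless some star separates two of them (\<open>common_copy_or_wall\<close>, a Helly property). A circuit
  that is not contained in a copy is therefore cut by a path of length at most two, through the centre of a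
  star, into two circuits (\<open>cyc_split\<close>). It follows that the extension graph, too, has girth above 20
  (\<open>girth_Y\<close>), so both of the new circuits are much shorter than the old one.

  \<^emph>\<open>Fineness.\<close> A circuit that is not in a copy is determined by two shorter circuits, the second of
  which passes through an edge spanned by vertices of the first; an edge lies in finitely many copies if the vertex
  groups are finite. Induction on the length bounds the number of circuits through an edge (\<open>fine\<close>).

  \<^emph>\<open>Hyperbolicity.\<close> Cut a geodesic polygon with at most four sides again and again, always keeping the part
  that contains a given edge. A shortcut cannot join two points of the same side, nor two points close to the same side,
  since together with the geodesic between them it would contain a circuit of length at most 20. So
  each side keeps a single segment, and the segments are joined by corners of length at most five, until the
  circuit lies in a copy (\<open>polygon_reduction\<close>). For triangles this transfers the four-point condition of \<open>\<Gamma>\<close>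
  to slimness of triangles in the extension graph (\<open>slim_Y\<close>); the converse holds since \<open>\<Gamma>\<close> is
  isometrically embedded.

  \<^emph>\<open>Tightness.\<close> Take all geodesics. If \<open>x\<close> is a vertex of a geodesic \<open>\<beta>\<close> that runs close to the geodesic
  \<open>\<alpha>\<close> on both sides of \<open>x\<close>, but \<open>x\<close> is not on \<open>\<alpha>\<close>, then a window of \<open>\<beta>\<close> around \<open>x\<close>, a piece of \<open>\<alpha>\<close> and two
  connections form a quadrilateral of bounded length. It reduces to a circuit in one copy that contains \<open>x\<close> and
  at least four consecutive vertices of \<open>\<alpha>\<close> (\<open>window\<close>). Two vertices at distance three or more lie in at most one
  copy, so uniform fineness of \<open>\<Gamma>\<close> bounds the number of such \<open>x\<close> near a given point of \<open>\<alpha>\<close>.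
\<close>

section \<open>Graphs and geodesics\<close>

text \<open>A circuit without its repeated last vertex. Dropping the repetition makes the closing edge, from the last
  vertex back to the first, a distinguished edge that can be kept fixed while the rest of the circuit is modified.\<close>

definition cyc :: "'a ugraph \<Rightarrow> 'a list \<Rightarrow> bool" where
  "cyc X R \<longleftrightarrow> edge_path X R \<and> distinct R \<and> 3 \<le> length R \<and> {last R, hd R} \<in> edges X"

definition geodesic_list :: "'a ugraph \<Rightarrow> 'a list \<Rightarrow> bool" where
  "geodesic_list X p \<longleftrightarrow> edge_path X p \<and>
     (\<forall>i j. i \<le> j \<longrightarrow> j < length p \<longrightarrow> gdist X (p ! i) (p ! j) = j - i)"

lemma circuit_of_cyc: "cyc X R \<Longrightarrow> circuit X (R @ [hd R])"
  unfolding cyc_def circuit_def edge_path_def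
  by (auto simp: successively_append_iff butlast_append hd_append)

lemma cyc_of_circuit:
  assumes "circuit X p" shows "cyc X (butlast p)" and "p = butlast p @ [hd p]"
proof -
  have p: "p \<noteq> []" "length p > 3" "hd p = last p" using assms by (auto simp: circuit_def edge_path_def)
  obtain R x where R: "p = R @ [x]" using p(1) by (metis append_butlast_last_id)
  have "R \<noteq> []" using p R by auto
  then show "cyc X (butlast p)" "p = butlast p @ [hd p]"
    using assms p unfolding R by (auto simp: circuit_def cyc_def edge_path_def successively_append_iff)
qed

lemma girth_cyc:
  assumes "girth X > 20" "cyc X R"
  shows "21 \<le> length R"
proof -
  have "girth X \<le> enat (length R)"
    unfolding girth_def using circuit_of_cyc[OF assms(2)] by (intro Inf_lower) (auto intro!: exI[of _ "R @ [hd R]"])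
  then have "enat 20 < enat (length R)" using assms(1) by (metis enat_numeral less_le_trans numeral_eq_enat)
  then show ?thesis by simp
qed

lemma edge_path_iff_nth:
  "edge_path X p \<longleftrightarrow> p \<noteq> [] \<and> set p \<subseteq> verts X \<and> (\<forall>i. Suc i < length p \<longrightarrow> {p ! i, p ! Suc i} \<in> edges X)"
  by (auto simp: edge_path_def successively_conv_nth)

lemma edge_path_append:
  "p \<noteq> [] \<Longrightarrow> q \<noteq> [] \<Longrightarrow> edge_path X (p @ q) \<longleftrightarrow>
     edge_path X p \<and> edge_path X q \<and> {last p, hd q} \<in> edges X"
  by (auto simp: edge_path_def successively_append_iff)

lemma edge_path_rev: "edge_path X p \<Longrightarrow> edge_path X (rev p)"
  by (auto simp: edge_path_def insert_commute successively_rev elim!: successively_mono[rotated])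

lemma edge_path_take: "edge_path X p \<Longrightarrow> 0 < n \<Longrightarrow> edge_path X (take n p)"
  by (auto simp: edge_path_iff_nth dest: in_set_takeD)

lemma edge_path_drop: "edge_path X p \<Longrightarrow> n < length p \<Longrightarrow> edge_path X (drop n p)"
  by (auto simp: edge_path_iff_nth dest: in_set_dropD)

lemma cyc_rotate1: "cyc X R \<Longrightarrow> cyc X (rotate1 R)"
proof (cases R)
  case (Cons a S)
  assume "cyc X R"
  then show ?thesis using Cons
    by (cases S) (auto simp: cyc_def edge_path_def successively_append_iff successively_Cons hd_append)
qed (simp add: cyc_def)

lemma cyc_rotate: "cyc X R \<Longrightarrow> cyc X (rotate n R)"
  by (induction n) (auto simp: cyc_rotate1)

locale conn_graph =
  fixes X :: "'a ugraph"
  assumes simplicial: "simplicial_graph X" and connected: "connected_graph X"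
begin

abbreviation (input) adj where "adj x y \<equiv> {x, y} \<in> edges X"
abbreviation "dd \<equiv> gdist X"

lemma adj_verts: "adj x y \<Longrightarrow> x \<in> verts X" "adj x y \<Longrightarrow> y \<in> verts X" "adj x y \<Longrightarrow> x \<noteq> y"
  using simplicial unfolding simplicial_graph_def by (metis doubleton_eq_iff)+

lemma not_adj_self [simp]: "\<not> adj x x" using adj_verts(3) by blast

lemma adj_sym: "adj x y \<longleftrightarrow> adj y x" by (simp add: insert_commute)

lemma gdist_le: "edge_path_betw X a b p \<Longrightarrow> Suc (dd a b) \<le> length p"
proof -
  assume p: "edge_path_betw X a b p"
  then obtain n where n: "length p = Suc n" by (cases p) (auto simp: edge_path_betw_def edge_path_def)
  have "dd a b \<le> n" unfolding gdist_def by (rule Least_le) (use p n in auto)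
  then show ?thesis using n by simp
qed

lemma geodesic_ex:
  assumes "a \<in> verts X" "b \<in> verts X"
  shows "\<exists>p. geodesic_edge_path X a b p"
proof -
  obtain p where p: "edge_path_betw X a b p" using connected assms unfolding connected_graph_def by blast
  then obtain n where n: "length p = Suc n" by (cases p) (auto simp: edge_path_betw_def edge_path_def)
  have "\<exists>p. edge_path_betw X a b p \<and> length p = Suc (dd a b)"
    unfolding gdist_def by (rule LeastI_ex) (use p n in blast)
  then show ?thesis by (simp add: geodesic_edge_path_def)
qed

lemma gdist_self [simp]: "a \<in> verts X \<Longrightarrow> dd a a = 0"
  using gdist_le[of a a "[a]"] by (simp add: edge_path_betw_def edge_path_def)

lemma gdist_zero: "a \<in> verts X \<Longrightarrow> b \<in> verts X \<Longrightarrow> dd a b = 0 \<longleftrightarrow> a = b"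
proof
  assume "a \<in> verts X" "b \<in> verts X" "dd a b = 0"
  then obtain p where "edge_path_betw X a b p" "length p = 1"
    using geodesic_ex[of a b] by (auto simp: geodesic_edge_path_def)
  then show "a = b" by (cases p) (auto simp: edge_path_betw_def)
qed auto

lemma gdist_sym_le: "a \<in> verts X \<Longrightarrow> b \<in> verts X \<Longrightarrow> dd b a \<le> dd a b"
proof -
  assume "a \<in> verts X" "b \<in> verts X"
  then obtain p where p: "edge_path_betw X a b p" "length p = Suc (dd a b)"
    using geodesic_ex[of a b] by (auto simp: geodesic_edge_path_def)
  then have "edge_path_betw X b a (rev p)"
    by (auto simp: edge_path_betw_def edge_path_rev hd_rev last_rev)
  then show ?thesis using gdist_le p by fastforce
qed

lemma gdist_sym: "a \<in> verts X \<Longrightarrow> b \<in> verts X \<Longrightarrow> dd a b = dd b a"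
  using gdist_sym_le by (metis le_antisym)

lemma gdist_triangle:
  assumes "a \<in> verts X" "b \<in> verts X" "c \<in> verts X"
  shows "dd a c \<le> dd a b + dd b c"
proof -
  obtain p where p: "edge_path_betw X a b p" "length p = Suc (dd a b)"
    using geodesic_ex[of a b] assms by (auto simp: geodesic_edge_path_def)
  obtain q where q: "edge_path_betw X b c q" "length q = Suc (dd b c)"
    using geodesic_ex[of b c] assms by (auto simp: geodesic_edge_path_def)
  show ?thesis
  proof (cases "tl q = []")
    case True
    then have "b = c" using q by (cases q) (auto simp: edge_path_betw_def)
    then show ?thesis by simp
  next
    case False
    then obtain q' where q': "q = b # q'" "q' \<noteq> []" using q by (cases q) (auto simp: edge_path_betw_def)
    have "edge_path_betw X a c (p @ q')"
      using p q q' edge_path_append[of p q' X] by (auto simp: edge_path_betw_def edge_path_def successively_Cons hd_append)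
    then show ?thesis using gdist_le p q q' by fastforce
  qed
qed

lemma gdist_adj: "adj a b \<Longrightarrow> dd a b = 1"
proof -
  assume e: "adj a b"
  then have "edge_path_betw X a b [a, b]" using adj_verts by (auto simp: edge_path_betw_def edge_path_def)
  then have "dd a b \<le> 1" using gdist_le by fastforce
  moreover have "dd a b \<noteq> 0" using gdist_zero adj_verts e by blast
  ultimately show ?thesis by simp
qed

lemma gdist_path: "edge_path X p \<Longrightarrow> i \<le> j \<Longrightarrow> j < length p \<Longrightarrow> dd (p ! i) (p ! j) \<le> j - i"
proof (induction "j - i" arbitrary: j)
  case 0
  then have "p ! i \<in> verts X" "i = j" by (auto simp: edge_path_iff_nth)
  then show ?case by simp
next
  case (Suc n)
  then obtain j' where j': "j = Suc j'" by (cases j) auto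
  have "dd (p ! i) (p ! j') \<le> j' - i" using Suc j' by auto
  moreover have "adj (p ! j') (p ! j)" using Suc j' by (auto simp: edge_path_iff_nth)
  then have "dd (p ! j') (p ! j) = 1" by (rule gdist_adj)
  moreover have "p ! i \<in> verts X" "p ! j \<in> verts X" "p ! j' \<in> verts X"
    using Suc.prems j' by (auto simp: edge_path_iff_nth subset_iff)
  ultimately show ?case using gdist_triangle[of "p ! i" "p ! j'" "p ! j"] Suc j' by linarith
qed

lemma geodesic_listI:
  assumes "geodesic_edge_path X a b p" shows "geodesic_list X p"
proof -
  have p: "edge_path X p" "hd p = a" "last p = b" "length p = Suc (dd a b)" and ne: "p \<noteq> []"
    using assms by (auto simp: geodesic_edge_path_def edge_path_betw_def edge_path_def)
  have "dd (p ! i) (p ! j) = j - i" if ij: "i \<le> j" "j < length p" for i j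
  proof -
    have v: "p ! k \<in> verts X" if "k < length p" for k using p that by (auto simp: edge_path_iff_nth)
    let ?n = "length p - 1"
    have 0: "p ! 0 = a" "p ! ?n = b" using p ne by (auto simp: hd_conv_nth last_conv_nth)
    have "dd a b \<le> dd (p ! 0) (p ! i) + (dd (p ! i) (p ! j) + dd (p ! j) (p ! ?n))"
      using gdist_triangle[of "p ! 0" "p ! i" "p ! ?n"] gdist_triangle[of "p ! i" "p ! j" "p ! ?n"] v ij 0
      by (smt (verit) One_nat_def add_le_mono diff_Suc_less le_trans length_greater_0_conv nat_add_left_cancel_le ne order_le_less_trans)
    moreover have "dd (p ! 0) (p ! i) \<le> i" "dd (p ! i) (p ! j) \<le> j - i" "dd (p ! j) (p ! ?n) \<le> ?n - j"
      using gdist_path[OF p(1), of 0 i] gdist_path[OF p(1), of i j] gdist_path[OF p(1), of j ?n] ij by auto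
    ultimately show ?thesis using p ij by linarith
  qed
  then show ?thesis using p by (simp add: geodesic_list_def)
qed

lemma geodesic_list_imp: "geodesic_list X p \<Longrightarrow> geodesic_edge_path X (hd p) (last p) p"
proof -
  assume g: "geodesic_list X p"
  then have ne: "p \<noteq> []" by (auto simp: geodesic_list_def edge_path_def)
  have "dd (p ! 0) (p ! (length p - 1)) = length p - 1" using g ne unfolding geodesic_list_def by simp
  then show ?thesis using g ne
    by (auto simp: geodesic_edge_path_def edge_path_betw_def geodesic_list_def hd_conv_nth last_conv_nth)
qed

lemma geodesic_list_nth: "geodesic_list X p \<Longrightarrow> i < length p \<Longrightarrow> j < length p \<Longrightarrow>
    dd (p ! i) (p ! j) = (if i \<le> j then j - i else i - j)"
proof -
  assume g: "geodesic_list X p" "i < length p" "j < length p"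
  then have "p ! i \<in> verts X" "p ! j \<in> verts X" by (auto simp: geodesic_list_def edge_path_def)
  then show ?thesis using g gdist_sym[of "p ! i" "p ! j"] by (auto simp: geodesic_list_def)
qed

lemma geodesic_list_rev: "geodesic_list X p \<Longrightarrow> geodesic_list X (rev p)"
  unfolding geodesic_list_def[of X "rev p"]
  using geodesic_list_nth[of p] by (auto simp: edge_path_rev rev_nth geodesic_list_def)

lemma geodesic_list_distinct: "geodesic_list X p \<Longrightarrow> distinct p"
proof -
  assume g: "geodesic_list X p"
  have "p ! i \<noteq> p ! j" if "i < j" "j < length p" for i j
  proof
    assume e: "p ! i = p ! j"
    have "p ! j \<in> verts X" using g that by (auto simp: geodesic_list_def edge_path_def)
    then have "dd (p ! i) (p ! j) = 0" using e by simp
    then show False using geodesic_list_nth[OF g, of i j] that by auto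
  qed
  then show ?thesis by (metis distinct_conv_nth linorder_neqE_nat)
qed

lemma geodesic_list_take: "geodesic_list X p \<Longrightarrow> 0 < n \<Longrightarrow> geodesic_list X (take n p)"
  by (auto simp: geodesic_list_def edge_path_take)

lemma geodesic_list_drop: "geodesic_list X p \<Longrightarrow> n < length p \<Longrightarrow> geodesic_list X (drop n p)"
  by (auto simp: geodesic_list_def edge_path_drop)

lemma geodesic_list_verts: "geodesic_list X p \<Longrightarrow> set p \<subseteq> verts X"
  by (auto simp: geodesic_list_def edge_path_def)

end

text \<open>Applied to the embeddings of \<open>\<Gamma>\<close> and to the retraction onto \<open>\<Gamma>\<close>, this makes the copies isometric.\<close>

lemma gdist_map_le:
  assumes "conn_graph X" "conn_graph Y" "\<And>x. x \<in> verts X \<Longrightarrow> f x \<in> verts Y"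
    "\<And>x y. {x, y} \<in> edges X \<Longrightarrow> {f x, f y} \<in> edges Y" "a \<in> verts X" "b \<in> verts X"
  shows "gdist Y (f a) (f b) \<le> gdist X a b"
proof -
  obtain p where p: "edge_path_betw X a b p" "length p = Suc (gdist X a b)"
    using conn_graph.geodesic_ex[OF assms(1,5,6)] by (auto simp: geodesic_edge_path_def)
  have "edge_path_betw Y (f a) (f b) (map f p)"
    using p assms by (auto simp: edge_path_betw_def edge_path_iff_nth hd_map last_map)
  then show ?thesis using conn_graph.gdist_le[OF assms(2)] p by fastforce
qed

section \<open>The four-point condition and slim triangles\<close>

text \<open>Gromov's four-point inequality, for vertices only and with the base point eliminated: of the three sums of
  opposite distances, the two largest differ by at most \<open>D\<close>.\<close>

definition fourpt :: "'a ugraph \<Rightarrow> nat \<Rightarrow> bool" where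
  "fourpt X D \<longleftrightarrow> (\<forall>x\<in>verts X. \<forall>y\<in>verts X. \<forall>z\<in>verts X. \<forall>w\<in>verts X.
     gdist X x z + gdist X y w \<le> max (gdist X x y + gdist X z w) (gdist X x w + gdist X y z) + D)"

context conn_graph
begin

lemma realization_support:
  assumes p: "p \<in> realization X" and u: "0 < p u"
  shows "u \<in> verts X" "p u \<le> 1" "\<And>w. 0 < p w \<Longrightarrow> dd u w \<le> 1"
proof -
  have "u \<in> verts X \<and> p u \<le> 1 \<and> (\<forall>w. 0 < p w \<longrightarrow> dd u w \<le> 1)"
    using p unfolding realization_def
  proof
    assume "p \<in> vertex_point ` verts X"
    then obtain v where v: "v \<in> verts X" "p = vertex_point v" by blast
    have sv: "w = v" if "0 < p w" for w using that v(2) by (auto simp: vertex_point_def split: if_splits)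
    have "dd u w \<le> 1" if "0 < p w" for w using sv[OF that] sv[OF u] v(1) by simp
    moreover have "p u \<le> 1" using v(2) sv[OF u] by (simp add: vertex_point_def)
    ultimately show ?thesis using sv[OF u] v(1) by blast
  next
    assume "p \<in> {edge_point u v t |u v t. {u, v} \<in> edges X \<and> 0 \<le> t \<and> t \<le> 1}"
    then obtain a b t where e: "adj a b" "0 \<le> t" "t \<le> 1" "p = edge_point a b t" by blast
    then have s: "w = a \<or> w = b" if "0 < p w" for w using that by (auto simp: edge_point_def split: if_splits)
    have "dd a b = 1" "dd b a = 1" using gdist_adj e adj_sym[of a b] by auto
    then have "dd u w \<le> 1" if "0 < p w" for w using s[OF that] s[OF u] adj_verts[OF e(1)] by auto
    moreover have "u \<in> verts X" using s[OF u] adj_verts[OF e(1)] by blast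
    moreover have "p u \<le> 1" using e by (auto simp: edge_point_def)
    ultimately show ?thesis by blast
  qed
  then show "u \<in> verts X" "p u \<le> 1" "\<And>w. 0 < p w \<Longrightarrow> dd u w \<le> 1" by auto
qed

lemma realization_ex_support:
  assumes p: "p \<in> realization X" shows "\<exists>u. 0 < p u"
  using p unfolding realization_def
proof
  assume "p \<in> vertex_point ` verts X"
  then obtain v where v: "v \<in> verts X" "p = vertex_point v" by blast
  then have "0 < p v" by (simp add: vertex_point_def)
  then show ?thesis by blast
next
  assume "p \<in> {edge_point u v t |u v t. {u, v} \<in> edges X \<and> 0 \<le> t \<and> t \<le> 1}"
  then obtain a b t where e: "adj a b" "0 \<le> t" "t \<le> 1" "p = edge_point a b t" by blast
  then have "p a = 1 - t" "p b = t" using adj_verts(3)[OF e(1)] by (auto simp: edge_point_def)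
  then have "0 < p a \<or> 0 < p b" by auto
  then show ?thesis by blast
qed

text \<open>A point of the realization is within distance 1 of every vertex that supports it, so the metric of the
  realization is the metric of the vertex set up to an error of 2.\<close>

lemma rdist_approx:
  assumes p: "p \<in> realization X" and q: "q \<in> realization X" and u: "0 < p u" and w: "0 < q w"
  shows "rdist X p q \<le> real (dd u w) + 2" "real (dd u w) \<le> rdist X p q + 2"
proof -
  define A where "A = {\<bar>s - t\<bar> | a b s t. {a, b} \<in> edges X \<and> 0 \<le> s \<and> s \<le> 1 \<and> 0 \<le> t \<and> t \<le> 1 \<and>
         p = edge_point a b s \<and> q = edge_point a b t} \<union>
     {(1 - p a) + real (dd a b) + (1 - q b) | a b. 0 < p a \<and> 0 < q b}"
  have rd: "rdist X p q = Inf A" by (simp add: rdist_def A_def)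
  have mem: "(1 - p u) + real (dd u w) + (1 - q w) \<in> A" using u w by (auto simp: A_def)
  have low: "real (dd u w) - 2 \<le> r \<and> 0 \<le> r" if "r \<in> A" for r
    using that unfolding A_def
  proof
    assume "r \<in> {\<bar>s - t\<bar> | a b s t. {a, b} \<in> edges X \<and> 0 \<le> s \<and> s \<le> 1 \<and> 0 \<le> t \<and> t \<le> 1 \<and>
         p = edge_point a b s \<and> q = edge_point a b t}"
    then obtain a b s t where e: "r = \<bar>s - t\<bar>" "adj a b" "p = edge_point a b s" "q = edge_point a b t" by blast
    have "u = a \<or> u = b" "w = a \<or> w = b" using u w e by (auto simp: edge_point_def split: if_splits)
    moreover have "dd a b = 1" "dd b a = 1" using gdist_adj e adj_sym[of a b] by auto
    ultimately have "dd u w \<le> 1" using adj_verts[OF e(2)] by auto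
    then show ?thesis using e by simp
  next
    assume "r \<in> {(1 - p a) + real (dd a b) + (1 - q b) | a b. 0 < p a \<and> 0 < q b}"
    then obtain a b where r: "r = (1 - p a) + real (dd a b) + (1 - q b)" "0 < p a" "0 < q b" by blast
    have "dd u w \<le> dd u a + dd a b + dd b w"
      using gdist_triangle[of u a w] gdist_triangle[of a b w] realization_support(1)[OF p] realization_support(1)[OF q] u w r
      by fastforce
    moreover have "dd u a \<le> 1" "dd b w \<le> 1"
      using realization_support(3)[OF p u] realization_support(3)[OF q r(3)] r w by auto
    ultimately have "real (dd u w) \<le> real (dd a b) + 2" by linarith
    then show ?thesis using r realization_support(2)[OF p r(2)] realization_support(2)[OF q r(3)] by linarith
  qed
  have bdd: "bdd_below A" using low by (auto intro!: bdd_belowI[of _ 0])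
  have "Inf A \<le> (1 - p u) + real (dd u w) + (1 - q w)" by (rule cInf_lower[OF mem bdd])
  then have "Inf A \<le> real (dd u w) + 2" using u w by simp
  moreover have "real (dd u w) - 2 \<le> Inf A"
    by (rule cInf_greatest) (use mem low in auto)
  ultimately show "rdist X p q \<le> real (dd u w) + 2" "real (dd u w) \<le> rdist X p q + 2"
    unfolding rd by linarith+
qed

lemma vertex_point_support: "v \<in> verts X \<Longrightarrow> vertex_point v \<in> realization X \<and> 0 < vertex_point v v"
  by (auto simp: realization_def vertex_point_def)

lemma hyperbolic_iff_fourpt: "hyperbolic_graph X \<longleftrightarrow> (\<exists>D. fourpt X D)"
proof
  assume "hyperbolic_graph X"
  then obtain \<delta> where \<delta>: "\<delta> \<ge> 0" "gromov_hyperbolic \<delta> (realization X) (rdist X)"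
    by (auto simp: hyperbolic_graph_def)
  define D where "D = nat \<lceil>2 * \<delta> + 8\<rceil>"
  have D: "2 * \<delta> + 8 \<le> real D" unfolding D_def by linarith
  have "fourpt X D" unfolding fourpt_def
  proof (intro ballI)
    fix x y z w assume v: "x \<in> verts X" "y \<in> verts X" "z \<in> verts X" "w \<in> verts X"
    define R where "R a b = rdist X (vertex_point a) (vertex_point b)" for a b
    have ap: "R a b \<le> real (dd a b) + 2" "real (dd a b) \<le> R a b + 2" if "a \<in> verts X" "b \<in> verts X" for a b
      unfolding R_def using rdist_approx vertex_point_support that by blast+
    have "gromov_product (rdist X) (vertex_point w) (vertex_point x) (vertex_point z) \<ge>
      min (gromov_product (rdist X) (vertex_point w) (vertex_point x) (vertex_point y))
        (gromov_product (rdist X) (vertex_point w) (vertex_point y) (vertex_point z)) - \<delta>"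
      using \<delta>(2) v vertex_point_support unfolding gromov_hyperbolic_def by blast
    then have "R x z + R y w \<le> R x y + R z w + 2 * \<delta> \<or> R x z + R y w \<le> R x w + R y z + 2 * \<delta>"
      unfolding gromov_product_def R_def[symmetric] by (auto simp: min_def field_simps split: if_splits)
    then have "real (dd x z) + real (dd y w) \<le> real (dd x y) + real (dd z w) + real D \<or>
        real (dd x z) + real (dd y w) \<le> real (dd x w) + real (dd y z) + real D"
      using ap(2)[OF v(1,3)] ap(2)[OF v(2,4)] ap(1)[OF v(1,2)] ap(1)[OF v(3,4)] ap(1)[OF v(1,4)] ap(1)[OF v(2,3)] D
      by (elim disjE) (rule disjI1, linarith, rule disjI2, linarith)
    then show "dd x z + dd y w \<le> max (dd x y + dd z w) (dd x w + dd y z) + D" by linarith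
  qed
  then show "\<exists>D. fourpt X D" ..
next
  assume "\<exists>D. fourpt X D"
  then obtain D where D: "fourpt X D" ..
  have "gromov_hyperbolic ((real D + 12) / 2) (realization X) (rdist X)"
    unfolding gromov_hyperbolic_def
  proof (intro ballI)
    fix w x y z assume r: "w \<in> realization X" "x \<in> realization X" "y \<in> realization X" "z \<in> realization X"
    obtain w' x' y' z' where s: "0 < w w'" "0 < x x'" "0 < y y'" "0 < z z'" using realization_ex_support r by metis
    have v: "w' \<in> verts X" "x' \<in> verts X" "y' \<in> verts X" "z' \<in> verts X" using realization_support(1) r s by blast+
    have "dd x' z' + dd y' w' \<le> max (dd x' y' + dd z' w') (dd x' w' + dd y' z') + D"
      using D v unfolding fourpt_def by blast
    then have "real (dd x' z') + real (dd y' w') \<le> real (dd x' y') + real (dd z' w') + real D \<or>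
        real (dd x' z') + real (dd y' w') \<le> real (dd x' w') + real (dd y' z') + real D"
      by linarith
    then have "rdist X x z + rdist X y w \<le> rdist X x y + rdist X z w + (real D + 12) \<or>
        rdist X x z + rdist X y w \<le> rdist X x w + rdist X y z + (real D + 12)"
      using rdist_approx(1)[OF r(2,4) s(2,4)] rdist_approx(1)[OF r(3,1) s(3,1)] rdist_approx(2)[OF r(2,3) s(2,3)]
        rdist_approx(2)[OF r(4,1) s(4,1)] rdist_approx(2)[OF r(2,1) s(2,1)] rdist_approx(2)[OF r(3,4) s(3,4)]
      by (elim disjE) (rule disjI1, linarith, rule disjI2, linarith)
    then show "gromov_product (rdist X) w x z \<ge>
        min (gromov_product (rdist X) w x y) (gromov_product (rdist X) w y z) - (real D + 12) / 2"
      unfolding gromov_product_def by (auto simp: min_def field_simps split: if_splits)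
  qed
  then show "hyperbolic_graph X" unfolding hyperbolic_graph_def using connected
    by (intro conjI exI[of _ "(real D + 12) / 2"]) auto
qed

text \<open>Triangles are given by their sides, as geodesic lists of vertices that run around the triangle.\<close>

definition slim :: "nat \<Rightarrow> bool" where
  "slim K \<longleftrightarrow> (\<forall>\<alpha> \<beta> \<gamma>. geodesic_list X \<alpha> \<longrightarrow> geodesic_list X \<beta> \<longrightarrow> geodesic_list X \<gamma> \<longrightarrow>
     last \<alpha> = hd \<beta> \<longrightarrow> last \<beta> = hd \<gamma> \<longrightarrow> last \<gamma> = hd \<alpha> \<longrightarrow>
     (\<forall>x\<in>set \<alpha>. \<exists>y\<in>set \<beta> \<union> set \<gamma>. dd x y \<le> K))"

lemma geodesic_list_ex:
  assumes "a \<in> verts X" "b \<in> verts X"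
  shows "\<exists>p. geodesic_list X p \<and> hd p = a \<and> last p = b \<and> length p = Suc (dd a b)"
  using geodesic_ex[OF assms] geodesic_listI unfolding geodesic_edge_path_def edge_path_betw_def by blast

lemma geodesic_list_point:
  assumes "geodesic_list X p" "y \<in> set p"
  shows "dd (hd p) (last p) = dd (hd p) y + dd y (last p)"
proof -
  have ne: "p \<noteq> []" using assms by auto
  obtain i where i: "i < length p" "y = p ! i" using assms by (metis in_set_conv_nth)
  show ?thesis using ne i assms(1) by (simp add: hd_conv_nth last_conv_nth geodesic_list_nth)
qed

text \<open>Up to a constant, the distance from \<open>w\<close> to a geodesic is the Gromov product of its endpoints. For the first
  estimate, some vertex of the geodesic is close to both of the other sides of the triangle: the first vertex that
  is close to the side that starts at the far end.\<close>

lemma slim_product: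
  assumes sl: "slim K" and w: "w \<in> verts X" and p: "geodesic_list X p"
  shows "\<exists>y\<in>set p. 2 * dd w y + dd (hd p) (last p) \<le> dd w (hd p) + dd w (last p) + 4 * (K + 1)"
    and "y \<in> set p \<Longrightarrow> dd w (hd p) + dd w (last p) \<le> 2 * dd w y + dd (hd p) (last p)"
proof -
  define a b where "a = hd p" and "b = last p"
  have ne: "p \<noteq> []" using p by (auto simp: geodesic_list_def edge_path_def)
  have pv: "set p \<subseteq> verts X" using geodesic_list_verts[OF p] .
  have ab: "a \<in> verts X" "b \<in> verts X" using pv ne by (auto simp: a_def b_def)
  obtain q where q: "geodesic_list X q" "hd q = b" "last q = w" using geodesic_list_ex[OF ab(2) w] by blast
  obtain r where r: "geodesic_list X r" "hd r = w" "last r = a" using geodesic_list_ex[OF w ab(1)] by blast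
  have qr: "q \<noteq> []" "r \<noteq> []" using q r by (auto simp: geodesic_list_def edge_path_def)
  have qv: "set q \<subseteq> verts X" "set r \<subseteq> verts X" using geodesic_list_verts q r by auto
  have near: "\<exists>y\<in>set q \<union> set r. dd x y \<le> K" if "x \<in> set p" for x
    using sl p q r that unfolding slim_def a_def b_def by metis
  define Q where "Q x \<longleftrightarrow> (\<exists>y\<in>set q. dd x y \<le> K)" for x
  define i where "i = (LEAST i. i < length p \<and> Q (p ! i))"
  have Qb: "Q (p ! (length p - 1))"
  proof -
    have "b \<in> set q" using q qr by (metis hd_in_set)
    then show ?thesis using ne ab by (auto simp: Q_def b_def last_conv_nth intro!: bexI[of _ b])
  qed
  then have i: "i < length p" "Q (p ! i)" unfolding i_def using ne
    LeastI[of "\<lambda>i. i < length p \<and> Q (p ! i)" "length p - 1"] by auto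
  have "\<exists>y\<in>set r. dd (p ! i) y \<le> K + 1"
  proof (cases i)
    case 0
    have "a \<in> set r" using r qr by (metis last_in_set)
    then show ?thesis using 0 ne ab by (auto simp: a_def hd_conv_nth intro!: bexI[of _ a])
  next
    case (Suc j)
    then have "\<not> Q (p ! j)" using i not_less_Least[of j "\<lambda>i. i < length p \<and> Q (p ! i)"] by (auto simp: i_def)
    then obtain y where y: "y \<in> set r" "dd (p ! j) y \<le> K" using near[of "p ! j"] Suc i by (auto simp: Q_def)
    have "dd (p ! i) (p ! j) = 1" using geodesic_list_nth[OF p] Suc i by simp
    then have "dd (p ! i) y \<le> 1 + K"
    proof -
      have "p ! i \<in> verts X" "p ! j \<in> verts X" "y \<in> verts X"
        using pv qv y(1) Suc i(1) nth_mem[of i p] nth_mem[of j p] by auto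
      then show ?thesis using gdist_triangle[of "p ! i" "p ! j" y] y(2) \<open>dd (p ! i) (p ! j) = 1\<close> by linarith
    qed
    then show ?thesis using y by (intro bexI[of _ y]) auto
  qed
  then obtain y1 where y1: "y1 \<in> set r" "dd (p ! i) y1 \<le> K + 1" by blast
  obtain y2 where y2: "y2 \<in> set q" "dd (p ! i) y2 \<le> K" using i by (auto simp: Q_def)
  define x where "x = p ! i"
  have xp: "x \<in> set p" "x \<in> verts X" using i pv by (auto simp: x_def)
  have yv: "y1 \<in> verts X" "y2 \<in> verts X" using y1 y2 qv by auto
  have 1: "dd w a = dd w y1 + dd y1 a" using geodesic_list_point[OF r(1) y1(1)] r by simp
  have 2: "dd b w = dd b y2 + dd y2 w" using geodesic_list_point[OF q(1) y2(1)] q by simp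
  have 3: "dd a b = dd a x + dd x b" using geodesic_list_point[OF p xp(1)] by (simp add: a_def b_def)
  have t: "dd w x \<le> dd w y1 + dd y1 x" "dd a x \<le> dd a y1 + dd y1 x" "dd w x \<le> dd w y2 + dd y2 x"
    "dd x b \<le> dd x y2 + dd y2 b"
    by (intro gdist_triangle xp yv ab w)+
  have t': "dd w b = dd b w" "dd a y1 = dd y1 a" "dd y1 x = dd x y1" "dd y2 x = dd x y2"
    "dd y2 b = dd b y2" "dd y2 w = dd w y2"
    by (intro gdist_sym xp yv ab w)+
  have y: "dd y1 x \<le> K + 1" "dd y2 x \<le> K" "dd x y2 \<le> K"
    using y1(2) y2(2) t'(3,4) by (simp_all add: x_def)
  have "dd w x + dd a x \<le> dd w a + 2 * (K + 1)" using 1 t(1,2) t'(2) y(1) by simp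
  moreover have "dd w x + dd x b \<le> dd w b + 2 * (K + 1)" using 2 t(3,4) t'(1,5,6) y(2,3) by simp
  ultimately have "2 * dd w x + dd a b \<le> dd w a + dd w b + 4 * (K + 1)" using 3 by simp
  then show "\<exists>y\<in>set p. 2 * dd w y + dd (hd p) (last p) \<le> dd w (hd p) + dd w (last p) + 4 * (K + 1)"
    using xp unfolding a_def b_def by blast
  assume y: "y \<in> set p"
  have "dd w a \<le> dd w y + dd a y" "dd w b \<le> dd w y + dd y b" "dd a b = dd a y + dd y b"
    using gdist_triangle[of w y a] gdist_triangle[of w y b] gdist_sym[of a y] w ab y pv geodesic_list_point[OF p y]
    by (auto simp: a_def b_def)
  then show "dd w (hd p) + dd w (last p) \<le> 2 * dd w y + dd (hd p) (last p)" unfolding a_def b_def by linarith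
qed

text \<open>Compare distances to geodesics instead of Gromov products: the vertex of one side that is nearest to \<open>w\<close>
  is close to another side.\<close>

lemma slim_fourpt:
  assumes sl: "slim K" shows "fourpt X (6 * (K + 1))"
  unfolding fourpt_def
proof (intro ballI)
  fix x y z w assume v: "x \<in> verts X" "y \<in> verts X" "z \<in> verts X" "w \<in> verts X"
  obtain p where p: "geodesic_list X p" "hd p = x" "last p = z" using geodesic_list_ex[OF v(1,3)] by blast
  obtain q where q: "geodesic_list X q" "hd q = z" "last q = y" using geodesic_list_ex[OF v(3,2)] by blast
  obtain r where r: "geodesic_list X r" "hd r = y" "last r = x" using geodesic_list_ex[OF v(2,1)] by blast
  obtain c where c: "c \<in> set p" "2 * dd w c + dd x z \<le> dd w x + dd w z + 4 * (K + 1)"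
    using slim_product(1)[OF sl v(4) p(1)] p by auto
  obtain e where e: "e \<in> set q \<union> set r" "dd c e \<le> K" using sl p q r c unfolding slim_def by metis
  have cv: "c \<in> verts X" "e \<in> verts X" using geodesic_list_verts p q r c e by blast+
  have we: "dd w e \<le> dd w c + K" using gdist_triangle[OF v(4) cv] e by linarith
  have s: "dd w x = dd x w" "dd w y = dd y w" "dd w z = dd z w" "dd z y = dd y z" "dd y x = dd x y"
    by (intro gdist_sym v)+
  have "dd w z + dd w y \<le> 2 * dd w e + dd z y \<or> dd w y + dd w x \<le> 2 * dd w e + dd y x"
    using e slim_product(2)[OF sl v(4) q(1), of e] slim_product(2)[OF sl v(4) r(1), of e] q r by auto
  then have "dd x z + dd y w \<le> dd x y + dd z w + 6 * (K + 1) \<or> dd x z + dd y w \<le> dd x w + dd y z + 6 * (K + 1)"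
  proof
    assume "dd w z + dd w y \<le> 2 * dd w e + dd z y"
    then have "dd x z + dd y w \<le> dd x w + dd y z + 6 * (K + 1)" using c(2) we s by simp
    then show ?thesis ..
  next
    assume "dd w y + dd w x \<le> 2 * dd w e + dd y x"
    then have "dd x z + dd y w \<le> dd x y + dd z w + 6 * (K + 1)" using c(2) we s by simp
    then show ?thesis ..
  qed
  then show "dd x z + dd y w \<le> max (dd x y + dd z w) (dd x w + dd y z) + 6 * (K + 1)" by linarith
qed

end

section \<open>Chambers, walls and circuits\<close>

text \<open>What the geometric part of the proof uses of the extension graph \<open>Y\<close>. The chambers \<open>C\<close> index the copies of
  \<open>\<Gamma>\<close>, embedded by \<open>emb\<close>, and \<open>proj\<close> is the common inverse of the embeddings. The number \<open>d h y\<close> is the distance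
  from the chamber \<open>h\<close> to the chambers whose copy contains \<open>y\<close>. The last assumption says that a chamber that is not yet
  at \<open>y\<close> can move towards \<open>y\<close> across the star of a vertex of its copy. This move changes no distance to vertices of the
  star, and the vertices outside the star that become closer form one side of the star.\<close>

locale chamber_graph =
  fixes \<Gamma> :: "'v ugraph" and Y :: "'y ugraph" and C :: "'c set"
    and emb :: "'c \<Rightarrow> 'v \<Rightarrow> 'y" and proj :: "'y \<Rightarrow> 'v" and d :: "'c \<Rightarrow> 'y \<Rightarrow> nat"
  assumes simplicial_\<Gamma>: "simplicial_graph \<Gamma>" and connected_\<Gamma>: "connected_graph \<Gamma>"
    and girth_\<Gamma>: "girth \<Gamma> > 20"
    and simplicial_Y: "simplicial_graph Y"
    and C_nonempty: "C \<noteq> {}"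
    and emb_verts: "h \<in> C \<Longrightarrow> v \<in> verts \<Gamma> \<Longrightarrow> emb h v \<in> verts Y"
    and proj_emb: "h \<in> C \<Longrightarrow> v \<in> verts \<Gamma> \<Longrightarrow> proj (emb h v) = v"
    and emb_edge: "h \<in> C \<Longrightarrow> {u, v} \<in> edges \<Gamma> \<Longrightarrow> {emb h u, emb h v} \<in> edges Y"
    and vert_cover: "y \<in> verts Y \<Longrightarrow> \<exists>h\<in>C. \<exists>v\<in>verts \<Gamma>. y = emb h v"
    and edge_cover: "{x, y} \<in> edges Y \<Longrightarrow> \<exists>h\<in>C. \<exists>u v. {u, v} \<in> edges \<Gamma> \<and> x = emb h u \<and> y = emb h v"
    and d_emb: "h \<in> C \<Longrightarrow> v \<in> verts \<Gamma> \<Longrightarrow> d h (emb h v) = 0"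
    and d_zero: "h \<in> C \<Longrightarrow> y \<in> verts Y \<Longrightarrow> d h y = 0 \<Longrightarrow> \<exists>v\<in>verts \<Gamma>. y = emb h v"
    and step: "h \<in> C \<Longrightarrow> y \<in> verts Y \<Longrightarrow> d h y > 0 \<Longrightarrow> \<exists>h'\<in>C. \<exists>v\<in>verts \<Gamma>. d h' y < d h y \<and>
       (\<forall>x\<in>verts Y. x = emb h v \<or> {x, emb h v} \<in> edges Y \<longrightarrow> d h' x = d h x) \<and>
       (\<forall>k\<in>C. \<forall>a\<in>verts \<Gamma>. \<forall>b\<in>verts \<Gamma>. d h' (emb k a) < d h (emb k a) \<longrightarrow>
          \<not> (emb k b = emb h v \<or> {emb k b, emb h v} \<in> edges Y) \<longrightarrow> d h' (emb k b) < d h (emb k b))"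
begin

sublocale g: conn_graph \<Gamma>
  by (intro conn_graph.intro simplicial_\<Gamma> connected_\<Gamma>)

abbreviation (input) adj where "adj x y \<equiv> {x, y} \<in> edges Y"

lemma adj_verts: "adj x y \<Longrightarrow> x \<in> verts Y" "adj x y \<Longrightarrow> y \<in> verts Y" "adj x y \<Longrightarrow> x \<noteq> y"
  using simplicial_Y unfolding simplicial_graph_def by (metis doubleton_eq_iff)+

lemma adj_sym: "adj x y \<longleftrightarrow> adj y x" by (simp add: insert_commute)

definition copy where "copy h = emb h ` verts \<Gamma>"

lemma copy_iff: "h \<in> C \<Longrightarrow> y \<in> copy h \<longleftrightarrow> y \<in> verts Y \<and> d h y = 0"
  using d_emb d_zero[of h y] emb_verts by (auto simp: copy_def)

lemma copy_proj: "h \<in> C \<Longrightarrow> y \<in> copy h \<Longrightarrow> y = emb h (proj y) \<and> proj y \<in> verts \<Gamma>"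
  by (auto simp: copy_def proj_emb)

lemma proj_verts: "y \<in> verts Y \<Longrightarrow> proj y \<in> verts \<Gamma>"
  using vert_cover proj_emb by metis

lemma proj_edge: "adj x y \<Longrightarrow> {proj x, proj y} \<in> edges \<Gamma>"
  using edge_cover proj_emb g.adj_verts by (metis (no_types, lifting))

lemma copy_proj_inj: "h \<in> C \<Longrightarrow> x \<in> copy h \<Longrightarrow> y \<in> copy h \<Longrightarrow> proj x = proj y \<Longrightarrow> x = y"
  by (metis copy_proj)

lemma edge_copy: "adj x y \<Longrightarrow> \<exists>h\<in>C. x \<in> copy h \<and> y \<in> copy h"
  using edge_cover g.adj_verts unfolding copy_def by blast

definition st where "st z = {x \<in> verts Y. x = z \<or> adj x z}"

text \<open>The star of \<open>z\<close> together with a side \<open>S\<close> of it that is not the side of the chamber \<open>h\<close>: a copy that meets \<open>S\<close>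
  has all its vertices in \<open>S\<close> or in the star.\<close>

definition wall :: "'c \<Rightarrow> 'y \<Rightarrow> 'y set \<Rightarrow> bool" where
  "wall h z S \<longleftrightarrow> h \<in> C \<and> z \<in> copy h \<and> S \<subseteq> verts Y \<and> S \<inter> st z = {} \<and> S \<inter> copy h = {} \<and>
     (\<forall>k\<in>C. \<forall>x\<in>copy k. \<forall>y\<in>copy k. x \<in> S \<longrightarrow> y \<notin> st z \<longrightarrow> y \<in> S)"

lemma wall_step:
  assumes h: "h \<in> C" and y: "y \<in> verts Y" "y \<notin> copy h"
  shows "\<exists>h'\<in>C. \<exists>z S. wall h z S \<and> y \<in> S \<and> z \<in> copy h' \<and>
     (\<forall>x\<in>st z. d h' x = d h x) \<and> (\<forall>x\<in>S. d h' x < d h x)"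
proof -
  have "d h y > 0" using y copy_iff[OF h] by auto
  then obtain h' v where h': "h' \<in> C" "v \<in> verts \<Gamma>" "d h' y < d h y"
    and 1: "\<forall>x\<in>verts Y. x = emb h v \<or> {x, emb h v} \<in> edges Y \<longrightarrow> d h' x = d h x"
    and 2: "\<forall>k\<in>C. \<forall>a\<in>verts \<Gamma>. \<forall>b\<in>verts \<Gamma>. d h' (emb k a) < d h (emb k a) \<longrightarrow>
          \<not> (emb k b = emb h v \<or> {emb k b, emb h v} \<in> edges Y) \<longrightarrow> d h' (emb k b) < d h (emb k b)"
    using step[OF h y(1)] by blast
  define z S where "z = emb h v" and "S = {x \<in> verts Y. d h' x < d h x}"
  have z: "z \<in> copy h" using h' by (simp add: z_def copy_def)
  have zY: "z \<in> verts Y" "d h z = 0" using z copy_iff[OF h] by auto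
  have s: "d h' x = d h x" if "x \<in> st z" for x using that 1 by (auto simp: st_def z_def)
  have "z \<in> copy h'" using s[of z] zY copy_iff[OF h'(1)] by (simp add: st_def)
  moreover have "wall h z S" unfolding wall_def
  proof (intro conjI ballI impI)
    show "S \<inter> st z = {}" using s by (force simp: S_def)
    show "S \<inter> copy h = {}" using copy_iff[OF h] by (auto simp: S_def)
    show "y \<in> S" if xy: "k \<in> C" "x \<in> copy k" "y \<in> copy k" "x \<in> S" "y \<notin> st z" for k x y
    proof -
      obtain a b where "x = emb k a" "y = emb k b" "a \<in> verts \<Gamma>" "b \<in> verts \<Gamma>" using xy by (auto simp: copy_def)
      then show ?thesis using 2 xy emb_verts by (auto simp: S_def st_def z_def)
    qed
  qed (use h z S_def in auto)
  moreover have "y \<in> S" using y h' by (simp add: S_def)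
  moreover have "\<forall>x\<in>S. d h' x < d h x" by (simp add: S_def)
  ultimately show ?thesis using s h'(1) by blast
qed

lemma wall_adj: "wall h z S \<Longrightarrow> x \<in> S \<Longrightarrow> adj x y \<Longrightarrow> y \<in> S \<or> y \<in> st z"
  unfolding wall_def using edge_copy by blast

lemma wall_adj': "wall h z S \<Longrightarrow> x \<notin> S \<Longrightarrow> x \<notin> st z \<Longrightarrow> adj x y \<Longrightarrow> y \<notin> S"
  using wall_adj adj_sym by metis

lemma wall_z: "wall h z S \<Longrightarrow> z \<in> st z \<and> z \<in> verts Y"
  using copy_iff by (auto simp: wall_def st_def)

text \<open>When a chamber moves across a star, the centre of the star lies in both copies and connects them.\<close>

lemma connected_Y: "connected_graph Y"
proof -
  have join: "edge_path_betw Y a c (p @ tl q)" if "edge_path_betw Y a b p" "edge_path_betw Y b c q" for a b c p q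
    using that unfolding edge_path_betw_def edge_path_def
    by (cases q) (auto simp: successively_append_iff successively_Cons)
  have cp: "\<exists>p. edge_path_betw Y x y p" if h: "h \<in> C" and xy: "x \<in> copy h" "y \<in> copy h" for h x y
  proof -
    obtain u v where uv: "x = emb h u" "y = emb h v" "u \<in> verts \<Gamma>" "v \<in> verts \<Gamma>" using xy by (auto simp: copy_def)
    obtain p where "edge_path_betw \<Gamma> u v p" using connected_\<Gamma> uv unfolding connected_graph_def by blast
    then have "edge_path_betw Y x y (map (emb h) p)"
      using uv h emb_edge emb_verts by (auto simp: edge_path_betw_def edge_path_iff_nth hd_map last_map)
    then show ?thesis by blast
  qed
  have "\<exists>p. edge_path_betw Y x y p" if "h \<in> C" "x \<in> copy h" "y \<in> verts Y" for h x y
    using that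
  proof (induction "d h y" arbitrary: h x rule: less_induct)
    case less
    show ?case
    proof (cases "y \<in> copy h")
      case True then show ?thesis using cp less by blast
    next
      case False
      obtain h' z S where w: "h' \<in> C" "wall h z S" "y \<in> S" "z \<in> copy h'" "\<forall>x\<in>S. d h' x < d h x"
        using wall_step[OF less.prems(1,3) False] by blast
      obtain p where "edge_path_betw Y x z p" using cp[OF less.prems(1,2), of z] w by (auto simp: wall_def)
      moreover obtain q where "edge_path_betw Y z y q" using less.hyps[of h' z] w less.prems by blast
      ultimately show ?thesis using join by blast
    qed
  qed
  then show ?thesis unfolding connected_graph_def using vert_cover copy_def by blast
qed

sublocale y: conn_graph Y
  by (intro conn_graph.intro simplicial_Y connected_Y)

lemma gdist_copy:
  assumes "h \<in> C" "x \<in> copy h" "y \<in> copy h"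
  shows "gdist Y x y = gdist \<Gamma> (proj x) (proj y)"
proof (rule antisym)
  have "gdist Y (emb h (proj x)) (emb h (proj y)) \<le> gdist \<Gamma> (proj x) (proj y)"
    by (rule gdist_map_le) (use assms g.conn_graph_axioms y.conn_graph_axioms emb_verts emb_edge copy_proj in auto)
  then show "gdist Y x y \<le> gdist \<Gamma> (proj x) (proj y)" using assms copy_proj by metis
  show "gdist \<Gamma> (proj x) (proj y) \<le> gdist Y x y"
    by (rule gdist_map_le) (use assms g.conn_graph_axioms y.conn_graph_axioms proj_verts proj_edge copy_iff in auto)
qed

text \<open>Choose the chamber that minimises the sum of the distances to the vertices of \<open>A\<close>. If it is not at some \<open>y\<close>,
  it can move across a star towards \<open>y\<close>. If no vertex of \<open>A\<close> is left on the other sides, no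
  distance increases, and the distance to \<open>y\<close> decreases.\<close>

lemma common_copy_or_wall:
  assumes A: "finite A" "A \<subseteq> verts Y"
  shows "(\<exists>h\<in>C. A \<subseteq> copy h) \<or> (\<exists>h z S. wall h z S \<and> A \<inter> S \<noteq> {} \<and> A - S - st z \<noteq> {})"
proof (rule ccontr)
  assume neg: "\<not> ?thesis"
  define F where "F h = (\<Sum>y\<in>A. d h y)" for h
  obtain h where h: "h \<in> C" "\<And>k. k \<in> C \<Longrightarrow> F h \<le> F k"
    using C_nonempty ex_has_least_nat[of "\<lambda>h. h \<in> C" _ F] by blast
  obtain y where y: "y \<in> A" "y \<notin> copy h" using neg h by blast
  obtain h' z S where w: "h' \<in> C" "wall h z S" "y \<in> S" "\<forall>x\<in>st z. d h' x = d h x" "\<forall>x\<in>S. d h' x < d h x"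
    using wall_step[OF h(1), of y] y A by blast
  have "A \<subseteq> S \<union> st z" using neg w y by blast
  then have "F h' < F h" unfolding F_def
    using A w y by (intro sum_strict_mono_ex1) (auto simp: less_imp_le)
  then show False using h(2)[OF w(1)] by simp
qed

end

context chamber_graph
begin

lemma \<Gamma>_triangle: "{a, b} \<in> edges \<Gamma> \<Longrightarrow> {b, c} \<in> edges \<Gamma> \<Longrightarrow> {c, a} \<in> edges \<Gamma> \<Longrightarrow> False"
proof -
  assume e: "{a, b} \<in> edges \<Gamma>" "{b, c} \<in> edges \<Gamma>" "{c, a} \<in> edges \<Gamma>"
  then have "cyc \<Gamma> [a, b, c]"
    using g.adj_verts(1,2)[OF e(1)] g.adj_verts(2)[OF e(2)] g.adj_verts(3)[OF e(1)] g.adj_verts(3)[OF e(2)]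
      g.adj_verts(3)[OF e(3)] by (auto simp: cyc_def edge_path_def)
  then show False using girth_cyc[OF girth_\<Gamma>] by fastforce
qed

lemma \<Gamma>_square: "{a, b} \<in> edges \<Gamma> \<Longrightarrow> {b, c} \<in> edges \<Gamma> \<Longrightarrow> {c, e} \<in> edges \<Gamma> \<Longrightarrow> {e, a} \<in> edges \<Gamma>
   \<Longrightarrow> a \<noteq> c \<Longrightarrow> b \<noteq> e \<Longrightarrow> False"
proof -
  assume e: "{a, b} \<in> edges \<Gamma>" "{b, c} \<in> edges \<Gamma>" "{c, e} \<in> edges \<Gamma>" "{e, a} \<in> edges \<Gamma>" "a \<noteq> c" "b \<noteq> e"
  then have "cyc \<Gamma> [a, b, c, e]"
    using g.adj_verts(1,2)[OF e(1)] g.adj_verts(1,2)[OF e(3)] g.adj_verts(3)[OF e(1)] g.adj_verts(3)[OF e(2)]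
      g.adj_verts(3)[OF e(3)] g.adj_verts(3)[OF e(4)] by (auto simp: cyc_def edge_path_def)
  then show False using girth_cyc[OF girth_\<Gamma>] by fastforce
qed

lemma triangle: "adj a b \<Longrightarrow> adj b c \<Longrightarrow> adj c a \<Longrightarrow> False"
  using \<Gamma>_triangle proj_edge by metis

lemma copy_square:
  assumes "h \<in> C" "a \<in> copy h" "b \<in> copy h" "c \<in> copy h" "e \<in> copy h"
    "adj a b" "adj b c" "adj c e" "adj e a" "a \<noteq> c" "b \<noteq> e"
  shows False
  using \<Gamma>_square[of "proj a" "proj b" "proj c" "proj e"] assms proj_edge copy_proj_inj by metis

lemma copyD: "h \<in> C \<Longrightarrow> x \<in> copy h \<Longrightarrow> x \<in> verts Y" "h \<in> C \<Longrightarrow> x \<in> copy h \<Longrightarrow> d h x = 0"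
  using copy_iff by auto

text \<open>The next two lemmas, and \<open>square\<close>, exclude 4-cycles \<open>a x b w\<close>. Among the chambers of the edge \<open>a x\<close>, one with
  the least sum of distances to \<open>b\<close> and \<open>w\<close> cannot move any closer; the stars that stop it form a
  triangle or a 4-cycle inside one copy.\<close>

lemma square_step1:
  assumes h: "h \<in> C" "a \<in> copy h" "x \<in> copy h" "b \<in> copy h" "w \<notin> copy h"
    and e: "adj a x" "adj x b" "adj b w" "adj w a" and ab: "a \<noteq> b"
  shows "\<exists>h'\<in>C. a \<in> copy h' \<and> x \<in> copy h' \<and> d h' b \<le> d h b \<and> d h' w < d h w"
proof -
  obtain h' z S where w: "h' \<in> C" "wall h z S" "w \<in> S" "z \<in> copy h'" "\<forall>x\<in>st z. d h' x = d h x" "\<forall>x\<in>S. d h' x < d h x"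
    using wall_step[OF h(1) _ h(5)] adj_verts e by blast
  have zh: "z \<in> copy h" and nS: "a \<notin> S" "b \<notin> S" using w(2) h by (auto simp: wall_def)
  have st: "a \<in> st z" "b \<in> st z" using wall_adj[OF w(2,3)] e nS adj_sym by blast+
  have nab: "\<not> adj a b" using triangle e by blast
  have "z \<noteq> a" "z \<noteq> b" using st ab nab adj_sym by (auto simp: st_def)
  then have az: "adj a z" "adj b z" using st by (auto simp: st_def)
  have "z = x"
    using copy_square[OF h(1,2) zh h(4,3)] az e ab adj_sym by blast
  then show ?thesis
    using w st h copyD[OF h(1)] copy_iff[OF w(1)] by (intro bexI[of _ h']) auto
qed

lemma square_step2:
  assumes h: "h \<in> C" "a \<in> copy h" "x \<in> copy h" "b \<notin> copy h"
    and e: "adj a x" "adj x b" "adj b w" "adj w a"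
  shows "(\<exists>h'\<in>C. a \<in> copy h' \<and> x \<in> copy h' \<and> d h' b < d h b \<and> d h' w \<le> d h w) \<or>
    (\<exists>z\<in>copy h. \<exists>S. wall h z S \<and> b \<in> S \<and> a \<notin> st z \<and> a \<notin> S \<and> adj x z)"
proof -
  obtain h' z S where w: "h' \<in> C" "wall h z S" "b \<in> S" "z \<in> copy h'" "\<forall>x\<in>st z. d h' x = d h x" "\<forall>x\<in>S. d h' x < d h x"
    using wall_step[OF h(1) _ h(4)] adj_verts e by blast
  have zh: "z \<in> copy h" and nS: "a \<notin> S" "x \<notin> S" using w(2) h by (auto simp: wall_def)
  have stx: "x \<in> st z" using wall_adj[OF w(2,3)] e nS adj_sym by blast
  show ?thesis
  proof (cases "a \<in> st z")
    case True
    have "w \<in> S \<or> w \<in> st z" using wall_adj[OF w(2,3)] e by blast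
    then have "d h' w \<le> d h w" using w by (auto simp: less_imp_le)
    then show ?thesis using w True stx h copyD[OF h(1)] copy_iff[OF w(1)] by (intro disjI1 bexI[of _ h']) auto
  next
    case False
    have "x \<noteq> z" using False e adj_verts by (auto simp: st_def)
    then have "adj x z" using stx by (auto simp: st_def)
    then show ?thesis using w zh nS False by blast
  qed
qed

lemma square:
  assumes e: "adj a x" "adj x b" "adj b w" "adj w a" and ab: "a \<noteq> b" and xw: "x \<noteq> w"
  shows False
proof -
  define Q where "Q h \<longleftrightarrow> h \<in> C \<and> a \<in> copy h \<and> x \<in> copy h" for h
  define F where "F h = d h b + d h w" for h
  obtain h0 where "Q h0" using edge_copy[OF e(1)] by (auto simp: Q_def)
  then obtain h where h: "Q h" and min: "\<And>k. Q k \<Longrightarrow> F h \<le> F k"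
    using ex_has_least_nat[of Q h0 F] by blast
  have hC: "h \<in> C" "a \<in> copy h" "x \<in> copy h" using h by (auto simp: Q_def)
  have e': "adj x a" "adj a w" "adj w b" "adj b x" using e adj_sym by auto
  show False
  proof (cases "b \<in> copy h")
    case b: True
    show False
    proof (cases "w \<in> copy h")
      case True
      then show False using copy_square[OF hC b True e] ab xw by blast
    next
      case False
      then obtain h' where "h' \<in> C" "a \<in> copy h'" "x \<in> copy h'" "d h' b \<le> d h b" "d h' w < d h w"
        using square_step1[OF hC b False e ab] by blast
      then show False using min[of h'] by (simp add: Q_def F_def)
    qed
  next
    case b: False
    show False
    proof (cases "w \<in> copy h")
      case True
      then obtain h' where "h' \<in> C" "a \<in> copy h'" "x \<in> copy h'" "d h' w \<le> d h w" "d h' b < d h b"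
        using square_step1[OF hC(1,3,2) True b e' xw] by blast
      then show False using min[of h'] by (simp add: Q_def F_def)
    next
      case w: False
      have "\<not> (\<exists>h'\<in>C. a \<in> copy h' \<and> x \<in> copy h' \<and> d h' b < d h b \<and> d h' w \<le> d h w)"
        using min by (fastforce simp: Q_def F_def)
      then obtain z S where z: "z \<in> copy h" "wall h z S" "b \<in> S" "a \<notin> st z" "a \<notin> S" "adj x z"
        using square_step2[OF hC b e] by blast
      have "\<not> (\<exists>h'\<in>C. x \<in> copy h' \<and> a \<in> copy h' \<and> d h' w < d h w \<and> d h' b \<le> d h b)"
        using min by (fastforce simp: Q_def F_def)
      then obtain z' S' where z': "z' \<in> copy h" "wall h z' S'" "w \<in> S'" "x \<notin> st z'" "x \<notin> S'" "adj a z'"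
        using square_step2[OF hC(1,3,2) w e'] by blast
      have "b \<in> st z'" using wall_adj[OF z'(2,3) e'(3)] wall_adj'[OF z'(2,5,4) e(2)] by blast
      moreover have "b \<noteq> z'" using b z' by blast
      ultimately have bz': "adj b z'" by (auto simp: st_def)
      have "z' \<in> st z" using wall_adj[OF z(2,3) bz'] wall_adj'[OF z(2,5,4) z'(6)] by blast
      then have "z' = z \<or> adj z' z" by (auto simp: st_def)
      then show False
      proof
        assume "z' = z"
        then show False using triangle[of a x z] e z z' adj_sym by blast
      next
        assume "adj z' z"
        moreover have "a \<noteq> z" using z wall_z by blast
        moreover have "x \<noteq> z'" using z' wall_z by blast
        ultimately show False
          using copy_square[OF hC(1,2,3) z(1) z'(1)] e z z' adj_sym by blast
      qed
    qed
  qed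
qed

lemma wall_run:
  assumes w: "wall h z S" and R: "edge_path Y R" and ab: "a \<le> b" "b < length R"
    and no: "\<And>i. a \<le> i \<Longrightarrow> i \<le> b \<Longrightarrow> R ! i \<notin> st z"
  shows "R ! a \<in> S \<longleftrightarrow> R ! b \<in> S"
  using ab no
proof (induction b)
  case (Suc b)
  show ?case
  proof (cases "a = Suc b")
    case False
    then have "R ! a \<in> S \<longleftrightarrow> R ! b \<in> S" using Suc by simp
    moreover have "adj (R ! b) (R ! Suc b)" using R Suc.prems by (auto simp: edge_path_iff_nth)
    then have "R ! b \<in> S \<longleftrightarrow> R ! Suc b \<in> S"
      using wall_adj[OF w] adj_sym Suc.prems(3)[of b] Suc.prems(3)[of "Suc b"] Suc.prems(1) False by (metis le_SucE le_Suc_eq order_refl)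
    ultimately show ?thesis by blast
  qed simp
qed simp

text \<open>The list \<open>K\<close> consists of the interior vertices of a path of length at most two between two vertices of \<open>R\<close>.\<close>

definition shortcut :: "'y list \<Rightarrow> nat \<Rightarrow> nat \<Rightarrow> 'y list \<Rightarrow> bool" where
  "shortcut R i j K \<longleftrightarrow> i < j \<and> j < length R \<and>
     (K = [] \<and> adj (R ! i) (R ! j) \<or> (\<exists>u. K = [u] \<and> u \<notin> set R \<and> adj (R ! i) u \<and> adj u (R ! j)))"

definition outer where "outer R i j K = take (Suc i) R @ K @ drop j R"
definition inner where "inner R i j K = take (Suc j - i) (drop i R) @ K"

text \<open>Going around the circuit from one side of the star of \<open>z\<close> to another and back, one meets the star twice.
  The shortcut runs through \<open>z\<close>; if \<open>z\<close> itself is on the circuit, it is chosen as one of the endpoints.\<close>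

lemma wall_shortcut:
  assumes R: "cyc Y R" and w: "wall h z S"
    and p: "p \<in> set R" "p \<in> S" and q: "q \<in> set R" "q \<notin> S" "q \<notin> st z"
  shows "\<exists>i j K. shortcut R i j K \<and> i + 2 \<le> j \<and> j - i + 2 \<le> length R"
proof -
  have P: "edge_path Y R" "distinct R" "adj (last R) (hd R)" "R \<noteq> []" using R by (auto simp: cyc_def)
  have RY: "R ! i \<in> verts Y" if "i < length R" for i using P that by (auto simp: edge_path_def)
  have pz: "p \<notin> st z" using p w by (auto simp: wall_def)
  obtain a b where ab: "a < b" "b < length R" "R ! a \<notin> st z" "R ! b \<notin> st z" "(R ! a \<in> S) \<noteq> (R ! b \<in> S)"
    using p q pz by (metis in_set_conv_nth linorder_neqE_nat)
  obtain i where i: "a < i" "i < b" "R ! i \<in> st z"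
    using wall_run[OF w P(1), of a b] ab by (metis le_neq_implies_less less_imp_le_nat)
  obtain j where j: "j < length R" "j < a \<or> b < j" "R ! j \<in> st z"
  proof -
    have "\<exists>j < length R. (j < a \<or> b < j) \<and> R ! j \<in> st z"
    proof (rule ccontr)
      assume n: "\<not> ?thesis"
      let ?n = "length R - 1"
      have 1: "R ! i \<notin> st z" if "i \<le> a" for i using n that ab by (metis less_le_trans order_less_trans le_neq_implies_less)
      have 2: "R ! i \<notin> st z" if "b \<le> i" "i < length R" for i using n that ab by (metis le_neq_implies_less)
      have "R ! b \<in> S \<longleftrightarrow> R ! ?n \<in> S" using wall_run[OF w P(1), of b ?n] 2 ab by auto
      moreover have "R ! 0 \<in> S \<longleftrightarrow> R ! a \<in> S" using wall_run[OF w P(1), of 0 a] 1 ab by auto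
      moreover have "adj (R ! ?n) (R ! 0)" using P by (simp add: hd_conv_nth last_conv_nth)
      moreover have "R ! ?n \<notin> st z" "R ! 0 \<notin> st z" using 1[of 0] 2[of ?n] ab by auto
      ultimately have "R ! a \<in> S \<longleftrightarrow> R ! b \<in> S" using wall_adj[OF w] adj_sym by metis
      then show False using ab by blast
    qed
    then show ?thesis using that by blast
  qed
  show ?thesis
  proof (cases "z \<in> set R")
    case False
    then have "adj (R ! i) z" "adj (R ! j) z" using i j ab by (auto simp: st_def)
    then have "shortcut R (min i j) (max i j) [z]"
      using i j ab False adj_sym[of z "R ! i"] adj_sym[of z "R ! j"] by (auto simp: shortcut_def min_def max_def)
    moreover have "min i j + 2 \<le> max i j" "max i j - min i j + 2 \<le> length R" using i j ab by auto
    ultimately show ?thesis by blast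
  next
    case True
    then obtain c where c: "c < length R" "R ! c = z" by (metis in_set_conv_nth)
    have zz: "z \<in> st z" using wall_z[OF w] by blast
    have "\<exists>i' j'. a < i' \<and> i' < b \<and> j' < length R \<and> (j' < a \<or> b < j') \<and> adj (R ! i') (R ! j')"
    proof (cases "a < c \<and> c < b")
      case True
      have "R ! j \<noteq> z" using True c j P(2) by (metis nth_eq_iff_index_eq not_less_iff_gr_or_eq)
      then have "adj (R ! c) (R ! j)" using j c adj_sym by (auto simp: st_def)
      then show ?thesis using True j by blast
    next
      case False
      have "c \<noteq> a" "c \<noteq> b" using ab c zz by auto
      then have c': "c < a \<or> b < c" using False by linarith
      have "R ! i \<noteq> z" using c' c i ab P(2) by (metis nth_eq_iff_index_eq not_less_iff_gr_or_eq order_less_trans)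
      then have "adj (R ! i) (R ! c)" using i c by (auto simp: st_def)
      then show ?thesis using c' c i by blast
    qed
    then obtain i' j' where ij: "a < i'" "i' < b" "j' < length R" "j' < a \<or> b < j'" "adj (R ! i') (R ! j')" by blast
    then have "shortcut R (min i' j') (max i' j') []"
      using ab adj_sym[of "R ! i'" "R ! j'"] by (auto simp: shortcut_def min_def max_def)
    moreover have "min i' j' + 2 \<le> max i' j'" "max i' j' - min i' j' + 2 \<le> length R" using ij ab by auto
    ultimately show ?thesis by blast
  qed
qed

lemma length_outer: "i < j \<Longrightarrow> j < length R \<Longrightarrow> length (outer R i j K) = length R + length K + 1 - (j - i)"
  by (simp add: outer_def)

lemma length_inner: "i < j \<Longrightarrow> j < length R \<Longrightarrow> length (inner R i j K) = (j - i) + length K + 1"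
  by (simp add: inner_def)

lemma cyc_outer_inner:
  assumes R: "cyc Y R" and s: "shortcut R i j K" and ij: "i + 2 \<le> j" "j - i + 2 \<le> length R"
  shows "cyc Y (outer R i j K)" "cyc Y (inner R i j K)"
    "hd (outer R i j K) = hd R" "last (outer R i j K) = last R"
proof -
  have P: "edge_path Y R" "distinct R" "adj (last R) (hd R)" "R \<noteq> []" using R by (auto simp: cyc_def)
  have lt: "i < j" "j < length R" using s by (auto simp: shortcut_def)
  have A: "edge_path Y (take (Suc i) R)" "take (Suc i) R \<noteq> []" "last (take (Suc i) R) = R ! i"
    using edge_path_take[OF P(1), of "Suc i"] lt P by (simp_all) (simp add: take_Suc_conv_app_nth)
  have B: "edge_path Y (drop j R)" "drop j R \<noteq> []" "hd (drop j R) = R ! j"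
    using edge_path_drop[OF P(1)] lt by (auto simp: hd_drop_conv_nth)
  have D: "edge_path Y (take (Suc j - i) (drop i R))" "take (Suc j - i) (drop i R) \<noteq> []"
     "hd (take (Suc j - i) (drop i R)) = R ! i" "last (take (Suc j - i) (drop i R)) = R ! j"
    using edge_path_take[OF edge_path_drop[OF P(1), of i], of "Suc j - i"] lt
    by (auto simp: hd_take hd_drop_conv_nth last_conv_nth min_def intro!: arg_cong[of _ _ "(!) R"])
  show hl: "hd (outer R i j K) = hd R" "last (outer R i j K) = last R"
    using lt P by (auto simp: outer_def hd_append)
  have dd: "set (take (Suc i) R) \<inter> set (drop j R) = {}"
    using set_take_disj_set_drop_if_distinct[OF P(2), of "Suc i" j] lt by simp
  have uv: "u \<in> verts Y" if "K = [u]" for u using s that adj_verts by (auto simp: shortcut_def)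
  have "edge_path Y (outer R i j K)" "distinct (outer R i j K)"
    using s A B dd P(2) uv edge_path_append[OF A(2) B(2)] edge_path_append[of "take (Suc i) R @ K" "drop j R"]
       edge_path_append[OF A(2), of K]
    unfolding outer_def shortcut_def by (auto simp: edge_path_def[of Y "[_]"] dest: in_set_takeD in_set_dropD)
  then show "cyc Y (outer R i j K)"
    using hl P(3) ij s lt length_outer[OF lt, of K] unfolding cyc_def by (auto simp: shortcut_def)
  have "set (take (Suc j - i) (drop i R)) \<subseteq> set R" by (meson in_set_dropD in_set_takeD subsetI)
  then have "edge_path Y (inner R i j K)" "distinct (inner R i j K)" "adj (last (inner R i j K)) (hd (inner R i j K))"
    using s D P(2) uv edge_path_append[OF D(2), of K] adj_sym
    unfolding inner_def shortcut_def by (auto simp: edge_path_def[of Y "[_]"] hd_append dest: in_set_takeD in_set_dropD)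
  then show "cyc Y (inner R i j K)"
    using ij lt length_inner[OF lt, of K] unfolding cyc_def by auto
qed

lemma cyc_split:
  assumes R: "cyc Y R"
  shows "(\<exists>h\<in>C. set R \<subseteq> copy h) \<or> (\<exists>i j K. shortcut R i j K \<and> i + 2 \<le> j \<and> j - i + 2 \<le> length R)"
proof -
  have "finite (set R)" "set R \<subseteq> verts Y" using R by (auto simp: cyc_def edge_path_def)
  from common_copy_or_wall[OF this] show ?thesis
  proof
    assume "\<exists>h z S. wall h z S \<and> set R \<inter> S \<noteq> {} \<and> set R - S - st z \<noteq> {}"
    then show ?thesis using wall_shortcut[OF R] by blast
  qed blast
qed

lemma cyc_copy_proj:
  assumes "cyc Y R" "h \<in> C" "set R \<subseteq> copy h"
  shows "cyc \<Gamma> (map proj R)"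
proof -
  have "inj_on proj (set R)" using assms copy_proj_inj by (meson inj_onI subsetD)
  then show ?thesis
    using assms proj_verts proj_edge by (auto simp: cyc_def edge_path_iff_nth distinct_map last_map hd_map)
qed

lemma no_cyc4: "cyc Y R \<Longrightarrow> length R \<noteq> 4"
proof
  assume R: "cyc Y R" "length R = 4"
  then obtain a b c e where "R = [a, b, c, e]" by (auto simp: length_Suc_conv eval_nat_numeral)
  then show False using R square[of a b c e] by (auto simp: cyc_def edge_path_def)
qed

text \<open>A circuit in a copy is a circuit of \<open>\<Gamma>\<close>. Otherwise it is cut into two circuits, which are shorter because
  there are no 4-cycles.\<close>

lemma girth_Y: "cyc Y R \<Longrightarrow> 21 \<le> length R"
proof (induction "length R" arbitrary: R rule: less_induct)
  case less
  from cyc_split[OF less.prems] show ?case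
  proof
    assume "\<exists>h\<in>C. set R \<subseteq> copy h"
    then show ?thesis using cyc_copy_proj[OF less.prems] girth_cyc[OF girth_\<Gamma>] by fastforce
  next
    assume "\<exists>i j K. shortcut R i j K \<and> i + 2 \<le> j \<and> j - i + 2 \<le> length R"
    then obtain i j K where s: "shortcut R i j K" "i + 2 \<le> j" "j - i + 2 \<le> length R" by blast
    note c = cyc_outer_inner[OF less.prems s]
    have lt: "i < j" "j < length R" and K: "length K \<le> 1" using s by (auto simp: shortcut_def)
    note l = length_outer[OF lt, of K] length_inner[OF lt, of K]
    have "length (outer R i j K) \<noteq> 4" "length (inner R i j K) \<noteq> 4" using no_cyc4 c by auto
    then have "length (outer R i j K) < length R" "length (inner R i j K) < length R"
      using l s(2,3) K lt by linarith+
    then show ?thesis using less.hyps[of "outer R i j K"] c(1) by simp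
  qed
qed

lemma shortcut_lengths:
  assumes R: "cyc Y R" and s: "shortcut R i j K" and ij: "i + 2 \<le> j" "j - i + 2 \<le> length R"
  shows "21 \<le> length (inner R i j K)" "21 \<le> length (outer R i j K)"
    "length (outer R i j K) + 17 \<le> length R" "length (inner R i j K) + 17 \<le> length R"
proof -
  have lt: "i < j" "j < length R" and K: "length K \<le> 1" using s by (auto simp: shortcut_def)
  note l = length_outer[OF lt, of K] length_inner[OF lt, of K]
  show 1: "21 \<le> length (inner R i j K)" "21 \<le> length (outer R i j K)"
    using girth_Y cyc_outer_inner[OF R s ij] by auto
  then show "length (outer R i j K) + 17 \<le> length R" "length (inner R i j K) + 17 \<le> length R" using l K lt by linarith+
qed

text \<open>If \<open>y\<^sub>0\<close> belongs to only one of two copies, a star separates it from the other copy, and this star contains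
  all vertices that the copies share; its diameter is 2.\<close>

lemma copy_unique:
  assumes h: "h \<in> C" and k: "k \<in> C" and x: "x \<in> copy h" "x \<in> copy k" and y: "y \<in> copy h" "y \<in> copy k"
    and xy: "3 \<le> gdist Y x y"
  shows "copy h = copy k"
proof -
  have *: "copy k \<subseteq> copy h" if h: "h \<in> C" and k: "k \<in> C" and x: "x \<in> copy h" "x \<in> copy k"
    and y: "y \<in> copy h" "y \<in> copy k" for h k
  proof (rule ccontr)
    assume "\<not> copy k \<subseteq> copy h"
    then obtain y0 where y0: "y0 \<in> copy k" "y0 \<notin> copy h" by blast
    obtain h' z S where w: "wall h z S" "y0 \<in> S"
      using wall_step[OF h _ y0(2)] copyD[OF k y0(1)] by blast
    have "x \<in> st z" "y \<in> st z" using w x y y0 k unfolding wall_def by blast+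
    then have "gdist Y x z \<le> 1" "gdist Y y z \<le> 1"
      using y.gdist_adj wall_z[OF w(1)] by (auto simp: st_def)
    then have "gdist Y x y \<le> 2"
      using y.gdist_triangle[of x z y] y.gdist_sym[of y z] wall_z[OF w(1)] copyD[OF h] x y by fastforce
    then show False using xy by simp
  qed
  show ?thesis using *[OF h k x y] *[OF k h x(2,1) y(2,1)] by blast
qed

end

section \<open>Fineness\<close>

text \<open>The edge \<open>e\<close> is the closing edge, so that induction on circuits can keep it fixed.\<close>

definition cycs_through :: "'a ugraph \<Rightarrow> 'a set \<Rightarrow> nat \<Rightarrow> 'a list set" where
  "cycs_through X e n = {R. cyc X R \<and> length R \<le> n \<and> {last R, hd R} = e}"

lemma finite_cycs_of_circuits:
  assumes "finite (circuits_through X e n)"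
  shows "finite (cycs_through X e n)"
proof (rule finite_subset)
  show "cycs_through X e n \<subseteq> butlast ` circuits_through X e n"
  proof
    fix R assume R: "R \<in> cycs_through X e n"
    then have c: "cyc X R" "length R \<le> n" "{last R, hd R} = e" by (auto simp: cycs_through_def)
    have l: "3 \<le> length R" "R \<noteq> []" using c by (auto simp: cyc_def)
    let ?p = "R @ [hd R]" and ?i = "length R - 1"
    have "?p ! ?i = last R" using l by (simp add: nth_append last_conv_nth)
    moreover have "?p ! Suc ?i = hd R" using l by (simp add: nth_append)
    moreover have "Suc ?i < length ?p" using l by simp
    ultimately have "?p \<in> circuits_through X e n"
      using circuit_of_cyc[OF c(1)] c unfolding circuits_through_def by (auto intro!: exI[of _ ?i])
    then show "R \<in> butlast ` circuits_through X e n" by (force intro: image_eqI[of _ _ ?p])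
  qed
qed (use assms in blast)

lemma finite_circuits_of_cycs:
  assumes "finite (cycs_through X e n)"
  shows "finite (circuits_through X e n)"
proof (rule finite_subset)
  let ?f = "\<lambda>(k, R). rotate k R @ [hd (rotate k R)]"
  show "circuits_through X e n \<subseteq> ?f ` ({..n} \<times> cycs_through X e n)"
  proof
    fix p assume p: "p \<in> circuits_through X e n"
    then obtain i where i: "Suc i < length p" "{p ! i, p ! Suc i} = e" and c: "circuit X p" "length p - 1 \<le> n"
      by (auto simp: circuits_through_def)
    define R where "R = butlast p"
    have R: "cyc X R" "p = R @ [hd p]" using cyc_of_circuit[OF c(1)] by (auto simp: R_def)
    have l: "3 \<le> length R" "R \<noteq> []" "length p = Suc (length R)" using R by (auto simp: cyc_def) (metis length_append_singleton)
    have hp: "hd p = hd R" using R(2) l by (metis hd_append2)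
    define R' where "R' = rotate (Suc i) R"
    have il: "Suc i \<le> length R" using i l by simp
    have "hd R' = R ! (Suc i mod length R)" unfolding R'_def by (rule hd_rotate_conv_nth[OF l(2)])
    also have "\<dots> = p ! Suc i"
    proof (cases "Suc i = length R")
      case True
      then have "p ! Suc i = hd p" using R(2) by (metis nth_append_length)
      then show ?thesis using True hp l by (simp add: hd_conv_nth)
    next
      case False
      then show ?thesis using il R(2) by (metis Suc_le_eq le_neq_implies_less mod_less nth_append)
    qed
    finally have 1: "hd R' = p ! Suc i" .
    have "last R' = R' ! (length R - 1)" using l by (simp add: R'_def last_conv_nth)
    also have "\<dots> = R ! ((Suc i + (length R - 1)) mod length R)"
      unfolding R'_def by (rule nth_rotate) (use l in simp)
    also have "(Suc i + (length R - 1)) mod length R = i"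
    proof -
      have "Suc i + (length R - 1) = i + length R" using l by simp
      then show ?thesis using il by simp
    qed
    also have "R ! i = p ! i" using il R(2) by (metis Suc_le_eq nth_append)
    finally have 2: "last R' = p ! i" .
    have R': "R' \<in> cycs_through X e n"
      using 1 2 i cyc_rotate[OF R(1), of "Suc i"] c(2) l by (auto simp: cycs_through_def R'_def)
    have "rotate (length R - Suc i) R' = rotate (length R - Suc i + Suc i) R" by (simp only: R'_def rotate_rotate)
    also have "length R - Suc i + Suc i = length R" using il by simp
    also have "rotate (length R) R = R" by simp
    finally have "p = ?f (length R - Suc i, R')" using R(2) hp by simp
    moreover have "length R - Suc i \<le> n" using c(2) l by simp
    ultimately show "p \<in> ?f ` ({..n} \<times> cycs_through X e n)" using R' by blast
  qed
qed (use assms in blast)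

context chamber_graph
begin

text \<open>A shortcut gives an outer circuit with the same closing edge and an inner circuit whose closing edge joins two
  vertices of the outer one. Both are shorter, and the original circuit is recovered from them and
  three cutting positions.\<close>

lemma fine:
  assumes fine: "fine_graph \<Gamma>"
    and fin: "\<And>x y. adj x y \<Longrightarrow> finite {h \<in> C. x \<in> copy h \<and> y \<in> copy h}"
  shows "fine_graph Y"
proof -
  have cycs: "finite (cycs_through Y e n)" if "e \<in> edges Y" for e n
    using that
  proof (induction n arbitrary: e rule: less_induct)
    case (less n)
    obtain x y where e: "e = {x, y}" using less.prems simplicial_Y unfolding simplicial_graph_def by blast
    have xy: "adj x y" using less.prems e by simp
    define H where "H = {h \<in> C. x \<in> copy h \<and> y \<in> copy h}"
    have H: "finite H" using fin[OF xy] by (simp add: H_def)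
    define D where "D = cycs_through \<Gamma> {proj x, proj y} n"
    have D: "finite D"
      unfolding D_def using fine proj_edge[OF xy] by (intro finite_cycs_of_circuits) (simp add: fine_graph_def)
    define I where "I = (\<Union>h\<in>H. (\<lambda>S. map (emb h) S) ` D)"
    define m where "m = n - 1"
    define Ou where "Ou = cycs_through Y e m"
    define Q where "Q = (\<Union>R\<in>Ou. \<Union>a\<in>set R. \<Union>b\<in>{b \<in> set R. adj a b}. \<Union>k1\<in>{..n}. \<Union>k2\<in>{..n}. \<Union>k3\<in>{..n}.
       (\<lambda>T. take k1 R @ take k2 (tl T) @ drop k3 R) ` cycs_through Y {a, b} m)"
    have "finite (I \<union> Q)" if "n > 0"
    proof -
      have m: "m < n" using that by (simp add: m_def)
      have "finite Ou" unfolding Ou_def by (rule less.IH[OF m less.prems])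
      moreover have "finite (cycs_through Y {a, b} m)" if "adj a b" for a b using less.IH[OF m that] .
      ultimately show ?thesis using H D by (auto simp: I_def Q_def)
    qed
    moreover have "cycs_through Y e n \<subseteq> I \<union> Q"
    proof
      fix R assume "R \<in> cycs_through Y e n"
      then have R: "cyc Y R" "length R \<le> n" "{last R, hd R} = e" by (auto simp: cycs_through_def)
      have Rne: "R \<noteq> []" using R by (auto simp: cyc_def)
      from cyc_split[OF R(1)] show "R \<in> I \<union> Q"
      proof
        assume "\<exists>h\<in>C. set R \<subseteq> copy h"
        then obtain h where h: "h \<in> C" "set R \<subseteq> copy h" by blast
        have "x \<in> set R" "y \<in> set R" using R(3) Rne e by (metis doubleton_eq_iff hd_in_set last_in_set)+
        then have "h \<in> H" using h by (auto simp: H_def)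
        moreover have "map proj R \<in> D"
          using cyc_copy_proj[OF R(1) h] R(2,3) Rne e
          by (auto simp: D_def cycs_through_def last_map hd_map doubleton_eq_iff)
        moreover have "R = map (emb h) (map proj R)"
          using copy_proj[OF h(1)] h(2) by (auto simp: comp_def intro!: map_idI[symmetric])
        ultimately show ?thesis
          unfolding I_def by (intro UnI1 UN_I[of h] image_eqI[of R _ "map proj R"])
      next
        assume "\<exists>i j K. shortcut R i j K \<and> i + 2 \<le> j \<and> j - i + 2 \<le> length R"
        then obtain i j K where s: "shortcut R i j K" "i + 2 \<le> j" "j - i + 2 \<le> length R" by blast
        have lt: "i < j" "j < length R" using s by (auto simp: shortcut_def)
        note l = shortcut_lengths[OF R(1) s] and c = cyc_outer_inner[OF R(1) s]
        define U T where "U = outer R i j K" and "T = inner R i j K"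
        have U: "U \<in> Ou" using c l(3) R by (auto simp: Ou_def cycs_through_def U_def m_def)
        have Tm: "length T \<le> m" using l(4) R(2) by (simp add: T_def m_def)
        have cT: "cyc Y T" using c by (simp add: T_def)
        have hT: "hd T = R ! i"
          using lt by (auto simp: T_def inner_def hd_append hd_take hd_drop_conv_nth)
        have lT: "last T = R ! j \<and> K = [] \<or> (\<exists>u. K = [u] \<and> last T = u)"
        proof -
          have "last (take (Suc j - i) (drop i R)) = R ! j"
            using lt by (subst last_conv_nth) (auto simp: min_def intro!: arg_cong[of _ _ "(!) R"])
          then show ?thesis using s(1) by (auto simp: shortcut_def T_def inner_def)
        qed
        have iU: "R ! i \<in> set U" using lt by (auto simp: U_def outer_def take_Suc_conv_app_nth)
        have "R ! j \<in> set (drop j R)" using lt by (metis Cons_nth_drop_Suc list.set_intros(1))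
        then have jU: "last T \<in> set U" using lT by (auto simp: U_def outer_def)
        have ad: "adj (last T) (hd T)" using cT by (simp add: cyc_def)
        have RR: "R = take (Suc i) U @ take (j - i - 1) (tl T) @ drop (Suc i + length K) U"
        proof -
          have "take (Suc i) U = take (Suc i) R" using lt by (simp add: U_def outer_def)
          moreover have "drop (Suc i + length K) U = drop j R" using lt by (simp add: U_def outer_def)
          moreover have "take (j - i - 1) (tl T) = take (j - i - 1) (drop (Suc i) R)"
          proof -
            have "take (Suc j - i) (drop i R) = R ! i # take (j - i) (drop (Suc i) R)"
              using lt by (simp add: Cons_nth_drop_Suc[symmetric] Suc_diff_le)
            then have "tl T = take (j - i) (drop (Suc i) R) @ K" by (simp add: T_def inner_def)
            then show ?thesis using lt by simp
          qed
          moreover have "R = take (Suc i) R @ take (j - i - 1) (drop (Suc i) R) @ drop j R"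
          proof -
            have "drop j R = drop (j - i - 1) (drop (Suc i) R)" using lt by simp
            then show ?thesis by (metis append_take_drop_id)
          qed
          ultimately show ?thesis by simp
        qed
        have "T \<in> cycs_through Y {last T, hd T} m" using cT Tm by (simp add: cycs_through_def)
        with RR have img: "R \<in> (\<lambda>T. take (Suc i) U @ take (j - i - 1) (tl T) @ drop (Suc i + length K) U) `
            cycs_through Y {last T, hd T} m" by (rule image_eqI)
        have k: "Suc i \<in> {..n}" "j - i - 1 \<in> {..n}" "Suc i + length K \<in> {..n}"
          using lt R(2) s(1,2) by (auto simp: shortcut_def)
        have b: "hd T \<in> {b \<in> set U. adj (last T) b}" using iU hT ad by simp
        have "R \<in> Q" unfolding Q_def
          by (rule UN_I[OF U], rule UN_I[OF jU], rule UN_I[OF b], rule UN_I[OF k(1)], rule UN_I[OF k(2)], rule UN_I[OF k(3)], rule img)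
        then show ?thesis by blast
      qed
    qed
    moreover have "cycs_through Y e 0 = {}" by (auto simp: cycs_through_def cyc_def)
    ultimately show ?case by (cases "n = 0") (auto dest: finite_subset)
  qed
  show ?thesis unfolding fine_graph_def using cycs finite_circuits_of_cycs by blast
qed

end

section \<open>Reduction of geodesic polygons\<close>

context chamber_graph
begin

text \<open>The state of the reduction of a geodesic polygon. A closed walk is cut open at a fixed edge, which joins its last
  vertex to its first. Each vertex that lies on a side carries the number of the side; the vertices in the interior
  of a corner carry none. The conditions after the two endpoint labels say: the two endpoints are visited only once; the
  sides appear in order; within a side the walk is geodesic; a corner that leads from side \<open>a\<close> to side \<open>b\<close>
  has length at most \<open>b - a + 1\<close>; and the sides \<open>0\<close> and \<open>m\<close> are the two parts of one geodesic that runs through the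
  closing edge. The bound on corners is the one that survives cutting: if a cut removes the sides between \<open>a\<close> and \<open>b\<close>,
  then the lengths of the old corners and of the shortcut add up to at most this bound.\<close>

definition lwalk :: "nat \<Rightarrow> ('y \<times> nat option) list \<Rightarrow> bool" where
  "lwalk m W \<longleftrightarrow> 3 \<le> length W \<and> 0 < m \<and> m \<le> 4 \<and> edge_path Y (map fst W) \<and>
     adj (fst (W ! (length W - 1))) (fst (W ! 0)) \<and>
     snd (W ! 0) = Some 0 \<and> snd (W ! (length W - 1)) = Some m \<and>
     (\<forall>i < length W. fst (W ! i) = fst (W ! 0) \<longrightarrow> i = 0) \<and>
     (\<forall>i < length W. fst (W ! i) = fst (W ! (length W - 1)) \<longrightarrow> i = length W - 1) \<and>
     (\<forall>i j a b. i \<le> j \<longrightarrow> j < length W \<longrightarrow> snd (W ! i) = Some a \<longrightarrow> snd (W ! j) = Some b \<longrightarrow> a \<le> b) \<and>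
     (\<forall>i j a. i \<le> j \<longrightarrow> j < length W \<longrightarrow> snd (W ! i) = Some a \<longrightarrow> snd (W ! j) = Some a \<longrightarrow>
        gdist Y (fst (W ! i)) (fst (W ! j)) = j - i) \<and>
     (\<forall>i j a b. i < j \<longrightarrow> j < length W \<longrightarrow> snd (W ! i) = Some a \<longrightarrow> snd (W ! j) = Some b \<longrightarrow>
        (\<forall>k. i < k \<longrightarrow> k < j \<longrightarrow> snd (W ! k) = None) \<longrightarrow> j - i \<le> b - a + 1) \<and>
     (\<forall>i j. i < length W \<longrightarrow> j < length W \<longrightarrow> snd (W ! i) = Some 0 \<longrightarrow> snd (W ! j) = Some m \<longrightarrow>
        gdist Y (fst (W ! i)) (fst (W ! j)) = i + 1 + (length W - 1 - j))"

lemma lwalkD: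
  assumes "lwalk m W"
  shows "3 \<le> length W" "0 < m" "m \<le> 4" "edge_path Y (map fst W)"
     "adj (fst (W ! (length W - 1))) (fst (W ! 0))"
     "snd (W ! 0) = Some 0" "snd (W ! (length W - 1)) = Some m"
     "\<And>i. i < length W \<Longrightarrow> fst (W ! i) = fst (W ! 0) \<Longrightarrow> i = 0"
     "\<And>i. i < length W \<Longrightarrow> fst (W ! i) = fst (W ! (length W - 1)) \<Longrightarrow> i = length W - 1"
     "\<And>i j a b. i \<le> j \<Longrightarrow> j < length W \<Longrightarrow> snd (W ! i) = Some a \<Longrightarrow> snd (W ! j) = Some b \<Longrightarrow> a \<le> b"
     "\<And>i j a. i \<le> j \<Longrightarrow> j < length W \<Longrightarrow> snd (W ! i) = Some a \<Longrightarrow> snd (W ! j) = Some a \<Longrightarrow>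
        gdist Y (fst (W ! i)) (fst (W ! j)) = j - i"
     "\<And>i j a b. i < j \<Longrightarrow> j < length W \<Longrightarrow> snd (W ! i) = Some a \<Longrightarrow> snd (W ! j) = Some b \<Longrightarrow>
        (\<And>k. i < k \<Longrightarrow> k < j \<Longrightarrow> snd (W ! k) = None) \<Longrightarrow> j - i \<le> b - a + 1"
     "\<And>i j. i < length W \<Longrightarrow> j < length W \<Longrightarrow> snd (W ! i) = Some 0 \<Longrightarrow> snd (W ! j) = Some m \<Longrightarrow>
        gdist Y (fst (W ! i)) (fst (W ! j)) = i + 1 + (length W - 1 - j)"
proof -
  note * = assms[unfolded lwalk_def]
  show "3 \<le> length W" by (rule *[THEN conjunct1])
  show "0 < m" by (rule *[THEN conjunct2, THEN conjunct1])
  show "m \<le> 4" by (rule *[THEN conjunct2, THEN conjunct2, THEN conjunct1])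
  show "edge_path Y (map fst W)" by (rule *[THEN conjunct2, THEN conjunct2, THEN conjunct2, THEN conjunct1])
  show "adj (fst (W ! (length W - 1))) (fst (W ! 0))" by (rule *[THEN conjunct2, THEN conjunct2, THEN conjunct2, THEN conjunct2, THEN conjunct1])
  show "snd (W ! 0) = Some 0" by (rule *[THEN conjunct2, THEN conjunct2, THEN conjunct2, THEN conjunct2, THEN conjunct2, THEN conjunct1])
  show "snd (W ! (length W - 1)) = Some m" by (rule *[THEN conjunct2, THEN conjunct2, THEN conjunct2, THEN conjunct2, THEN conjunct2, THEN conjunct2, THEN conjunct1])
  show "\<And>i. i < length W \<Longrightarrow> fst (W ! i) = fst (W ! 0) \<Longrightarrow> i = 0"
    by (rule *[THEN conjunct2, THEN conjunct2, THEN conjunct2, THEN conjunct2, THEN conjunct2, THEN conjunct2, THEN conjunct2, THEN conjunct1, rule_format])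
  show "\<And>i. i < length W \<Longrightarrow> fst (W ! i) = fst (W ! (length W - 1)) \<Longrightarrow> i = length W - 1"
    by (rule *[THEN conjunct2, THEN conjunct2, THEN conjunct2, THEN conjunct2, THEN conjunct2, THEN conjunct2, THEN conjunct2, THEN conjunct2, THEN conjunct1, rule_format])
  show "\<And>i j a b. i \<le> j \<Longrightarrow> j < length W \<Longrightarrow> snd (W ! i) = Some a \<Longrightarrow> snd (W ! j) = Some b \<Longrightarrow> a \<le> b"
    by (rule *[THEN conjunct2, THEN conjunct2, THEN conjunct2, THEN conjunct2, THEN conjunct2, THEN conjunct2, THEN conjunct2, THEN conjunct2, THEN conjunct2, THEN conjunct1, rule_format])
  show "\<And>i j a. i \<le> j \<Longrightarrow> j < length W \<Longrightarrow> snd (W ! i) = Some a \<Longrightarrow> snd (W ! j) = Some a \<Longrightarrow>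
        gdist Y (fst (W ! i)) (fst (W ! j)) = j - i"
    by (rule *[THEN conjunct2, THEN conjunct2, THEN conjunct2, THEN conjunct2, THEN conjunct2, THEN conjunct2, THEN conjunct2, THEN conjunct2, THEN conjunct2, THEN conjunct2, THEN conjunct1, rule_format])
  show "\<And>i j a b. i < j \<Longrightarrow> j < length W \<Longrightarrow> snd (W ! i) = Some a \<Longrightarrow> snd (W ! j) = Some b \<Longrightarrow>
        (\<And>k. i < k \<Longrightarrow> k < j \<Longrightarrow> snd (W ! k) = None) \<Longrightarrow> j - i \<le> b - a + 1"
    by (rule *[THEN conjunct2, THEN conjunct2, THEN conjunct2, THEN conjunct2, THEN conjunct2, THEN conjunct2, THEN conjunct2, THEN conjunct2, THEN conjunct2, THEN conjunct2, THEN conjunct2, THEN conjunct1, rule_format])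
  show "\<And>i j. i < length W \<Longrightarrow> j < length W \<Longrightarrow> snd (W ! i) = Some 0 \<Longrightarrow> snd (W ! j) = Some m \<Longrightarrow>
        gdist Y (fst (W ! i)) (fst (W ! j)) = i + 1 + (length W - 1 - j)"
    by (rule *[THEN conjunct2, THEN conjunct2, THEN conjunct2, THEN conjunct2, THEN conjunct2, THEN conjunct2, THEN conjunct2, THEN conjunct2, THEN conjunct2, THEN conjunct2, THEN conjunct2, THEN conjunct2, rule_format])
qed

definition cut :: "('y \<times> nat option) list \<Rightarrow> nat \<Rightarrow> nat \<Rightarrow> 'y list \<Rightarrow> ('y \<times> nat option) list" where
  "cut W i j K = take (Suc i) W @ map (\<lambda>u. (u, None)) K @ drop j W"

lemma cut_length: "i + length K + 1 \<le> j \<Longrightarrow> j < length W \<Longrightarrow>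
    length (cut W i j K) = length W - (j - i - 1 - length K)"
  by (simp add: cut_def)

lemma cut_nth:
  assumes "i + length K + 1 \<le> j" "j < length W"
  shows "p \<le> i \<Longrightarrow> cut W i j K ! p = W ! p"
    "i < p \<Longrightarrow> p \<le> i + length K \<Longrightarrow> cut W i j K ! p = (K ! (p - i - 1), None)"
    "i + length K < p \<Longrightarrow> cut W i j K ! p = W ! (p + (j - i - 1 - length K))"
proof -
  show "p \<le> i \<Longrightarrow> cut W i j K ! p = W ! p"
    using assms by (simp add: cut_def nth_append)
  show "cut W i j K ! p = (K ! (p - i - 1), None)" if "i < p" "p \<le> i + length K"
  proof -
    have "p - Suc i < length K" using that by linarith
    then show ?thesis using assms that by (simp add: cut_def nth_append)
  qed
  assume p: "i + length K < p"
  have "\<not> p - Suc i < length K" using p by linarith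
  then have "cut W i j K ! p = drop j W ! (p - Suc i - length K)"
    using assms p by (simp add: cut_def nth_append)
  also have "\<dots> = W ! (j + (p - Suc i - length K))" using assms by simp
  also have "j + (p - Suc i - length K) = p + (j - i - 1 - length K)" using assms p by linarith
  finally show "cut W i j K ! p = W ! (p + (j - i - 1 - length K))" .
qed

text \<open>Shortening a walk within a geodesic side is impossible, so every side keeps at most one segment. Only the length of the
  new corner has to be controlled, which is the last premise.\<close>

lemma cut_lwalk:
  assumes L: "lwalk m W" and ij: "i + length K + 2 \<le> j" "j < length W"
    and K: "K = [] \<and> adj (fst (W ! i)) (fst (W ! j)) \<or>
      (\<exists>u. K = [u] \<and> u \<notin> fst ` set W \<and> adj (fst (W ! i)) u \<and> adj u (fst (W ! j)))"
    and len: "3 \<le> length (cut W i j K)"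
    and cond: "\<And>p q a b. p \<le> i \<Longrightarrow> j \<le> q \<Longrightarrow> q < length W \<Longrightarrow> snd (W ! p) = Some a \<Longrightarrow> snd (W ! q) = Some b \<Longrightarrow>
        (\<And>k. p < k \<Longrightarrow> k \<le> i \<Longrightarrow> snd (W ! k) = None) \<Longrightarrow> (\<And>k. j \<le> k \<Longrightarrow> k < q \<Longrightarrow> snd (W ! k) = None) \<Longrightarrow>
        (i - p) + length K + 1 + (q - j) \<le> b - a + 1"
  shows "lwalk m (cut W i j K)"
proof -
  note D = lwalkD[OF L]
  define s where "s = j - i - 1 - length K"
  define V where "V = cut W i j K"
  have ij': "i + length K + 1 \<le> j" using ij by simp
  have s: "1 \<le> s" "j = i + 1 + length K + s" using ij by (auto simp: s_def)
  have lV: "length V = length W - s" "s < length W" using cut_length[OF ij' ij(2)] ij by (auto simp: V_def s_def)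
  have V1: "V ! p = W ! p" if "p \<le> i" for p using cut_nth(1)[OF ij' ij(2)] that by (simp add: V_def)
  have V2: "V ! p = (K ! (p - i - 1), None)" if "i < p" "p \<le> i + length K" for p
    using cut_nth(2)[OF ij' ij(2)] that by (simp add: V_def)
  have V3: "V ! p = W ! (p + s)" if "i + length K < p" for p
    using cut_nth(3)[OF ij' ij(2)] that by (simp add: V_def s_def)
  have lab: "p \<le> i \<or> i + length K < p" if "snd (V ! p) = Some a" for p a
    using V2[of p] that by fastforce
  have last: "V ! (length V - 1) = W ! (length W - 1)" 
    using V3[of "length V - 1"] lV s ij by simp
  have first: "V ! 0 = W ! 0" using V1 by simp
  have KW: "u \<notin> fst ` set W" if "u \<in> set K" for u
    using K that by (elim disjE exE conjE) simp_all
  have V2n: "fst (V ! p) \<notin> fst ` set W" if "i < p" "p \<le> i + length K" for p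
  proof -
    have "K ! (p - i - 1) \<in> set K" using that by (intro nth_mem) linarith
    then show ?thesis using V2[OF that] KW by simp
  qed
  have A: "edge_path Y (take (Suc i) (map fst W))" "take (Suc i) (map fst W) \<noteq> []"
      "last (take (Suc i) (map fst W)) = fst (W ! i)"
    using edge_path_take[OF D(4), of "Suc i"] ij D(1)
    by (simp_all) (auto simp: take_Suc_conv_app_nth simp flip: take_map)
  have B: "edge_path Y (drop j (map fst W))" "drop j (map fst W) \<noteq> []" "hd (drop j (map fst W)) = fst (W ! j)"
    using edge_path_drop[OF D(4), of j] ij by (auto simp: hd_drop_conv_nth)
  have mV: "map fst V = take (Suc i) (map fst W) @ K @ drop j (map fst W)"
    by (simp add: V_def cut_def take_map drop_map o_def)
  have uv: "u \<in> verts Y" if "K = [u]" for u using K that adj_verts by auto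
  have P: "edge_path Y (map fst V)"
    unfolding mV using K A B uv edge_path_append[OF A(2) B(2)] edge_path_append[of "take (Suc i) (map fst W) @ K" "drop j (map fst W)"]
       edge_path_append[OF A(2), of K] by (auto simp: edge_path_def[of Y "[_]"])
  have Vd: "gdist Y (fst (V ! p)) (fst (V ! q)) \<le> q - p" if "p \<le> q" "q < length V" for p q
    using y.gdist_path[OF P, of p q] that by simp
  have G: "gdist Y (fst (V ! p)) (fst (V ! q)) = q - p"
    if pq: "p \<le> q" "q < length V" "snd (V ! p) = Some a" "snd (V ! q) = Some a" for p q a
  proof (cases "q \<le> i \<or> i + length K < p")
    case True
    then show ?thesis using pq D(11)[of p q a] D(11)[of "p + s" "q + s" a] V1 V3 lV by auto
  next
    case False
    then have pq': "p \<le> i" "i + length K < q" using lab pq by auto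
    then have "gdist Y (fst (V ! p)) (fst (V ! q)) = q + s - p"
      using D(11)[of p "q + s" a] pq V1 V3 lV by simp
    then show ?thesis using Vd[OF pq(1,2)] s pq by simp
  qed
  have M: "a \<le> b" if pq: "p \<le> q" "q < length V" "snd (V ! p) = Some a" "snd (V ! q) = Some b" for p q a b
    using lab[OF pq(3)] lab[OF pq(4)] pq V1[of p] V1[of q] V3[of p] V3[of q] lV
      D(10)[of p q a b] D(10)[of p "q + s" a b] D(10)[of "p + s" "q + s" a b] by auto
  have U1: "p = 0" if "p < length V" "fst (V ! p) = fst (V ! 0)" for p
  proof (rule ccontr)
    assume p0: "p \<noteq> 0"
    have "fst (V ! p) \<in> fst ` set W"
      unfolding that(2) first using D(1) by (intro imageI nth_mem) linarith
    then have "p \<le> i \<or> i + length K < p" using V2n[of p] by linarith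
    moreover have "p < length W" "p + s < length W" using that(1) lV by linarith+
    ultimately show False using that first V1[of p] V3[of p] D(8)[of p] D(8)[of "p + s"] p0 s by auto
  qed
  have U2: "p = length V - 1" if "p < length V" "fst (V ! p) = fst (V ! (length V - 1))" for p
  proof -
    have "fst (V ! p) \<in> fst ` set W"
      unfolding that(2) last using D(1) by (intro imageI nth_mem) linarith
    then have "p \<le> i \<or> i + length K < p" using V2n[of p] by linarith
    moreover have "p < length W" "p + s < length W" using that(1) lV by linarith+
    ultimately show ?thesis using that last V1[of p] V3[of p] D(9)[of p] D(9)[of "p + s"] lV s ij by auto
  qed
  have C: "q - p \<le> b - a + 1" if pq: "p < q" "q < length V" "snd (V ! p) = Some a" "snd (V ! q) = Some b"
     and none: "\<And>k. p < k \<Longrightarrow> k < q \<Longrightarrow> snd (V ! k) = None" for p q a b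
  proof -
    consider "q \<le> i" | "i + length K < p" | "p \<le> i" "i + length K < q" using lab pq by blast
    then show ?thesis
    proof cases
      case 1
      then show ?thesis using D(12)[of p q a b] pq none V1 lV by auto
    next
      case 2
      have "snd (W ! k) = None" if "p + s < k" "k < q + s" for k
        using none[of "k - s"] V3[of "k - s"] that 2 by auto
      then show ?thesis using D(12)[of "p + s" "q + s" a b] pq 2 V3 lV by auto
    next
      case 3
      have "snd (W ! k) = None" if "p < k" "k \<le> i" for k using none[of k] V1 that 3 by auto
      moreover have "snd (W ! k) = None" if "j \<le> k" "k < q + s" for k
        using none[of "k - s"] V3[of "k - s"] that 3 s by auto
      ultimately have "(i - p) + length K + 1 + (q + s - j) \<le> b - a + 1"
        using cond[of p "q + s" a b] pq 3 V1 V3 lV s by auto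
      then show ?thesis using 3 s by simp
    qed
  qed
  have Z: "gdist Y (fst (V ! p)) (fst (V ! q)) = p + 1 + (length V - 1 - q)"
    if pq: "p < length V" "q < length V" "snd (V ! p) = Some 0" "snd (V ! q) = Some m" for p q
  proof -
    have "p \<le> i"
    proof (rule ccontr)
      assume "\<not> p \<le> i"
      then have p: "i + length K < p" using lab pq by blast
      then have "gdist Y (fst (V ! 0)) (fst (V ! p)) = p + s"
        using D(11)[of 0 "p + s" 0] pq V3 first D(6) lV by simp
      then show False using Vd[of 0 p] pq s by simp
    qed
    moreover have "i + length K < q"
    proof (rule ccontr)
      assume "\<not> i + length K < q"
      then have q: "q \<le> i" using lab pq by blast
      then have "gdist Y (fst (V ! q)) (fst (V ! (length V - 1))) = length W - 1 - q"
        using D(11)[of q "length W - 1" m] pq V1 last D(7) lV ij by simp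
      moreover have "gdist Y (fst (V ! q)) (fst (V ! (length V - 1))) \<le> length V - 1 - q"
        by (rule Vd) (use pq in auto)
      ultimately show False using pq s lV by linarith
    qed
    ultimately show ?thesis using D(13)[of p "q + s"] pq V1 V3 lV s by simp
  qed
  show ?thesis unfolding V_def[symmetric] lwalk_def
    using len[folded V_def] D(2,3,5,6,7) P G M U1 U2 C Z first last by simp
qed

lemma cut_labels: "x \<in> set (cut W i j K) \<Longrightarrow> snd x \<noteq> None \<Longrightarrow> x \<in> set W"
  by (auto simp: cut_def dest: in_set_takeD in_set_dropD)

text \<open>Let \<open>k\<^sub>1\<close> and \<open>k\<^sub>2\<close> be the first and the last position between \<open>i\<close> and \<open>j\<close> that lie on a side. If these were on the
  same side, the inner circuit would consist of a geodesic and of a path of length at most 6 with the same ends,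
  and would be too short. So a shortcut of length two skips from one side to a different one, which is what
  the bound \<open>b - a + 1\<close> pays for.\<close>

lemma corner_bound:
  assumes L: "lwalk m W" and ij: "i + length K + 2 \<le> j" "j < length W"
    and K: "length K = 0 \<or> length K = 1 \<and> 19 \<le> j - i \<and> gdist Y (fst (W ! i)) (fst (W ! j)) \<le> 2"
    and pq: "p \<le> i" "j \<le> q" "q < length W" "snd (W ! p) = Some a" "snd (W ! q) = Some b"
    and n1: "\<And>k. p < k \<Longrightarrow> k \<le> i \<Longrightarrow> snd (W ! k) = None" and n2: "\<And>k. j \<le> k \<Longrightarrow> k < q \<Longrightarrow> snd (W ! k) = None"
  shows "(i - p) + length K + 1 + (q - j) \<le> b - a + 1"
proof (cases "\<exists>k. i \<le> k \<and> k \<le> j \<and> snd (W ! k) \<noteq> None")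
  case False
  have "snd (W ! k) = None" if "p < k" "k < q" for k
    using n1[of k] n2[of k] False that by (meson nat_le_linear)
  then have "q - p \<le> b - a + 1"
    using lwalkD(12)[OF L _ pq(3,4,5)] pq(1,2) ij by simp
  then show ?thesis using pq ij by linarith
next
  case True
  define k1 where "k1 = (LEAST k. i \<le> k \<and> k \<le> j \<and> snd (W ! k) \<noteq> None)"
  have k1: "i \<le> k1" "k1 \<le> j" "snd (W ! k1) \<noteq> None" using LeastI_ex[OF True] by (auto simp: k1_def)
  have k1min: "snd (W ! k) = None" if "i \<le> k" "k < k1" for k
    using not_less_Least[of k "\<lambda>k. i \<le> k \<and> k \<le> j \<and> snd (W ! k) \<noteq> None"] that k1 by (auto simp: k1_def)
  define k2 where "k2 = (GREATEST k. i \<le> k \<and> k \<le> j \<and> snd (W ! k) \<noteq> None)"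
  have k2: "i \<le> k2" "k2 \<le> j" "snd (W ! k2) \<noteq> None"
    using GreatestI_ex_nat[OF True, of j] by (auto simp: k2_def)
  have k2max: "snd (W ! k) = None" if "k2 < k" "k \<le> j" for k
  proof (rule ccontr)
    assume "snd (W ! k) \<noteq> None"
    then have "k \<le> k2" unfolding k2_def by (intro Greatest_le_nat[of _ _ j]) (use that k2 in auto)
    then show False using that by simp
  qed
  have k12: "k1 \<le> k2" using k1min k2 by (meson linorder_not_le)
  obtain c e where ce: "snd (W ! k1) = Some c" "snd (W ! k2) = Some e" using k1 k2 by auto
  have mono: "a \<le> c" "c \<le> e" "e \<le> b"
    using lwalkD(10)[OF L, of p k1 a c] lwalkD(10)[OF L, of k1 k2 c e] lwalkD(10)[OF L, of k2 q e b] pq k1 k2 k12 ce ij by auto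
  have "b \<le> m" by (rule lwalkD(10)[OF L _ _ pq(5) lwalkD(7)[OF L]]) (use pq in auto)
  then have b4: "b \<le> 4" using lwalkD(3)[OF L] by simp
  have l: "i - p \<le> c - a" "k1 - i \<le> c - a"
  proof -
    have "i - p \<le> c - a \<and> k1 - i \<le> c - a"
    proof (cases "k1 = i")
      case True
      then have "p = i" using n1[of i] k1 pq by (metis le_neq_implies_less order_refl)
      then show ?thesis using True by simp
    next
      case False
      then have "k1 - p \<le> c - a + 1"
      proof (intro lwalkD(12)[OF L _ _ pq(4) ce(1)])
        show "snd (W ! k) = None" if "p < k" "k < k1" for k
          using n1[of k] k1min[of k] that by (meson nat_le_linear)
      qed (use False k1 pq ij in auto)
      moreover have "p \<noteq> i" using False k1min[of i] k1 pq by auto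
      ultimately show ?thesis using False k1 pq by linarith
    qed
    then show "i - p \<le> c - a" "k1 - i \<le> c - a" by auto
  qed
  have r: "q - j \<le> b - e" "j - k2 \<le> b - e"
  proof -
    have "q - j \<le> b - e \<and> j - k2 \<le> b - e"
    proof (cases "k2 = j")
      case True
      then have "q = j" using n2[of j] k2 pq by (metis le_neq_implies_less order_refl)
      then show ?thesis using True by simp
    next
      case False
      then have "q - k2 \<le> b - e + 1"
      proof (intro lwalkD(12)[OF L _ _ ce(2) pq(5)])
        show "snd (W ! k) = None" if "k2 < k" "k < q" for k
          using n2[of k] k2max[of k] that by (meson nat_le_linear)
      qed (use False k2 pq ij in auto)
      moreover have "q \<noteq> j" using False k2max[of j] k2 pq by auto
      ultimately show ?thesis using False k2 pq by linarith
    qed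
    then show "q - j \<le> b - e" "j - k2 \<le> b - e" by auto
  qed
  show ?thesis
  proof (cases "length K = 0")
    case True
    then show ?thesis using l r mono by linarith
  next
    case False
    then have K1: "length K = 1" "19 \<le> j - i" "gdist Y (fst (W ! i)) (fst (W ! j)) \<le> 2" using K by auto
    have "c \<noteq> e"
    proof
      assume "c = e"
      then have g: "gdist Y (fst (W ! k1)) (fst (W ! k2)) = k2 - k1"
        using lwalkD(11)[OF L, of k1 k2 c] k12 k2 ce ij by simp
      have v: "fst (W ! k) \<in> verts Y" if "k < length W" for k
        using lwalkD(4)[OF L] that by (auto simp: edge_path_def subset_iff)
      have p1: "gdist Y (fst (W ! i)) (fst (W ! k1)) \<le> k1 - i" "gdist Y (fst (W ! k2)) (fst (W ! j)) \<le> j - k2"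
        using y.gdist_path[OF lwalkD(4)[OF L], of i k1] y.gdist_path[OF lwalkD(4)[OF L], of k2 j] k1 k2 ij by auto
      have lts: "i < length W" "k1 < length W" "k2 < length W" using k1 k2 ij by auto
      have "gdist Y (fst (W ! k1)) (fst (W ! k2)) \<le> gdist Y (fst (W ! k1)) (fst (W ! i)) + gdist Y (fst (W ! i)) (fst (W ! j))
           + gdist Y (fst (W ! j)) (fst (W ! k2))"
        using y.gdist_triangle[OF v[OF lts(2)] v[OF lts(1)] v[OF lts(3)]] y.gdist_triangle[OF v[OF lts(1)] v[OF ij(2)] v[OF lts(3)]]
        by linarith
      also have "\<dots> \<le> (k1 - i) + 2 + (j - k2)"
        using p1 K1(3) y.gdist_sym[OF v[OF lts(1)] v[OF lts(2)]] y.gdist_sym[OF v[OF ij(2)] v[OF lts(3)]] by linarith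
      finally have "k2 - k1 \<le> (k1 - i) + 2 + (j - k2)" using g by simp
      moreover have "j - i = (k1 - i) + (k2 - k1) + (j - k2)" using k1(1,2) k2(2) k12 by simp
      ultimately have "j - i \<le> 2 * ((k1 - i) + (j - k2)) + 2" by simp
      also have "(k1 - i) + (j - k2) \<le> (c - a) + (b - c)" using l(2) r(2) \<open>c = e\<close> by simp
      also have "(c - a) + (b - c) \<le> 4" using mono b4 \<open>c = e\<close> by simp
      finally show False using K1(2) by simp
    qed
    then show ?thesis using l r mono K1 by linarith
  qed
qed

text \<open>A shortest labelled walk with the given ends is a circuit, and it has no shortcuts, so it lies in a copy.\<close>

lemma polygon_reduction:
  assumes L0: "lwalk m W0"
  shows "\<exists>W. lwalk m W \<and> length W \<le> length W0 \<and> W ! 0 = W0 ! 0 \<and> W ! (length W - 1) = W0 ! (length W0 - 1) \<and>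
    (\<forall>x\<in>set W. snd x \<noteq> None \<longrightarrow> x \<in> set W0) \<and> cyc Y (map fst W) \<and> (\<exists>h\<in>C. fst ` set W \<subseteq> copy h)"
proof -
  define Q where "Q W \<longleftrightarrow> lwalk m W \<and> W ! 0 = W0 ! 0 \<and> W ! (length W - 1) = W0 ! (length W0 - 1) \<and>
    (\<forall>x\<in>set W. snd x \<noteq> None \<longrightarrow> x \<in> set W0)" for W
  have "Q W0" using L0 by (simp add: Q_def)
  then obtain W where W: "Q W" and min: "\<And>V. Q V \<Longrightarrow> length W \<le> length V"
    using ex_has_least_nat[of Q W0 length] by blast
  have L: "lwalk m W" using W by (simp add: Q_def)
  note D = lwalkD[OF L]
  have nocut: False
    if ij: "i + length K + 2 \<le> j" "j < length W"
      and K: "K = [] \<and> adj (fst (W ! i)) (fst (W ! j)) \<or>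
        (\<exists>u. K = [u] \<and> u \<notin> fst ` set W \<and> adj (fst (W ! i)) u \<and> adj u (fst (W ! j)) \<and> 19 \<le> j - i)"
      and len: "3 \<le> length (cut W i j K)" for i j K
  proof -
    have ij': "i + length K + 1 \<le> j" using ij by simp
    have K': "length K = 0 \<or> length K = 1 \<and> 19 \<le> j - i \<and> gdist Y (fst (W ! i)) (fst (W ! j)) \<le> 2"
      using K
    proof (elim disjE conjE exE)
      fix u assume u: "K = [u]" "adj (fst (W ! i)) u" "adj u (fst (W ! j))" "19 \<le> j - i"
      then have "gdist Y (fst (W ! i)) (fst (W ! j)) \<le> 1 + 1"
        using y.gdist_triangle[of "fst (W ! i)" u "fst (W ! j)"] y.gdist_adj adj_verts by (metis (no_types))
      then show ?thesis using u by simp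
    qed simp
    have "lwalk m (cut W i j K)"
    proof (rule cut_lwalk[OF L ij _ len])
      show "K = [] \<and> adj (fst (W ! i)) (fst (W ! j)) \<or>
        (\<exists>u. K = [u] \<and> u \<notin> fst ` set W \<and> adj (fst (W ! i)) u \<and> adj u (fst (W ! j)))"
        using K by blast
    qed (rule corner_bound[OF L ij K'])
    moreover have "cut W i j K ! 0 = W ! 0" using cut_nth(1)[OF ij' ij(2)] by simp
    moreover have "cut W i j K ! (length (cut W i j K) - 1) = W ! (length W - 1)"
      using cut_nth(3)[OF ij' ij(2), of "length (cut W i j K) - 1"] cut_length[OF ij' ij(2)] ij by simp
    ultimately have "Q (cut W i j K)" using W cut_labels by (fastforce simp: Q_def)
    then show False using min cut_length[OF ij' ij(2)] ij by fastforce
  qed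
  have ne: "W \<noteq> []" using D(1) by auto
  have dist: "distinct (map fst W)"
  proof (rule ccontr)
    assume "\<not> distinct (map fst W)"
    then obtain i j where ij: "i < j" "j < length W" "fst (W ! i) = fst (W ! j)"
      unfolding distinct_conv_nth by (auto simp: nat_neq_iff)
    have i0: "0 < i" using D(8)[of j] ij by (cases "i = 0") auto
    have jn: "Suc j < length W" using D(9)[of i] ij by (cases "j = length W - 1") auto
    have "adj (fst (W ! j)) (fst (W ! Suc j))" using D(4) jn by (auto simp: edge_path_iff_nth)
    moreover have "3 \<le> length (cut W i (Suc j) [])" using ij i0 jn by (simp add: cut_def)
    ultimately show False using nocut[of i "[]" "Suc j"] ij jn by simp
  qed
  have cW: "cyc Y (map fst W)"
    using D(1,4,5) dist ne by (simp add: cyc_def last_conv_nth hd_conv_nth)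
  have "\<not> (\<exists>i j K. shortcut (map fst W) i j K \<and> i + 2 \<le> j \<and> j - i + 2 \<le> length (map fst W))"
  proof
    assume "\<exists>i j K. shortcut (map fst W) i j K \<and> i + 2 \<le> j \<and> j - i + 2 \<le> length (map fst W)"
    then obtain i j K where s: "shortcut (map fst W) i j K" "i + 2 \<le> j" "j - i + 2 \<le> length (map fst W)" by blast
    note l = shortcut_lengths[OF cW s]
    have lt: "i < j" "j < length W" and K1: "length K \<le> 1" using s by (auto simp: shortcut_def)
    have ji: "19 \<le> j - i" using l(1) length_inner[of i j "map fst W" K] lt K1 by simp
    have "length (cut W i j K) = length (outer (map fst W) i j K)" by (simp add: cut_def outer_def)
    then have "3 \<le> length (cut W i j K)" using l(2) by simp
    moreover have "i + length K + 2 \<le> j" using ji K1 by linarith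
    ultimately show False using nocut[of i K j] s(1) lt ji by (auto simp: shortcut_def)
  qed
  then have "\<exists>h\<in>C. fst ` set W \<subseteq> copy h" using cyc_split[OF cW] by auto
  then show ?thesis using W L min[OF \<open>Q W0\<close>] cW by (auto simp: Q_def)
qed

end

definition lab :: "nat \<Rightarrow> 'a list \<Rightarrow> ('a \<times> nat option) list" where
  "lab l p = map (\<lambda>y. (y, Some l)) p"

lemma lab_simps [simp]: "length (lab l p) = length p" "map fst (lab l p) = p"
  "i < length p \<Longrightarrow> lab l p ! i = (p ! i, Some l)" "set (lab l p) = (\<lambda>y. (y, Some l)) ` set p"
  by (auto simp: lab_def comp_def)

context chamber_graph
begin

text \<open>A walk without corners that follows its sides one after the other.\<close>

definition blocks :: "('y \<times> nat option) list \<Rightarrow> bool" where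
  "blocks W \<longleftrightarrow> (\<forall>i<length W. snd (W ! i) \<noteq> None) \<and>
     (\<forall>i j a b. i \<le> j \<longrightarrow> j < length W \<longrightarrow> snd (W ! i) = Some a \<longrightarrow> snd (W ! j) = Some b \<longrightarrow> a \<le> b) \<and>
     (\<forall>i j a. i \<le> j \<longrightarrow> j < length W \<longrightarrow> snd (W ! i) = Some a \<longrightarrow> snd (W ! j) = Some a \<longrightarrow>
        gdist Y (fst (W ! i)) (fst (W ! j)) = j - i)"

lemma blocks_append:
  assumes W: "blocks W" and less: "\<And>x a. x \<in> set W \<Longrightarrow> snd x = Some a \<Longrightarrow> a < l"
    and p: "\<And>i j. i \<le> j \<Longrightarrow> j < length p \<Longrightarrow> gdist Y (p ! i) (p ! j) = j - i"
  shows "blocks (W @ lab l p)"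
proof -
  let ?V = "W @ lab l p"
  have n1: "?V ! i = W ! i" if "i < length W" for i using that by (simp add: nth_append)
  have n2: "?V ! i = (p ! (i - length W), Some l)" if "\<not> i < length W" "i < length ?V" for i
    using that by (simp add: nth_append)
  have ls: "a < l" if "i < length W" "snd (W ! i) = Some a" for i a using less that nth_mem by blast
  show ?thesis unfolding blocks_def
  proof (intro conjI allI impI)
    fix i assume "i < length ?V"
    then show "snd (?V ! i) \<noteq> None" using W n1[of i] n2[of i] by (cases "i < length W") (auto simp: blocks_def)
  next
    fix i j a b assume ij: "i \<le> j" "j < length ?V" "snd (?V ! i) = Some a" "snd (?V ! j) = Some b"
    show "a \<le> b"
    proof (cases "j < length W")
      case True
      then have "snd (W ! i) = Some a" "snd (W ! j) = Some b" using ij n1[of i] n1[of j] by auto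
      then show ?thesis using W ij(1) True unfolding blocks_def by blast
    next
      case False
      then have "b = l" using n2[of j] ij by simp
      then show ?thesis using ls[of i a] n1[of i] n2[of i] ij by (cases "i < length W") auto
    qed
  next
    fix i j a assume ij: "i \<le> j" "j < length ?V" "snd (?V ! i) = Some a" "snd (?V ! j) = Some a"
    show "gdist Y (fst (?V ! i)) (fst (?V ! j)) = j - i"
    proof (cases "j < length W")
      case True
      then have "snd (W ! i) = Some a" "snd (W ! j) = Some a" "?V ! i = W ! i" "?V ! j = W ! j"
        using ij n1[of i] n1[of j] by auto
      then show ?thesis using W ij(1) True unfolding blocks_def by simp
    next
      case False
      then have "a = l" using n2[of j] ij by simp
      then have iW: "\<not> i < length W" using ls[of i a] n1[of i] ij by auto
      have "gdist Y (p ! (i - length W)) (p ! (j - length W)) = (j - length W) - (i - length W)"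
        using ij False by (intro p) auto
      then show ?thesis using n2[OF False ij(2)] n2[OF iW] ij False iW by simp
    qed
  qed
qed

lemma edge_path_join:
  assumes "edge_path Y p" "edge_path Y q" "last p = hd q"
  shows "edge_path Y (p @ tl q)" "last (p @ tl q) = last q"
proof -
  have ne: "p \<noteq> []" "q \<noteq> []" using assms by (auto simp: edge_path_def)
  then show "edge_path Y (p @ tl q)"
    using assms by (cases q; cases "tl q = []") (auto simp: edge_path_def successively_append_iff successively_Cons)
  show "last (p @ tl q) = last q" using ne assms by (cases q) auto
qed

lemma geodesic_tl:
  assumes "geodesic_list Y p" "i \<le> j" "j < length (tl p)"
  shows "gdist Y (tl p ! i) (tl p ! j) = j - i"
  using assms y.geodesic_list_nth[OF assms(1), of "Suc i" "Suc j"] by (simp add: nth_tl)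

text \<open>The list \<open>A4\<close> followed by \<open>A\<close> is a geodesic that has been cut open at one of its edges. Consecutive sides share an
  endpoint, which \<open>tl\<close> removes from the second one.\<close>

lemma lwalk_build:
  assumes A: "geodesic_list Y A" and B1: "geodesic_list Y B1" and B2: "geodesic_list Y B2"
    and B3: "geodesic_list Y B3" and A4: "geodesic_list Y A4"
    and j: "last A = hd B1" "last B1 = hd B2" "last B2 = hd B3" "last B3 = hd A4"
    and ne: "tl A4 \<noteq> []"
    and Z: "\<And>p q. p < length A \<Longrightarrow> q < length A4 \<Longrightarrow> gdist Y (A ! p) (A4 ! q) = p + 1 + (length A4 - 1 - q)"
    and e: "adj (last A4) (hd A)"
    and U: "hd A \<notin> set (tl B1) \<union> set (tl B2) \<union> set (tl B3)" "last A4 \<notin> set (tl B1) \<union> set (tl B2) \<union> set (tl B3)"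
    and len: "3 \<le> length A + length (tl B1) + length (tl B2) + length (tl B3) + length (tl A4)"
  shows "lwalk 4 (lab 0 A @ lab 1 (tl B1) @ lab 2 (tl B2) @ lab 3 (tl B3) @ lab 4 (tl A4))"
proof -
  define R where "R = lab 1 (tl B1) @ lab 2 (tl B2) @ lab 3 (tl B3) @ lab 4 (tl A4)"
  define Q where "Q = lab 0 A @ lab 1 (tl B1) @ lab 2 (tl B2) @ lab 3 (tl B3)"
  define W where "W = lab 0 A @ R"
  have W2: "W = Q @ lab 4 (tl A4)" by (simp add: W_def Q_def R_def)
  have An: "A \<noteq> []" "A4 \<noteq> []" using A ne by (auto simp: geodesic_list_def edge_path_def)
  have lW: "length W = length A + length R" "length W = length Q + (length A4 - 1)"
    by (simp add: W_def) (simp add: W2)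
  have lA4: "2 \<le> length A4" using ne An by (cases A4; cases "tl A4") auto
  have W0: "W ! i = (A ! i, Some 0)" if "i < length A" for i using that by (simp add: W_def nth_append)
  have WR: "W ! i \<in> set R" if "\<not> i < length A" "i < length W" for i
    using that lW by (auto simp: W_def nth_append intro!: nth_mem)
  have WQ: "W ! i \<in> set Q" if "i < length Q" for i using that by (simp add: W2 nth_append)
  have W4: "W ! i = (A4 ! (i - length Q + 1), Some 4)" if "\<not> i < length Q" "i < length W" for i
    using that lW by (simp add: W2 nth_append nth_tl)
  have first: "W ! 0 = (hd A, Some 0)" using W0[of 0] An by (simp add: hd_conv_nth)
  have last: "W ! (length W - 1) = (last A4, Some 4)"
  proof -
    have "length W - 1 - length Q + 1 = length A4 - 1" using lW lA4 by linarith
    then show ?thesis using W4[of "length W - 1"] lW lA4 An by (simp add: last_conv_nth)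
  qed
  have dA: "distinct A" "distinct A4" using y.geodesic_list_distinct A A4 by auto
  have AA4: "A ! p \<noteq> A4 ! q" if "p < length A" "q < length A4" for p q
  proof
    assume "A ! p = A4 ! q"
    moreover have "A ! p \<in> verts Y" using y.geodesic_list_verts[OF A] that nth_mem by blast
    ultimately have "gdist Y (A ! p) (A4 ! q) = 0" by (metis y.gdist_self)
    then show False using Z[OF that] by simp
  qed
  have P: "edge_path Y (map fst W)"
  proof -
    have p: "edge_path Y A" "edge_path Y B1" "edge_path Y B2" "edge_path Y B3" "edge_path Y A4"
      using A B1 B2 B3 A4 by (auto simp: geodesic_list_def)
    note e1 = edge_path_join[OF p(1,2) j(1)]
    note e2 = edge_path_join[OF e1(1) p(3) HOL.trans[OF e1(2) j(2)]]
    note e3 = edge_path_join[OF e2(1) p(4) HOL.trans[OF e2(2) j(3)]]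
    note e4 = edge_path_join[OF e3(1) p(5) HOL.trans[OF e3(2) j(4)]]
    show ?thesis using e4(1) by (simp add: W_def R_def)
  qed
  have bl: "blocks W"
  proof -
    have 0: "blocks (lab 0 A)"
      using blocks_append[of "[]" 0 A] y.geodesic_list_nth[OF A] by (simp add: blocks_def)
    have 1: "blocks (lab 0 A @ lab 1 (tl B1))" by (rule blocks_append[OF 0]) (use geodesic_tl[OF B1] in auto)
    have 2: "blocks ((lab 0 A @ lab 1 (tl B1)) @ lab 2 (tl B2))"
      by (rule blocks_append[OF 1]) (use geodesic_tl[OF B2] in auto)
    have 3: "blocks (((lab 0 A @ lab 1 (tl B1)) @ lab 2 (tl B2)) @ lab 3 (tl B3))"
      by (rule blocks_append[OF 2]) (use geodesic_tl[OF B3] in auto)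
    have "blocks ((((lab 0 A @ lab 1 (tl B1)) @ lab 2 (tl B2)) @ lab 3 (tl B3)) @ lab 4 (tl A4))"
      by (rule blocks_append[OF 3]) (use geodesic_tl[OF A4] in auto)
    then show ?thesis by (simp add: W_def R_def)
  qed
  have U1: "i = 0" if i: "i < length W" "fst (W ! i) = fst (W ! 0)" for i
  proof (cases "i < length A")
    case True
    then have "A ! i = A ! 0" using i first W0[of i] An by (simp add: hd_conv_nth)
    then show ?thesis using dA True by (metis An(1) length_greater_0_conv nth_eq_iff_index_eq)
  next
    case False
    then have "fst (W ! i) \<in> set (tl B1) \<union> set (tl B2) \<union> set (tl B3) \<union> set (tl A4)"
      using WR[OF False i(1)] by (auto simp: R_def)
    then have "hd A \<in> set (tl A4)" using i first U by auto
    then have "hd A \<in> set A4" by (metis An(2) list.set_sel(2))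
    then obtain q where "q < length A4" "A4 ! q = A ! 0" using An by (metis hd_conv_nth in_set_conv_nth)
    then show ?thesis using AA4[of 0 q] An by simp
  qed
  have U2: "i = length W - 1" if i: "i < length W" "fst (W ! i) = fst (W ! (length W - 1))" for i
  proof (cases "i < length Q")
    case True
    then have "fst (W ! i) \<in> set A \<union> set (tl B1) \<union> set (tl B2) \<union> set (tl B3)"
      using WQ[OF True] by (auto simp: Q_def)
    then have "last A4 \<in> set A" using i last U by auto
    then obtain p where "p < length A" "A ! p = A4 ! (length A4 - 1)" using An by (metis last_conv_nth in_set_conv_nth)
    then show ?thesis using AA4[of p "length A4 - 1"] An by simp
  next
    case False
    then have "A4 ! (i - length Q + 1) = A4 ! (length A4 - 1)" using i last W4[OF False i(1)] An by (simp add: last_conv_nth)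
    then have "i - length Q + 1 = length A4 - 1"
      using dA(2) lW lA4 i(1) False by (subst (asm) nth_eq_iff_index_eq) auto
    then show ?thesis using lW lA4 False by linarith
  qed
  have ZZ: "gdist Y (fst (W ! i)) (fst (W ! k)) = i + 1 + (length W - 1 - k)"
    if ik: "i < length W" "k < length W" "snd (W ! i) = Some 0" "snd (W ! k) = Some 4" for i k
  proof -
    have i: "i < length A" using WR[of i] ik by (cases "i < length A") (auto simp: R_def)
    have k: "\<not> k < length Q" using WQ[of k] ik by (auto simp: Q_def)
    have "k - length Q + 1 < length A4" using ik(2) k lW lA4 by linarith
    then have "gdist Y (fst (W ! i)) (fst (W ! k)) = i + 1 + (length A4 - 1 - (k - length Q + 1))"
      using Z[OF i] W0[OF i] W4[OF k ik(2)] by simp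
    moreover have "length A4 - 1 - (k - length Q + 1) = length W - 1 - k" using k ik(2) lW lA4 by linarith
    ultimately show ?thesis by simp
  qed
  have CC: "k - i \<le> b - a + 1" if ik: "i < k" "k < length W" "\<And>l. i < l \<Longrightarrow> l < k \<Longrightarrow> snd (W ! l) = None" for i k a b
  proof -
    have "k = Suc i"
    proof (rule ccontr)
      assume "k \<noteq> Suc i"
      then have "snd (W ! Suc i) = None" using ik by simp
      then show False using bl ik unfolding blocks_def by (metis Suc_lessI order_less_trans)
    qed
    then show ?thesis by simp
  qed
  have bM: "a \<le> b" if "i \<le> k" "k < length W" "snd (W ! i) = Some a" "snd (W ! k) = Some b" for i k a b
    using bl that unfolding blocks_def by blast
  have bG: "gdist Y (fst (W ! i)) (fst (W ! k)) = k - i"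
    if "i \<le> k" "k < length W" "snd (W ! i) = Some a" "snd (W ! k) = Some a" for i k a
    using bl that unfolding blocks_def by blast
  have "lwalk 4 W" unfolding lwalk_def
  proof (intro conjI allI impI, goal_cases)
    case 1 then show ?case using len lW(1) by (simp add: R_def)
  next
    case 5 then show ?case using e first last by simp
  next
    case 6 then show ?case using first by simp
  next
    case 7 then show ?case using last by simp
  next
    case 8 then show ?case by (rule U1)
  next
    case 9 then show ?case by (rule U2)
  next
    case 10 then show ?case by (rule bM)
  next
    case 11 then show ?case by (rule bG)
  next
    case (12 i j a b) then show ?case using CC[of i j b a] by blast
  next
    case 13 then show ?case by (rule ZZ)
  qed (simp_all add: P)
  then show ?thesis by (simp add: W_def R_def)
qed

text \<open>The place where the walk passes from the sides below \<open>l\<close> to the sides from \<open>l\<close> on.\<close>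

lemma jump:
  assumes L: "lwalk m W" and l: "0 < l" "l \<le> m"
  shows "\<exists>p q a b. p < q \<and> q < length W \<and> snd (W ! p) = Some a \<and> snd (W ! q) = Some b \<and> a < l \<and> l \<le> b \<and>
     (\<forall>k. p < k \<longrightarrow> k < q \<longrightarrow> snd (W ! k) = None)"
proof -
  let ?P = "\<lambda>q. q < length W \<and> (\<exists>b. snd (W ! q) = Some b \<and> l \<le> b)"
  define q where "q = (LEAST q. ?P q)"
  have "?P (length W - 1)" using lwalkD(1,7)[OF L] l by simp
  then have q: "?P q" unfolding q_def by (rule LeastI)
  then obtain b where b: "q < length W" "snd (W ! q) = Some b" "l \<le> b" by blast
  have q0: "q \<noteq> 0"
  proof
    assume "q = 0"
    then show False using b lwalkD(6)[OF L] l by simp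
  qed
  let ?R = "\<lambda>p. p < q \<and> snd (W ! p) \<noteq> None"
  define p where "p = (GREATEST p. ?R p)"
  have "?R 0" using q0 lwalkD(6)[OF L] by simp
  then have p: "?R p" unfolding p_def by (rule GreatestI_nat[of ?R 0 q]) auto
  then obtain a where a: "snd (W ! p) = Some a" by blast
  have "a < l"
  proof (rule ccontr)
    assume "\<not> a < l"
    then have "?P p" using a p b by auto
    then have "q \<le> p" unfolding q_def by (rule Least_le)
    then show False using p by simp
  qed
  moreover have "snd (W ! k) = None" if "p < k" "k < q" for k
  proof (rule ccontr)
    assume "snd (W ! k) \<noteq> None"
    then have "?R k" using that by simp
    then have "k \<le> p" unfolding p_def by (rule Greatest_le_nat[of ?R k q]) auto
    then show False using that by simp
  qed
  ultimately show ?thesis using p a b by blast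
qed

lemma label_block:
  assumes L: "lwalk m W" and uv: "u \<le> k" "k \<le> v" "v < length W" "snd (W ! u) = Some a" "snd (W ! v) = Some a"
  shows "snd (W ! k) = Some a"
proof -
  have "snd (W ! k) \<noteq> None"
  proof
    assume k: "snd (W ! k) = None"
    let ?P = "\<lambda>q. k < q \<and> q \<le> v \<and> snd (W ! q) \<noteq> None"
    define q where "q = (LEAST q. ?P q)"
    have "?P v" using uv k by (auto simp: le_less)
    then have q: "?P q" unfolding q_def by (rule LeastI)
    let ?R = "\<lambda>p. p < k \<and> u \<le> p \<and> snd (W ! p) \<noteq> None"
    define p where "p = (GREATEST p. ?R p)"
    have "?R u" using uv k by (auto simp: le_less)
    then have p: "?R p" unfolding p_def by (rule GreatestI_nat[of ?R u k]) auto
    obtain b c where bc: "snd (W ! p) = Some b" "snd (W ! q) = Some c" using p q by blast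
    have "a \<le> b" by (rule lwalkD(10)[OF L _ _ uv(4) bc(1)]) (use p q uv in auto)
    moreover have "c \<le> a" by (rule lwalkD(10)[OF L _ _ bc(2) uv(5)]) (use p q uv in auto)
    moreover have "q - p \<le> c - b + 1"
    proof (rule lwalkD(12)[OF L _ _ bc])
      show "snd (W ! n) = None" if n: "p < n" "n < q" for n
      proof (rule ccontr)
        assume s: "snd (W ! n) \<noteq> None"
        show False
        proof (cases "n < k")
          case True
          then have "?R n" using n p s by auto
          then have "n \<le> p" unfolding p_def by (rule Greatest_le_nat[of ?R n k]) auto
          then show False using n by simp
        next
          case False
          moreover have "n \<noteq> k" using s k by metis
          ultimately have "?P n" using n q s by auto
          then have "q \<le> n" unfolding q_def by (rule Least_le)
          then show False using n by simp
        qed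
      qed
    qed (use p q uv in auto)
    ultimately show False using p q by linarith
  qed
  then obtain b where b: "snd (W ! k) = Some b" by blast
  have "a \<le> b" by (rule lwalkD(10)[OF L _ _ uv(4) b]) (use uv in auto)
  moreover have "b \<le> a" by (rule lwalkD(10)[OF L _ _ b uv(5)]) (use uv in auto)
  ultimately show ?thesis using b by simp
qed

lemma lwalk_verts: "lwalk m W \<Longrightarrow> i < length W \<Longrightarrow> fst (W ! i) \<in> verts Y"
  using lwalkD(4) by (fastforce simp: edge_path_def)

text \<open>A corner that leads from the first part of the cut geodesic directly to its second part would close up to a circuit
  of length at most 10.\<close>

lemma no_wrap_jump:
  assumes L: "lwalk m W" and c: "cyc Y (map fst W)" and pq: "p < q" "q < length W"
    and lb: "snd (W ! p) = Some 0" "snd (W ! q) = Some m"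
    and none: "\<And>k. p < k \<Longrightarrow> k < q \<Longrightarrow> snd (W ! k) = None"
  shows False
proof -
  have "q - p \<le> m - 0 + 1" by (rule lwalkD(12)[OF L pq lb none])
  moreover have "gdist Y (fst (W ! p)) (fst (W ! q)) = p + 1 + (length W - 1 - q)"
    using lwalkD(13)[OF L _ pq(2) lb] pq by simp
  moreover have "gdist Y (fst (W ! p)) (fst (W ! q)) \<le> q - p"
    using y.gdist_path[OF lwalkD(4)[OF L], of p q] pq by simp
  moreover have "21 \<le> length W" using girth_Y[OF c] by simp
  ultimately show False using lwalkD(3)[OF L] pq by linarith
qed

end

section \<open>Hyperbolicity\<close>

text \<open>Twice the Gromov product of \<open>a\<close> and \<open>b\<close> with base point \<open>x\<close>.\<close>

definition gp2 :: "'a ugraph \<Rightarrow> 'a \<Rightarrow> 'a \<Rightarrow> 'a \<Rightarrow> int" where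
  "gp2 X x a b = int (gdist X x a) + int (gdist X x b) - int (gdist X a b)"

lemma gp2_chain:
  assumes four: "\<And>a b c. a \<in> S \<Longrightarrow> b \<in> S \<Longrightarrow> c \<in> S \<Longrightarrow> min (gp2 X x a b) (gp2 X x b c) - int D \<le> gp2 X x a c"
    and f: "\<And>i. i \<le> n \<Longrightarrow> f i \<in> S" and big: "\<And>i. i < n \<Longrightarrow> int (n * D) < gp2 X x (f i) (f (Suc i))" and n: "0 < n"
  shows "0 < gp2 X x (f 0) (f n)"
proof -
  have "int ((n - k) * D) < gp2 X x (f 0) (f (Suc k))" if "k < n" for k
    using that
  proof (induction k)
    case 0
    then show ?case using big[of 0] by simp
  next
    case (Suc k)
    have "int ((n - k) * D) < gp2 X x (f 0) (f (Suc k))" using Suc by simp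
    moreover have "int ((n - k) * D) \<le> int (n * D)" by (simp only: of_nat_le_iff mult_le_mono1 diff_le_self)
    then have "int ((n - k) * D) < gp2 X x (f (Suc k)) (f (Suc (Suc k)))" using big[of "Suc k"] Suc.prems by simp
    ultimately have "int ((n - k) * D) - int D < gp2 X x (f 0) (f (Suc (Suc k)))"
      using four[OF f[of 0] f[of "Suc k"] f[of "Suc (Suc k)"]] Suc.prems by simp
    moreover have "(n - k) * D = (n - Suc k) * D + D"
      using Suc.prems by (metis Suc_diff_Suc Suc_lessD add.commute mult_Suc)
    ultimately show ?case by simp
  qed
  from this[of "n - 1"] show ?thesis using n by simp
qed

context chamber_graph
begin

lemma copy_fourpt:
  assumes "fourpt \<Gamma> D" "h \<in> C" "x \<in> copy h" "y \<in> copy h" "z \<in> copy h" "w \<in> copy h"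
  shows "gdist Y x z + gdist Y y w \<le> max (gdist Y x y + gdist Y z w) (gdist Y x w + gdist Y y z) + D"
  using assms copy_proj unfolding fourpt_def by (simp add: gdist_copy[OF assms(2)])

lemma copy_gp2:
  assumes "fourpt \<Gamma> D" "h \<in> C" "x \<in> copy h" "a \<in> copy h" "b \<in> copy h" "c \<in> copy h"
  shows "min (gp2 Y x a b) (gp2 Y x b c) - int D \<le> gp2 Y x a c"
proof -
  have "gdist Y a c + gdist Y b x \<le> max (gdist Y a b + gdist Y c x) (gdist Y a x + gdist Y b c) + D"
    by (rule copy_fourpt[OF assms(1,2)]) (use assms in auto)
  moreover have "gdist Y b x = gdist Y x b" "gdist Y c x = gdist Y x c" "gdist Y a x = gdist Y x a"
    using y.gdist_sym copyD(1)[OF assms(2)] assms by auto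
  ultimately have "gdist Y a c + gdist Y x b \<le> gdist Y a b + gdist Y x c + D \<or>
     gdist Y a c + gdist Y x b \<le> gdist Y x a + gdist Y b c + D" by simp linarith
  then show ?thesis unfolding gp2_def by linarith
qed

text \<open>The vertex at which the distance sums in the four-point inequality balance, up to rounding.\<close>

lemma copy_gp2_geodesic:
  assumes F: "fourpt \<Gamma> D" and h: "h \<in> C" and x: "x \<in> copy h"
    and uv: "u \<le> v" and f: "\<And>k. u \<le> k \<Longrightarrow> k \<le> v \<Longrightarrow> f k \<in> copy h"
    and geo: "\<And>k l. u \<le> k \<Longrightarrow> k \<le> l \<Longrightarrow> l \<le> v \<Longrightarrow> gdist Y (f k) (f l) = l - k"
  shows "\<exists>k. u \<le> k \<and> k \<le> v \<and> 2 * int (gdist Y x (f k)) \<le> gp2 Y x (f u) (f v) + 2 * int D + 2"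
proof -
  define A B T where "A = gdist Y x (f u)" and "B = gdist Y x (f v)" and "T = v - u"
  have V: "f k \<in> verts Y" if "u \<le> k" "k \<le> v" for k using copyD(1)[OF h f[OF that]] .
  have xV: "x \<in> verts Y" using copyD(1)[OF h x] .
  have T: "gdist Y (f u) (f v) = T" using geo[of u v] uv by (simp add: T_def)
  have tri: "A \<le> B + T" "B \<le> A + T"
    using y.gdist_triangle[OF xV V[of v] V[of u]] y.gdist_triangle[OF xV V[of u] V[of v]] uv T
      y.gdist_sym[OF V[of u] V[of v]] by (auto simp: A_def B_def)
  define t where "t = (A + T - B) div 2"
  have t: "t \<le> T" "2 * t \<le> A + T - B" "A + T - B \<le> 2 * t + 1" using tri by (auto simp: t_def)
  define k where "k = u + t"
  have k: "u \<le> k" "k \<le> v" using t uv by (auto simp: k_def T_def)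
  have gk: "gdist Y (f u) (f k) = t" "gdist Y (f k) (f v) = T - t"
    using geo[of u k] geo[of k v] k by (auto simp: k_def T_def)
  have "gdist Y x (f k) + gdist Y (f u) (f v) \<le> max (gdist Y x (f u) + gdist Y (f k) (f v)) (gdist Y x (f v) + gdist Y (f u) (f k)) + D"
    by (rule copy_fourpt[OF F h x f f f]) (use k uv in auto)
  then have "gdist Y x (f k) + T \<le> A + (T - t) + D \<or> gdist Y x (f k) + T \<le> B + t + D"
    unfolding T gk A_def B_def by linarith
  then have "2 * int (gdist Y x (f k)) \<le> int A + int B - int T + 2 * int D + 2"
    using t tri by linarith
  then show ?thesis using k T by (auto simp: gp2_def A_def B_def)
qed

text \<open>Suppose that \<open>x\<close> is far from \<open>\<beta>\<close> and \<open>\<gamma>\<close>. Open the triangle at the edge after \<open>x\<close> on the side \<open>\<alpha>\<close> and reduce it to a circuit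
  in a copy. The places where this circuit passes from one side to the next give a chain of eight vertices. Consecutive
  ones have a large Gromov product based at \<open>x\<close>, since they are close together or are joined by a piece of
  \<open>\<beta>\<close> or \<open>\<gamma>\<close>; but the first and the last one lie on \<open>\<alpha>\<close> on both sides of \<open>x\<close> and have Gromov product 0. The fourth of the five
  sides that \<open>lwalk_build\<close> provides is a single point here.\<close>

lemma slim_Y:
  assumes F: "fourpt \<Gamma> D"
  shows "y.slim (5 * D + 20)"
  unfolding y.slim_def
proof (intro allI impI ballI, rule ccontr)
  fix \<alpha> \<beta> \<gamma> x
  assume g: "geodesic_list Y \<alpha>" "geodesic_list Y \<beta>" "geodesic_list Y \<gamma>"
    and ends: "last \<alpha> = hd \<beta>" "last \<beta> = hd \<gamma>" "last \<gamma> = hd \<alpha>"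
    and x: "x \<in> set \<alpha>" and neg: "\<not> (\<exists>y\<in>set \<beta> \<union> set \<gamma>. gdist Y x y \<le> 5 * D + 20)"
  define K where "K = 5 * D + 20"
  have far: "K < gdist Y x y" if "y \<in> set \<beta> \<union> set \<gamma>" for y using neg that by (auto simp: K_def not_le)
  have ne: "\<alpha> \<noteq> []" "\<beta> \<noteq> []" "\<gamma> \<noteq> []" using g by (auto simp: geodesic_list_def edge_path_def)
  have vs: "set \<alpha> \<subseteq> verts Y" "set \<beta> \<subseteq> verts Y" "set \<gamma> \<subseteq> verts Y" using y.geodesic_list_verts g by auto
  have xv: "x \<in> verts Y" using x vs by blast
  have xn: "x \<notin> set \<beta> \<union> set \<gamma>" using far[of x] xv by auto
  obtain i where i: "i < length \<alpha>" "x = \<alpha> ! i" using x by (metis in_set_conv_nth)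
  have i1: "Suc i < length \<alpha>"
  proof (rule ccontr)
    assume "\<not> Suc i < length \<alpha>"
    then have "i = length \<alpha> - 1" using i by simp
    then have "x = hd \<beta>" using i ne ends by (simp add: last_conv_nth)
    then show False using xn ne by simp
  qed
  have i0: "0 < i"
  proof (rule ccontr)
    assume "\<not> 0 < i"
    then have "x = last \<gamma>" using i ne ends by (simp add: hd_conv_nth)
    then show False using xn ne by simp
  qed
  define A A4 where "A = drop (Suc i) \<alpha>" and "A4 = take (Suc i) \<alpha>"
  have hdA: "hd A = \<alpha> ! Suc i" "last A4 = x" "last A = last \<alpha>"
    using i1 i by (auto simp: A_def A4_def hd_drop_conv_nth take_Suc_conv_app_nth)
  have hdA4: "hd A4 = hd \<alpha>" by (simp add: A4_def)
  have e: "adj x (hd A)" using g(1) i1 i hdA by (auto simp: geodesic_list_def edge_path_iff_nth)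
  have hdn: "hd A \<notin> set \<beta> \<union> set \<gamma>" using far[of "hd A"] y.gdist_adj[OF e] by (auto simp: K_def)
  have lA: "2 \<le> length A"
  proof (rule ccontr)
    assume "\<not> 2 \<le> length A"
    moreover have "A \<noteq> []" using i1 by (simp add: A_def)
    ultimately have "last A = hd A" by (cases A; cases "tl A") auto
    then show False using hdA(3) ends(1) hdn list.set_sel(1)[OF ne(2)] by simp
  qed
  have tlsub: "set (tl p) \<subseteq> set p" for p :: "'y list" by (cases p) auto
  define W0 where "W0 = lab 0 A @ lab 1 (tl \<beta>) @ lab 2 (tl \<gamma>) @ lab 3 (tl [hd \<alpha>]) @ lab 4 (tl A4)"
  have "lwalk 4 W0" unfolding W0_def
  proof (rule lwalk_build)
    show "geodesic_list Y A" "geodesic_list Y A4"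
      using y.geodesic_list_drop[OF g(1) i1] y.geodesic_list_take[OF g(1)] by (auto simp: A_def A4_def)
    have "hd \<alpha> \<in> verts Y" using list.set_sel(1)[OF ne(1)] vs(1) by blast
    then show "geodesic_list Y [hd \<alpha>]" by (simp add: geodesic_list_def edge_path_def)
    show "gdist Y (A ! p) (A4 ! q) = p + 1 + (length A4 - 1 - q)" if "p < length A" "q < length A4" for p q
      using that i1 y.geodesic_list_nth[OF g(1), of "Suc i + p" q] y.gdist_sym by (auto simp: A_def A4_def)
    show "3 \<le> length A + length (tl \<beta>) + length (tl \<gamma>) + length (tl [hd \<alpha>]) + length (tl A4)"
      using lA i0 i1 by (simp add: A4_def)
    show "tl A4 \<noteq> []" using i0 i1 by (cases \<alpha>) (auto simp: A4_def)
  qed (use g ends hdA hdA4 e xn hdn tlsub in auto)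
  from polygon_reduction[OF this] obtain W h where W: "lwalk 4 W" "cyc Y (map fst W)" "h \<in> C" "fst ` set W \<subseteq> copy h"
    and ends': "W ! (length W - 1) = W0 ! (length W0 - 1)" "W ! 0 = W0 ! 0"
    and sub: "\<forall>x\<in>set W. snd x \<noteq> None \<longrightarrow> x \<in> set W0" by blast
  define n where "n = length W"
  have n3: "3 \<le> n" using lwalkD(1)[OF W(1)] by (simp add: n_def)
  have lb: "(a = 1 \<or> a = 2 \<longrightarrow> fst (W ! k) \<in> set \<beta> \<union> set \<gamma>) \<and> a \<noteq> 3" if kn: "k < n" and ka: "snd (W ! k) = Some a" for k a
  proof -
    obtain c where c: "W ! k = (c, Some a)" using ka by (cases "W ! k") auto
    have "W ! k \<in> set W0" using sub kn ka nth_mem[of k W] by (auto simp: n_def)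
    moreover have "set W0 = (\<lambda>y. (y, Some 0)) ` set A \<union> (\<lambda>y. (y, Some 1)) ` set (tl \<beta>) \<union>
        (\<lambda>y. (y, Some 2)) ` set (tl \<gamma>) \<union> (\<lambda>y. (y, Some 4)) ` set (tl A4)"
      by (simp add: W0_def Un_assoc del: One_nat_def)
    ultimately have "a = 0 \<or> a = 1 \<and> c \<in> set (tl \<beta>) \<or> a = 2 \<and> c \<in> set (tl \<gamma>) \<or> a = 4"
      unfolding c by (simp only: Un_iff image_iff prod.inject option.inject) blast
    then show ?thesis unfolding c fst_conv using subsetD[OF tlsub, of c \<beta>] subsetD[OF tlsub, of c \<gamma>]
      by (elim disjE conjE) simp_all
  qed
  have lW0: "W0 \<noteq> []" "last W0 = (x, Some 4)" 
  proof -
    have "tl A4 \<noteq> []" using i0 i1 by (cases \<alpha>) (auto simp: A4_def)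
    then show "W0 \<noteq> []" "last W0 = (x, Some 4)" using hdA by (auto simp: W0_def last_map lab_def last_tl)
  qed
  have Wx: "fst (W ! (n - 1)) = x" using ends' lW0 by (simp add: last_conv_nth n_def)
  have cop: "fst (W ! k) \<in> copy h" if "k < n" for k using W(4) that by (auto simp: n_def)
  have vert: "fst (W ! k) \<in> verts Y" if "k < n" for k using cop[OF that] copyD(1)[OF W(3)] by blast
  have xc: "x \<in> copy h" using cop[of "n - 1"] Wx n3 by simp
  have farW: "K < gdist Y x (fst (W ! k))" if "k < n" "snd (W ! k) = Some a" "a = 1 \<or> a = 2" for k a
    using far lb[OF that(1,2)] that(3) by blast
  define jmp where "jmp l t \<longleftrightarrow> (case t of (p, q, a, b) \<Rightarrow> p < q \<and> q < length W \<and> snd (W ! p) = Some a \<and>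
     snd (W ! q) = Some b \<and> a < l \<and> l \<le> b \<and> (\<forall>k. p < k \<longrightarrow> k < q \<longrightarrow> snd (W ! k) = None))" for l t
  have "\<exists>t. jmp l t" if "l \<in> {1..4}" for l
    using jump[OF W(1), of l] that by (auto simp: jmp_def)
  then have "\<forall>l\<in>{1..4}. \<exists>t. jmp l t" by blast
  from bchoice[OF this] obtain T where T: "\<forall>l\<in>{1..4}. jmp l (T l)" ..
  define p q a b where "p l = fst (T l)" and "q l = fst (snd (T l))" and "a l = fst (snd (snd (T l)))"
    and "b l = snd (snd (snd (T l)))" for l
  have J: "p l < q l" "q l < n" "snd (W ! p l) = Some (a l)" "snd (W ! q l) = Some (b l)" "a l < l" "l \<le> b l"
     "\<And>k. p l < k \<Longrightarrow> k < q l \<Longrightarrow> snd (W ! k) = None" if "1 \<le> l" "l \<le> 4" for l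
    using bspec[OF T, of l] that by (auto simp: p_def q_def a_def b_def n_def jmp_def split_beta)
  have b4: "b l \<le> 4" if "1 \<le> l" "l \<le> 4" for l
    by (rule lwalkD(10)[OF W(1) _ _ J(4)[OF that] lwalkD(7)[OF W(1)]]) (use J(2)[OF that] in \<open>auto simp: n_def\<close>)
  define w where "w k = fst (W ! k)" for k
  have pair1: "int (7 * D) < gp2 Y x (w (p l)) (w (q l))" if l: "1 \<le> l" "l \<le> 4" for l
  proof -
    have pq: "p l < n" "q l < n" using J(1,2)[OF l] by auto
    have "q l - p l \<le> b l - a l + 1"
      by (rule lwalkD(12)[OF W(1) J(1)[OF l] _ J(3,4)[OF l] J(7)[OF l]]) (use pq in \<open>simp_all add: n_def\<close>)
    moreover have "gdist Y (w (p l)) (w (q l)) \<le> q l - p l"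
      using y.gdist_path[OF lwalkD(4)[OF W(1)], of "p l" "q l"] J(1,2)[OF l] by (simp add: n_def w_def)
    ultimately have g5: "gdist Y (w (p l)) (w (q l)) \<le> 5" using b4[OF l] by linarith
    have "\<not> (a l = 0 \<and> b l = 4)"
      using no_wrap_jump[OF W(1,2) J(1)[OF l] _ _ _ J(7)[OF l]] J(2,3,4)[OF l] by (auto simp: n_def)
    moreover have "a l \<noteq> 3" "b l \<noteq> 3" using lb[OF pq(1) J(3)[OF l]] lb[OF pq(2) J(4)[OF l]] by auto
    ultimately have ab: "(a l = 1 \<or> a l = 2) \<or> (b l = 1 \<or> b l = 2)"
      using b4[OF l] J(5,6)[OF l] l by presburger
    have tri: "gdist Y x (w (p l)) \<le> gdist Y x (w (q l)) + gdist Y (w (p l)) (w (q l))"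
       "gdist Y x (w (q l)) \<le> gdist Y x (w (p l)) + gdist Y (w (p l)) (w (q l))"
      using y.gdist_triangle[OF xv vert[OF pq(2)] vert[OF pq(1)]] y.gdist_triangle[OF xv vert[OF pq(1)] vert[OF pq(2)]]
        y.gdist_sym[OF vert[OF pq(2)] vert[OF pq(1)]] by (auto simp: w_def)
    have "K < gdist Y x (w (p l)) \<or> K < gdist Y x (w (q l))"
      using ab farW[OF pq(1) J(3)[OF l]] farW[OF pq(2) J(4)[OF l]] unfolding w_def by blast
    then have "K < gdist Y x (w (p l)) + 5 \<and> K < gdist Y x (w (q l)) + 5 \<and> 2 * K < gdist Y x (w (p l)) + gdist Y x (w (q l)) + 5"
      using tri g5 by linarith
    then show ?thesis using g5 unfolding gp2_def K_def by linarith
  qed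
  have sym: "gp2 Y x u v = gp2 Y x v u" if "u \<in> verts Y" "v \<in> verts Y" for u v
    using y.gdist_sym[OF that] by (simp add: gp2_def)
  have pair2: "int (7 * D) < gp2 Y x (w (q l)) (w (p (Suc l)))" if l: "1 \<le> l" "l \<le> 3" for l
  proof -
    have l': "1 \<le> l" "l \<le> 4" "1 \<le> Suc l" "Suc l \<le> 4" using l by auto
    note j = J[OF l'(1,2)] and j' = J[OF l'(3,4)]
    show ?thesis
    proof (cases "q l \<le> p (Suc l)")
      case True
      have "b l \<le> a (Suc l)"
        by (rule lwalkD(10)[OF W(1) True _ j(4) j'(3)]) (use j'(1,2) n_def in auto)
      then have ll: "b l = l" "a (Suc l) = l" using j(6) j'(5) by auto
      have lbl: "snd (W ! k) = Some l" if "q l \<le> k" "k \<le> p (Suc l)" for k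
        using label_block[OF W(1) that, of l] j(4) j'(3) ll j'(1,2) by (simp add: n_def)
      have l12: "l = 1 \<or> l = 2" using lb[OF j(2,4)] ll l by auto
      have "\<exists>k. q l \<le> k \<and> k \<le> p (Suc l) \<and> 2 * int (gdist Y x (w k)) \<le> gp2 Y x (w (q l)) (w (p (Suc l))) + 2 * int D + 2"
      proof (rule copy_gp2_geodesic[OF F W(3) xc True])
        show "w k \<in> copy h" if "q l \<le> k" "k \<le> p (Suc l)" for k using cop that j'(1,2) by (simp add: w_def)
        show "gdist Y (w k) (w m) = m - k" if "q l \<le> k" "k \<le> m" "m \<le> p (Suc l)" for k m
          unfolding w_def by (rule lwalkD(11)[OF W(1) that(2) _ lbl lbl]) (use that j'(1,2) n_def in auto)
      qed
      then obtain k where k: "q l \<le> k" "k \<le> p (Suc l)" "2 * int (gdist Y x (w k)) \<le> gp2 Y x (w (q l)) (w (p (Suc l))) + 2 * int D + 2"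
        by blast
      have "K < gdist Y x (w k)" using farW[of k l] lbl[OF k(1,2)] l12 k(2) j'(1,2) by (simp add: w_def)
      then show ?thesis using k(3) unfolding K_def by linarith
    next
      case False
      have "p (Suc l) \<le> p l"
      proof (rule ccontr)
        assume "\<not> p (Suc l) \<le> p l"
        then have "snd (W ! p (Suc l)) = None" using j(7)[of "p (Suc l)"] False by simp
        then show False using j'(3) by simp
      qed
      moreover have "p l \<le> p (Suc l)"
      proof (rule ccontr)
        assume "\<not> p l \<le> p (Suc l)"
        then have "\<not> p l < q (Suc l)" using j'(7)[of "p l"] j(3) by auto
        then have "b (Suc l) \<le> a l"
          by (intro lwalkD(10)[OF W(1) _ _ j'(4) j(3)]) (use j(1,2) n_def in auto)
        then show False using j(5) j'(6) by simp
      qed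
      ultimately have "p (Suc l) = p l" by simp
      then show ?thesis using pair1[OF l'(1,2)] sym[of "w (p l)" "w (q l)"] vert[of "p l"] vert[of "q l"] j(1,2)
        by (simp add: w_def)
    qed
  qed
  define f where "f k = w (if even k then p (Suc (k div 2)) else q (Suc (k div 2)))" for k :: nat
  have "0 < gp2 Y x (f 0) (f 7)"
  proof (rule gp2_chain[where S = "copy h" and D = D])
    show "min (gp2 Y x u v) (gp2 Y x v z) - int D \<le> gp2 Y x u z" if "u \<in> copy h" "v \<in> copy h" "z \<in> copy h" for u v z
      by (rule copy_gp2[OF F W(3) xc that])
    show "f k \<in> copy h" if "k \<le> 7" for k
    proof -
      have "1 \<le> Suc (k div 2)" "Suc (k div 2) \<le> 4" using that by auto
      then show ?thesis using J(1,2)[of "Suc (k div 2)"] cop by (auto simp: f_def w_def)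
    qed
    show "int (7 * D) < gp2 Y x (f k) (f (Suc k))" if k: "k < 7" for k
    proof (cases "even k")
      case True
      then have "Suc k div 2 = k div 2" by auto
      then show ?thesis using pair1[of "Suc (k div 2)"] True k by (simp add: f_def)
    next
      case False
      then have "Suc k div 2 = Suc (k div 2)" "k div 2 \<le> 2" using k by presburger+
      then show ?thesis using pair2[of "Suc (k div 2)"] False by (simp add: f_def)
    qed
  qed simp
  moreover have "gp2 Y x (f 0) (f 7) \<le> 0"
  proof -
    have f: "f 0 = w (p 1)" "f 7 = w (q 4)" by (simp_all add: f_def)
    have l: "(1::nat) \<le> 1" "(1::nat) \<le> 4" "(4::nat) \<le> 4" by auto
    have a1: "a 1 = 0" "b 4 = 4" using J(5)[OF l(1,2)] J(6)[OF l(2,3)] b4[OF l(2,3)] by auto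
    have pn: "p 1 < n" "q 4 < n" using J(1,2)[OF l(1,2)] J(1,2)[OF l(2,3)] by auto
    have "gdist Y (w (p 1)) (w (q 4)) = p 1 + 1 + (n - 1 - q 4)"
      using lwalkD(13)[OF W(1), of "p 1" "q 4"] J(3)[OF l(1,2)] J(4)[OF l(2,3)] a1 pn by (simp add: w_def n_def)
    moreover have "gdist Y x (w (q 4)) \<le> n - 1 - q 4"
      using y.gdist_path[OF lwalkD(4)[OF W(1)], of "q 4" "n - 1"] pn n3 Wx y.gdist_sym[OF xv vert[OF pn(2)]]
      by (simp add: n_def w_def)
    moreover have "gdist Y x (w (p 1)) \<le> p 1 + 1"
    proof -
      have 0: "gdist Y (w 0) (w (p 1)) \<le> p 1"
      proof -
        have "0 < length W" "p 1 < length W" using pn n3 by (auto simp: n_def)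
        then show ?thesis using y.gdist_path[OF lwalkD(4)[OF W(1)], of 0 "p 1"] by (simp add: w_def)
      qed
      have "adj x (w 0)" using lwalkD(5)[OF W(1)] Wx by (simp add: w_def n_def)
      then have "gdist Y x (w 0) = 1" by (rule y.gdist_adj)
      moreover have "w 0 \<in> verts Y" using vert[of 0] n3 by (simp add: w_def)
      ultimately show ?thesis using y.gdist_triangle[OF xv _ vert[OF pn(1)], of "w 0"] 0 by (simp add: w_def)
    qed
    ultimately show ?thesis unfolding f gp2_def by linarith
  qed
  ultimately show False by simp
qed

lemma fourpt_\<Gamma>_of_Y:
  assumes "fourpt Y D" shows "fourpt \<Gamma> D"
proof -
  obtain h where h: "h \<in> C" using C_nonempty by blast
  have g: "gdist Y (emb h u) (emb h v) = gdist \<Gamma> u v" if "u \<in> verts \<Gamma>" "v \<in> verts \<Gamma>" for u v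
    using gdist_copy[OF h, of "emb h u" "emb h v"] that proj_emb[OF h] by (simp add: copy_def)
  show ?thesis unfolding fourpt_def
  proof (intro ballI)
    fix x y z w assume v: "x \<in> verts \<Gamma>" "y \<in> verts \<Gamma>" "z \<in> verts \<Gamma>" "w \<in> verts \<Gamma>"
    have "emb h x \<in> verts Y" "emb h y \<in> verts Y" "emb h z \<in> verts Y" "emb h w \<in> verts Y" using v emb_verts h by auto
    then show "g.dd x z + g.dd y w \<le> max (g.dd x y + g.dd z w) (g.dd x w + g.dd y z) + D"
      using assms v unfolding fourpt_def by (simp add: g[symmetric])
  qed
qed

lemma hyperbolic_iff: "hyperbolic_graph \<Gamma> \<longleftrightarrow> hyperbolic_graph Y"
  unfolding g.hyperbolic_iff_fourpt y.hyperbolic_iff_fourpt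
  using fourpt_\<Gamma>_of_Y slim_Y y.slim_fourpt by blast

end

section \<open>Tightness\<close>

context conn_graph
begin

lemma geodesic_segment:
  assumes p: "geodesic_list X p" and uv: "u \<in> set p" "v \<in> set p"
  shows "\<exists>S. geodesic_list X S \<and> hd S = u \<and> last S = v \<and> set S \<subseteq> set p"
proof -
  have *: "\<exists>S. geodesic_list X S \<and> hd S = p ! i \<and> last S = p ! j \<and> set S \<subseteq> set p"
    if ij: "i \<le> j" "j < length p" for i j
  proof (intro exI conjI)
    let ?S = "drop i (take (Suc j) p)"
    show "geodesic_list X ?S"
      using ij by (intro geodesic_list_drop geodesic_list_take p) auto
    show "hd ?S = p ! i" using ij by (simp add: hd_drop_conv_nth)
    show "last ?S = p ! j" using ij by (simp add: last_drop take_Suc_conv_app_nth)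
    show "set ?S \<subseteq> set p" by (meson in_set_dropD in_set_takeD subsetI)
  qed
  obtain i j where ij: "i < length p" "p ! i = u" "j < length p" "p ! j = v" using uv by (metis in_set_conv_nth)
  show ?thesis
  proof (cases "i \<le> j")
    case True
    then show ?thesis using *[of i j] ij by auto
  next
    case False
    then obtain S where "geodesic_list X S" "hd S = v" "last S = u" "set S \<subseteq> set p" using *[of j i] ij by auto
    then show ?thesis using geodesic_list_rev[of S]
      by (intro exI[of _ "rev S"]) (auto simp: hd_rev last_rev)
  qed
qed

lemma geodesic_list_length: "geodesic_list X p \<Longrightarrow> length p = Suc (dd (hd p) (last p))"
  using geodesic_list_imp by (auto simp: geodesic_edge_path_def)

lemma nearest_geodesic:
  assumes t: "t \<in> verts X" and e: "y \<in> verts X" "dd t y \<le> K"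
  shows "\<exists>B. geodesic_list X B \<and> hd B = t \<and> last B = y \<and> length B \<le> Suc K \<and> (\<forall>z\<in>set B. dd t z \<le> K)"
proof -
  obtain B where B: "geodesic_list X B" "hd B = t" "last B = y" "length B = Suc (dd t y)"
    using geodesic_list_ex[OF t e(1)] by blast
  have "dd t z \<le> K" if "z \<in> set B" for z using geodesic_list_point[OF B(1) that] B e by simp
  then show ?thesis using B e by auto
qed

end

context chamber_graph
begin

text \<open>The polygon consists of the part of \<open>\<beta>\<close> after \<open>x = \<beta> ! i\<close>, up to the first vertex on \<open>\<alpha>\<close> or to the
  end of the window of radius \<open>M\<close>; a connection to \<open>\<alpha>\<close>, trivial in the first case; a segment of \<open>\<alpha>\<close>; a
  connection back to \<open>\<beta>\<close>; and the part of \<open>\<beta>\<close> up to \<open>x\<close>. The ends of the window are too far from each other, and from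
  the opposite part of \<open>\<beta>\<close>, for a corner to skip the segment of \<open>\<alpha>\<close> (\<open>far'\<close>); and what remains of this segment
  is long, by the same distances or because the girth is above 20.\<close>

lemma window:
  assumes \<alpha>: "geodesic_list Y \<alpha>" and \<beta>: "geodesic_list Y \<beta>"
    and i: "Suc i < length \<beta>" and x: "\<beta> ! i \<notin> set \<alpha>" and M: "M = 2 * K + 20"
    and up: "(\<exists>k. i < k \<and> k \<le> i + M \<and> k < length \<beta> \<and> \<beta> ! k \<in> set \<alpha>) \<or>
       (i + M < length \<beta> \<and> (\<exists>y\<in>set \<alpha>. gdist Y (\<beta> ! (i + M)) y \<le> K))"
    and down: "(\<exists>k. k < i \<and> i \<le> k + M \<and> \<beta> ! k \<in> set \<alpha>) \<or>
       (M \<le> i \<and> (\<exists>y\<in>set \<alpha>. gdist Y (\<beta> ! (i - M)) y \<le> K))"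
  shows "\<exists>h\<in>C. \<exists>R. cyc Y R \<and> set R \<subseteq> copy h \<and> length R \<le> 4 * M + 4 * K \<and> \<beta> ! i \<in> set R \<and>
     (\<exists>u v. u + 3 \<le> v \<and> v < length R \<and> R ! u \<in> set \<alpha> \<and> R ! Suc u \<in> set \<alpha> \<and> R ! v \<in> set \<alpha> \<and>
        3 \<le> gdist Y (R ! u) (R ! v))"
proof -
  have \<alpha>v: "set \<alpha> \<subseteq> verts Y" using y.geodesic_list_verts[OF \<alpha>] .
  have \<beta>v: "\<beta> ! k \<in> verts Y" if "k < length \<beta>" for k using y.geodesic_list_verts[OF \<beta>] that nth_mem by blast
  note \<beta>d = y.geodesic_list_nth[OF \<beta>]
  have single: "geodesic_list Y [z]" if "z \<in> verts Y" for z
    using that by (simp add: geodesic_list_def edge_path_def)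
  \<comment> \<open>Going up from \<open>x\<close>, the window ends where \<open>\<beta>\<close> first returns to \<open>\<alpha>\<close>. By the last conjunct the
    successor of \<open>x\<close>, an end of the edge that is kept, is not visited again on \<open>\<alpha>\<close>.\<close>
  have "\<exists>k B. i < k \<and> k \<le> i + M \<and> k < length \<beta> \<and> geodesic_list Y B \<and> hd B = \<beta> ! k \<and> last B \<in> set \<alpha> \<and> length B \<le> Suc K \<and>
      (tl B = [] \<or> k = i + M \<and> (\<forall>z\<in>set B. gdist Y (\<beta> ! (i + M)) z \<le> K)) \<and>
      (\<beta> ! Suc i \<in> set \<alpha> \<longrightarrow> k = Suc i \<and> tl B = [])"
  proof (cases "\<exists>k. i < k \<and> k \<le> i + M \<and> k < length \<beta> \<and> \<beta> ! k \<in> set \<alpha>")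
    case True
    define k where "k = (LEAST k. i < k \<and> k \<le> i + M \<and> k < length \<beta> \<and> \<beta> ! k \<in> set \<alpha>)"
    have k: "i < k \<and> k \<le> i + M \<and> k < length \<beta> \<and> \<beta> ! k \<in> set \<alpha>" unfolding k_def using LeastI_ex[OF True] .
    have "\<beta> ! Suc i \<in> set \<alpha> \<Longrightarrow> k \<le> Suc i" unfolding k_def using i M by (intro Least_le) auto
    then show ?thesis using k single[OF \<beta>v[of k]] by (intro exI[of _ k] exI[of _ "[\<beta> ! k]"]) auto
  next
    case False
    then obtain y where y: "i + M < length \<beta>" "y \<in> set \<alpha>" "gdist Y (\<beta> ! (i + M)) y \<le> K" using up by blast
    have "\<beta> ! Suc i \<notin> set \<alpha>" using False i M by auto
    then show ?thesis
      using y.nearest_geodesic[OF \<beta>v[OF y(1)] _ y(3)] y \<alpha>v M by (intro exI[of _ "i + M"]) auto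
  qed
  then obtain k B1 where k: "i < k" "k \<le> i + M" "k < length \<beta>"
    and B1: "geodesic_list Y B1" "hd B1 = \<beta> ! k" "last B1 \<in> set \<alpha>" "length B1 \<le> Suc K"
      "tl B1 = [] \<or> k = i + M \<and> (\<forall>z\<in>set B1. gdist Y (\<beta> ! (i + M)) z \<le> K)"
      "\<beta> ! Suc i \<in> set \<alpha> \<longrightarrow> k = Suc i \<and> tl B1 = []" by blast
  have "\<exists>k B. k < i \<and> i \<le> k + M \<and> geodesic_list Y B \<and> last B = \<beta> ! k \<and> hd B \<in> set \<alpha> \<and> length B \<le> Suc K \<and>
      (tl B = [] \<or> M \<le> i \<and> k = i - M \<and> (\<forall>z\<in>set B. gdist Y (\<beta> ! (i - M)) z \<le> K))"
  proof (cases "\<exists>k. k < i \<and> i \<le> k + M \<and> \<beta> ! k \<in> set \<alpha>")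
    case True
    then obtain k where "k < i" "i \<le> k + M" "\<beta> ! k \<in> set \<alpha>" by blast
    then show ?thesis using single[of "\<beta> ! k"] \<alpha>v by (intro exI[of _ k] exI[of _ "[\<beta> ! k]"]) auto
  next
    case False
    then obtain y where y: "M \<le> i" "y \<in> set \<alpha>" "gdist Y (\<beta> ! (i - M)) y \<le> K" using down by blast
    have v: "\<beta> ! (i - M) \<in> verts Y" using \<beta>v i by simp
    obtain B where B: "geodesic_list Y B" "hd B = \<beta> ! (i - M)" "last B = y" "length B \<le> Suc K" "\<forall>z\<in>set B. gdist Y (\<beta> ! (i - M)) z \<le> K"
      using y.nearest_geodesic[OF v _ y(3)] y \<alpha>v by blast
    then have "geodesic_list Y (rev B)" "last (rev B) = \<beta> ! (i - M)" "hd (rev B) = y"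
      using y.geodesic_list_rev by (auto simp: hd_rev last_rev)
    then show ?thesis using B y M by (intro exI[of _ "i - M"] exI[of _ "rev B"]) auto
  qed
  then obtain k' B3 where k': "k' < i" "i \<le> k' + M"
    and B3: "geodesic_list Y B3" "last B3 = \<beta> ! k'" "hd B3 \<in> set \<alpha>" "length B3 \<le> Suc K"
      "tl B3 = [] \<or> M \<le> i \<and> k' = i - M \<and> (\<forall>z\<in>set B3. gdist Y (\<beta> ! (i - M)) z \<le> K)" by blast
  have ne: "B1 \<noteq> []" "B3 \<noteq> []" using B1 B3 by (auto simp: geodesic_list_def edge_path_def)
  obtain S where S: "geodesic_list Y S" "hd S = last B1" "last S = hd B3" "set S \<subseteq> set \<alpha>"
    using y.geodesic_segment[OF \<alpha> B1(3) B3(3)] by blast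
  have Sne: "S \<noteq> []" using S by (auto simp: geodesic_list_def edge_path_def)
  have tlsub: "set (tl p) \<subseteq> set p" for p :: "'y list" by (cases p) auto
  define A A4 where "A = drop (Suc i) (take (Suc k) \<beta>)" and "A4 = drop k' (take (Suc i) \<beta>)"
  have A: "geodesic_list Y A" "length A = k - i" "\<And>p. p < k - i \<Longrightarrow> A ! p = \<beta> ! (Suc i + p)"
    using k y.geodesic_list_drop[OF y.geodesic_list_take[OF \<beta>, of "Suc k"], of "Suc i"] by (auto simp: A_def)
  have A4: "geodesic_list Y A4" "length A4 = Suc i - k'" "\<And>p. p < Suc i - k' \<Longrightarrow> A4 ! p = \<beta> ! (k' + p)"
    using k' i y.geodesic_list_drop[OF y.geodesic_list_take[OF \<beta>, of "Suc i"], of k'] by (auto simp: A4_def)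
  have An: "A \<noteq> []" "A4 \<noteq> []" using A(2) A4(2) k k' by auto
  have hA: "hd A = \<beta> ! Suc i" "last A = \<beta> ! k" "hd A4 = \<beta> ! k'" "last A4 = \<beta> ! i"
    using An A A4 k k' by (auto simp: hd_conv_nth last_conv_nth)
  have e: "adj (\<beta> ! i) (\<beta> ! Suc i)" using \<beta> i by (auto simp: geodesic_list_def edge_path_iff_nth)
  have tB1: "k = i + M \<and> gdist Y (\<beta> ! (i + M)) z \<le> K" if "z \<in> set (tl B1)" for z
    using B1(5) that tlsub[of B1] by (cases "tl B1 = []") auto
  have tB3: "M \<le> i \<and> k' = i - M \<and> gdist Y (\<beta> ! (i - M)) z \<le> K" if "z \<in> set (tl B3)" for z
    using B3(5) that tlsub[of B3] by (cases "tl B3 = []") auto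
  have nB1: "\<beta> ! s \<notin> set (tl B1)" if "s \<le> Suc i" for s
  proof
    assume "\<beta> ! s \<in> set (tl B1)"
    then have "k = i + M" "gdist Y (\<beta> ! (i + M)) (\<beta> ! s) \<le> K" using tB1 by auto
    then show False using \<beta>d[of "i + M" s] k that M by (auto split: if_splits)
  qed
  have nB3: "\<beta> ! s \<notin> set (tl B3)" if "i \<le> s" "s < length \<beta>" for s
  proof
    assume "\<beta> ! s \<in> set (tl B3)"
    then have "M \<le> i" "gdist Y (\<beta> ! (i - M)) (\<beta> ! s) \<le> K" using tB3 by auto
    then show False using \<beta>d[of "i - M" s] that M by (auto split: if_splits)
  qed
  have x1S: "\<beta> ! Suc i \<notin> set (tl S)"
  proof
    assume a: "\<beta> ! Suc i \<in> set (tl S)"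
    then have "\<beta> ! Suc i \<in> set \<alpha>" using tlsub S(4) by blast
    then have "k = Suc i" "tl B1 = []" using B1(6) by auto
    then have "hd S = \<beta> ! Suc i" using S(2) B1(2) ne by (cases B1) auto
    then show False using a y.geodesic_list_distinct[OF S(1)] Sne by (cases S) auto
  qed
  have xS: "\<beta> ! i \<notin> set (tl S)" using x tlsub S(4) by blast
  have lS: "length S \<le> Suc (2 * K + 2 * M)"
  proof -
    have v: "last B1 \<in> verts Y" "hd B3 \<in> verts Y" "\<beta> ! k \<in> verts Y" "\<beta> ! k' \<in> verts Y"
      using B1 B3 \<alpha>v \<beta>v k k' i by auto
    have "gdist Y (\<beta> ! k) (last B1) \<le> K" "gdist Y (hd B3) (\<beta> ! k') \<le> K"
      using y.geodesic_list_length[OF B1(1)] y.geodesic_list_length[OF B3(1)] B1 B3 by auto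
    moreover have "gdist Y (\<beta> ! k) (\<beta> ! k') \<le> 2 * M" using \<beta>d[of k k'] k k' i by auto
    moreover have "gdist Y (last B1) (hd B3) \<le> gdist Y (last B1) (\<beta> ! k) + gdist Y (\<beta> ! k) (\<beta> ! k') + gdist Y (\<beta> ! k') (hd B3)"
      using y.gdist_triangle[OF v(1,3,2)] y.gdist_triangle[OF v(3,4,2)] by linarith
    ultimately have "gdist Y (last B1) (hd B3) \<le> 2 * K + 2 * M"
      using y.gdist_sym[OF v(1,3)] y.gdist_sym[OF v(4,2)] by linarith
    then show ?thesis using y.geodesic_list_length[OF S(1)] S by simp
  qed
  define W0 where "W0 = lab 0 A @ lab 1 (tl B1) @ lab 2 (tl S) @ lab 3 (tl B3) @ lab 4 (tl A4)"
  have tlA4: "tl A4 \<noteq> []" using A4(2) k' by (cases A4) auto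
  have L0: "lwalk 4 W0" unfolding W0_def
  proof (rule lwalk_build[OF A(1) B1(1) S(1) B3(1) A4(1)])
    show "gdist Y (A ! p) (A4 ! q) = p + 1 + (length A4 - 1 - q)" if "p < length A" "q < length A4" for p q
      using that A A4 k k' \<beta>d[of "Suc i + p" "k' + q"] by auto
    show "hd A \<notin> set (tl B1) \<union> set (tl S) \<union> set (tl B3)" using hA nB1[of "Suc i"] nB3[of "Suc i"] x1S i by auto
    show "last A4 \<notin> set (tl B1) \<union> set (tl S) \<union> set (tl B3)" using hA nB1[of i] nB3[of i] xS i by auto
    show "3 \<le> length A + length (tl B1) + length (tl S) + length (tl B3) + length (tl A4)"
    proof (rule ccontr)
      assume "\<not> ?thesis"
      moreover have "1 \<le> length A" "1 \<le> length (tl A4)" using A(2) A4(2) k k' by auto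
      ultimately have z: "length A = 1" "length (tl B1) = 0" "length (tl S) = 0" "length (tl B3) = 0" by linarith+
      have "\<beta> ! k = hd B1" "hd B1 = last B1" "last B1 = hd S" "hd S = last S" "last S = hd B3" "hd B3 = last B3" "last B3 = \<beta> ! k'"
        using z ne Sne B1 B3 S by (cases B1; cases S; cases B3; simp)+
      then have "\<beta> ! k = \<beta> ! k'" by simp
      then have "gdist Y (\<beta> ! k) (\<beta> ! k') = 0" using \<beta>v[OF k(3)] by simp
      then show False using \<beta>d[of k k'] k k' i by auto
    qed
  qed (use hA B1 B3 S tlA4 e in auto)
  have len0: "length W0 \<le> 4 * M + 4 * K" using A(2) A4(2) B1(4) B3(4) lS k k' by (simp add: W0_def)
  from polygon_reduction[OF L0] obtain W h where W: "lwalk 4 W" "cyc Y (map fst W)" "h \<in> C" "fst ` set W \<subseteq> copy h"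
    and ends: "W ! (length W - 1) = W0 ! (length W0 - 1)" and lW: "length W \<le> length W0"
    and sub: "\<forall>x\<in>set W. snd x \<noteq> None \<longrightarrow> x \<in> set W0" by blast
  define n where "n = length W"
  define w where "w k = fst (W ! k)" for k
  have n21: "21 \<le> n" using girth_Y[OF W(2)] by (simp add: n_def)
  have lb: "a = 0 \<and> (\<exists>s. i < s \<and> s \<le> k \<and> w l = \<beta> ! s) \<or> a = 1 \<and> w l \<in> set (tl B1) \<or> a = 2 \<and> w l \<in> set \<alpha> \<or>
      a = 3 \<and> w l \<in> set (tl B3) \<or> a = 4 \<and> (\<exists>s. s \<le> i \<and> w l = \<beta> ! s)"
    if ln: "l < n" and la: "snd (W ! l) = Some a" for l a
  proof -
    obtain c where c: "W ! l = (c, Some a)" using la by (cases "W ! l") auto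
    have "W ! l \<in> set W0" using sub ln la nth_mem[of l W] by (auto simp: n_def)
    moreover have "set W0 = (\<lambda>y. (y, Some 0)) ` set A \<union> (\<lambda>y. (y, Some 1)) ` set (tl B1) \<union>
        (\<lambda>y. (y, Some 2)) ` set (tl S) \<union> (\<lambda>y. (y, Some 3)) ` set (tl B3) \<union> (\<lambda>y. (y, Some 4)) ` set (tl A4)"
      by (simp add: W0_def Un_assoc del: One_nat_def)
    ultimately have alt: "a = 0 \<and> c \<in> set A \<or> a = 1 \<and> c \<in> set (tl B1) \<or> a = 2 \<and> c \<in> set (tl S) \<or> a = 3 \<and> c \<in> set (tl B3) \<or> a = 4 \<and> c \<in> set (tl A4)"
      unfolding c by (simp only: Un_iff image_iff prod.inject option.inject) blast
    have c0: "\<exists>s. i < s \<and> s \<le> k \<and> c = \<beta> ! s" if "c \<in> set A"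
    proof -
      obtain p where p: "p < k - i" "c = A ! p" using \<open>c \<in> set A\<close> A(2) by (metis in_set_conv_nth)
      then show ?thesis using A(3)[OF p(1)] by (intro exI[of _ "Suc i + p"]) auto
    qed
    have c4: "\<exists>s. s \<le> i \<and> c = \<beta> ! s" if "c \<in> set (tl A4)"
    proof -
      have "c \<in> set A4" using that tlsub by blast
      then obtain p where p: "p < Suc i - k'" "c = A4 ! p" using A4(2) by (metis in_set_conv_nth)
      then show ?thesis using A4(3)[OF p(1)] by (intro exI[of _ "k' + p"]) auto
    qed
    have c2: "c \<in> set \<alpha>" if "c \<in> set (tl S)" using that tlsub S(4) by blast
    have wc: "w l = c" using c by (simp add: w_def)
    show ?thesis using alt unfolding wc by (elim disjE conjE) (simp_all add: c0 c2 c4)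
  qed
  have vert: "w l \<in> verts Y" if "l < n" for l using lwalk_verts[OF W(1)] that by (simp add: n_def w_def)
  have dW: "gdist Y (w p) (w q) \<le> q - p" if "p \<le> q" "q < n" for p q
    using y.gdist_path[OF lwalkD(4)[OF W(1)], of p q] that by (simp add: n_def w_def)
  have lab4: "a \<le> 4" if "l < n" "snd (W ! l) = Some a" for l a using lb[OF that] by auto
  \<comment> \<open>Labels: 0 and 4 are the parts of \<open>\<beta>\<close> after and before \<open>x\<close>, 1 and 3 are the connections, 2 is in \<open>\<alpha>\<close>.\<close>
  have far: "M \<le> gdist Y (w p) (w q) + K" if p: "p < n" "snd (W ! p) = Some a" and q: "q < n" "snd (W ! q) = Some b"
    and ab: "a = 0 \<and> b = 3 \<or> a = 1 \<and> b = 4" for p q a b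
    using ab
  proof (elim disjE conjE)
    assume "a = 0" "b = 3"
    then obtain s where s: "i < s" "s \<le> k" "w p = \<beta> ! s" and B: "w q \<in> set (tl B3)" using lb[OF p] lb[OF q] by auto
    note t = tB3[OF B]
    have "gdist Y (\<beta> ! (i - M)) (w p) = s - (i - M)" using \<beta>d[of "i - M" s] s k t by simp
    moreover have "gdist Y (\<beta> ! (i - M)) (w p) \<le> K + gdist Y (w p) (w q)"
    proof -
      have "i - M < length \<beta>" using i by simp
      from y.gdist_triangle[OF \<beta>v[OF this] vert[OF q(1)] vert[OF p(1)]] show ?thesis
        using y.gdist_sym[OF vert[OF q(1)] vert[OF p(1)]] t by simp
    qed
    ultimately show ?thesis using s t by linarith
  next
    assume "a = 1" "b = 4"
    then obtain s where s: "s \<le> i" "w q = \<beta> ! s" and B: "w p \<in> set (tl B1)" using lb[OF p] lb[OF q] by auto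
    note t = tB1[OF B]
    have "gdist Y (\<beta> ! (i + M)) (w q) = i + M - s" using \<beta>d[of "i + M" s] s k t by auto
    moreover have "gdist Y (\<beta> ! (i + M)) (w q) \<le> K + gdist Y (w p) (w q)"
    proof -
      have "i + M < length \<beta>" using k t by simp
      from y.gdist_triangle[OF \<beta>v[OF this] vert[OF p(1)] vert[OF q(1)]] show ?thesis using t by simp
    qed
    ultimately show ?thesis using s by linarith
  qed
  have far13: "2 * M \<le> gdist Y (w p) (w q) + 2 * K" if p: "p < n" "snd (W ! p) = Some 1" and q: "q < n" "snd (W ! q) = Some 3" for p q
  proof -
    have B: "w p \<in> set (tl B1)" "w q \<in> set (tl B3)" using lb[OF p] lb[OF q] by auto
    note t1 = tB1[OF B(1)] and t3 = tB3[OF B(2)]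
    have v: "\<beta> ! (i + M) \<in> verts Y" "\<beta> ! (i - M) \<in> verts Y" using \<beta>v t1 k i by auto
    have "gdist Y (\<beta> ! (i + M)) (\<beta> ! (i - M)) = 2 * M" using \<beta>d[of "i + M" "i - M"] t1 t3 k i by auto
    moreover have "gdist Y (\<beta> ! (i + M)) (\<beta> ! (i - M)) \<le> K + gdist Y (w p) (w q) + K"
      using y.gdist_triangle[OF v(1) vert[OF p(1)] v(2)] y.gdist_triangle[OF vert[OF p(1)] vert[OF q(1)] v(2)]
        y.gdist_sym[OF vert[OF q(1)] v(2)] t1 t3 by linarith
    ultimately show ?thesis by linarith
  qed
  have far': "q - p \<ge> 6 + 3 + (if a = 0 \<and> b = 4 then 0 else 3)"
    if pq: "p < q" "q < n" "snd (W ! p) = Some a" "snd (W ! q) = Some b" "a \<le> 1" "3 \<le> b" for p q a b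
  proof -
    have pn: "p < n" using pq by simp
    have b34: "b = 3 \<or> b = 4" using lab4[OF pq(2,4)] pq(6) by linarith
    have d: "gdist Y (w p) (w q) \<le> q - p" using dW pq by simp
    consider "a = 0" "b = 4" | "a = 1" "b = 3" | "a = 0 \<and> b = 3 \<or> a = 1 \<and> b = 4" using b34 pq(5) by linarith
    then show ?thesis
    proof cases
      case 1
      have "gdist Y (w p) (w q) = p + 1 + (n - 1 - q)"
        using lwalkD(13)[OF W(1), of p q] pq 1 by (simp add: w_def n_def)
      then show ?thesis using d n21 1 pq(1,2) by simp
    next
      case 2
      then show ?thesis using far13[OF pn _ pq(2)] pq(3,4) d M by simp
    next
      case 3
      then show ?thesis using far[OF pn pq(3) pq(2) pq(4) 3] d M by auto
    qed
  qed
  obtain p q a b where J: "p < q" "q < n" "snd (W ! p) = Some a" "snd (W ! q) = Some b" "a < 2" "2 \<le> b"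
     "\<And>k. p < k \<Longrightarrow> k < q \<Longrightarrow> snd (W ! k) = None"
    using jump[OF W(1), of 2] by (auto simp: n_def)
  obtain p' q' a' b' where J': "p' < q'" "q' < n" "snd (W ! p') = Some a'" "snd (W ! q') = Some b'" "a' < 3" "3 \<le> b'"
     "\<And>k. p' < k \<Longrightarrow> k < q' \<Longrightarrow> snd (W ! k) = None"
    using jump[OF W(1), of 3] by (auto simp: n_def)
  have gap: "q - p \<le> b - a + 1" "q' - p' \<le> b' - a' + 1"
    using lwalkD(12)[OF W(1) J(1) _ J(3,4,7)] lwalkD(12)[OF W(1) J'(1) _ J'(3,4,7)] J(2) J'(2) by (simp_all add: n_def)
  have b2: "b = 2"
    using far'[OF J(1,2,3,4)] J(5,6) gap(1) lab4[OF J(2,4)] by (cases "3 \<le> b") (auto split: if_splits)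
  have a2: "a' = 2"
    using far'[OF J'(1,2,3,4)] J'(5,6) gap(2) lab4[OF J'(2,4)] by (cases "a' \<le> 1") (auto split: if_splits)
  have qp: "q \<le> p'"
  proof (rule ccontr)
    assume n: "\<not> q \<le> p'"
    then have "p' \<le> p" using J(7)[of p'] J'(3) by (cases "p' \<le> p") auto
    then have "a' \<le> a" by (intro lwalkD(10)[OF W(1) _ _ J'(3) J(3)]) (use J(1,2) n_def in auto)
    then show False using a2 J(5) by simp
  qed
  have len3: "q + 3 \<le> p'"
  proof -
    have "q - p \<le> 3" "q' - p' \<le> 3" using gap b2 a2 lab4[OF J'(2,4)] by auto
    show ?thesis
    proof (cases "a = 0 \<and> b' = 4")
      case True
      have "gdist Y (w p) (w q') = p + 1 + (n - 1 - q')"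
        using lwalkD(13)[OF W(1), of p q'] J J' True qp by (simp add: w_def n_def)
      moreover have "gdist Y (w p) (w q') \<le> q' - p" using dW J J' qp by simp
      ultimately show ?thesis using \<open>q - p \<le> 3\<close> \<open>q' - p' \<le> 3\<close> n21 J(1,2) J'(1,2) qp by linarith
    next
      case False
      then have "q' - p \<ge> 12" using far'[of p q' a b'] J J' qp by auto
      then show ?thesis using \<open>q - p \<le> 3\<close> \<open>q' - p' \<le> 3\<close> J(1) J'(1) qp by linarith
    qed
  qed
  have l2: "snd (W ! l) = Some 2" if "q \<le> l" "l \<le> p'" for l
    using label_block[OF W(1) that, of 2] J(4) J'(1,2,3) a2 b2 by (simp add: n_def)
  have in\<alpha>: "w l \<in> set \<alpha>" if "q \<le> l" "l \<le> p'" for l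
    using lb[OF _ l2[OF that]] that J'(1,2) by simp
  have "gdist Y (w q) (w p') = p' - q"
    unfolding w_def by (rule lwalkD(11)[OF W(1) qp _ l2 l2]) (use qp J'(1,2) n_def in auto)
  have wn: "map fst W ! l = w l" if "l < n" for l using that by (simp add: w_def n_def)
  have "\<beta> ! i \<in> set (map fst W)"
  proof -
    have "W0 \<noteq> []" "last W0 = (\<beta> ! i, Some 4)" using tlA4 hA by (auto simp: W0_def lab_def last_map last_tl)
    then have "fst (W ! (n - 1)) = \<beta> ! i" using ends by (simp add: last_conv_nth n_def)
    moreover have "n - 1 < length W" using n21 by (simp add: n_def)
    ultimately show ?thesis by (metis image_eqI nth_mem set_map)
  qed
  moreover have "length (map fst W) \<le> 4 * M + 4 * K" using lW len0 by simp
  moreover have "q + 3 \<le> p' \<and> p' < length (map fst W) \<and> map fst W ! q \<in> set \<alpha> \<and> map fst W ! Suc q \<in> set \<alpha> \<and> map fst W ! p' \<in> set \<alpha> \<and>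
        3 \<le> gdist Y (map fst W ! q) (map fst W ! p')"
    using len3 J'(1,2) wn[of q] wn[of "Suc q"] wn[of p'] in\<alpha>[of q] in\<alpha>[of "Suc q"] in\<alpha>[of p'] \<open>gdist Y (w q) (w p') = p' - q\<close>
    by (simp add: n_def)
  ultimately show ?thesis using W(2,3,4) by (intro bexI[OF _ W(3)] exI[of _ "map fst W"]) auto
qed

end

lemma card_UN_bound:
  assumes "finite I" "\<And>i. i \<in> I \<Longrightarrow> finite (A i) \<and> card (A i) \<le> n"
  shows "finite (\<Union>i\<in>I. A i)" "card (\<Union>i\<in>I. A i) \<le> card I * n"
proof -
  show "finite (\<Union>i\<in>I. A i)" using assms by blast
  have "card (\<Union>i\<in>I. A i) \<le> (\<Sum>i\<in>I. card (A i))" by (rule card_UN_le[OF assms(1)])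
  also have "\<dots> \<le> card I * n" using sum_bounded_above[of I "\<lambda>i. card (A i)" n] assms(2) by simp
  finally show "card (\<Union>i\<in>I. A i) \<le> card I * n" .
qed

context conn_graph
begin

lemma slim_quadrilateral:
  assumes sl: "slim K" and \<beta>: "geodesic_list X \<beta>" and \<alpha>: "geodesic_list X \<alpha>" and t: "t \<in> set \<beta>"
  shows "\<exists>y. dd t y \<le> 2 * K \<and> y \<in> verts X \<and> (y \<in> set \<alpha> \<or> dd (hd \<alpha>) y \<le> dd (hd \<alpha>) (hd \<beta>) \<or> dd (last \<alpha>) y \<le> dd (last \<alpha>) (last \<beta>))"
proof -
  define a b a' b' where ends: "a = hd \<alpha>" "b = last \<alpha>" "a' = hd \<beta>" "b' = last \<beta>"
  have ne: "\<alpha> \<noteq> []" "\<beta> \<noteq> []" using \<alpha> \<beta> by (auto simp: geodesic_list_def edge_path_def)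
  have v: "a \<in> verts X" "b \<in> verts X" "a' \<in> verts X" "b' \<in> verts X" "t \<in> verts X"
    using geodesic_list_verts[OF \<alpha>] geodesic_list_verts[OF \<beta>] ne t by (auto simp: ends)
  obtain E1 where E1: "geodesic_list X E1" "hd E1 = b'" "last E1 = b" using geodesic_list_ex[OF v(4,2)] by blast
  obtain E2 where E2: "geodesic_list X E2" "hd E2 = a'" "last E2 = a" using geodesic_list_ex[OF v(3,1)] by blast
  obtain g where g: "geodesic_list X g" "hd g = b" "last g = a'" using geodesic_list_ex[OF v(2,3)] by blast
  have E1v: "dd b y \<le> dd b b'" "y \<in> verts X" if "y \<in> set E1" for y
  proof -
    show y: "y \<in> verts X" using geodesic_list_verts[OF E1(1)] that by blast
    show "dd b y \<le> dd b b'" using geodesic_list_point[OF E1(1) that] E1 gdist_sym[OF v(2) y] gdist_sym[OF v(2,4)] by simp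
  qed
  have E2v: "dd a y \<le> dd a a'" "y \<in> verts X" if "y \<in> set E2" for y
  proof -
    show y: "y \<in> verts X" using geodesic_list_verts[OF E2(1)] that by blast
    show "dd a y \<le> dd a a'" using geodesic_list_point[OF E2(1) that] E2 gdist_sym[OF v(1) y] gdist_sym[OF v(1,3)] by simp
  qed
  obtain y where y: "y \<in> set E1 \<union> set g" "dd t y \<le> K"
    using sl \<beta> E1 g t unfolding slim_def ends by metis
  show ?thesis
  proof (cases "y \<in> set E1")
    case True
    then show ?thesis using E1v[OF True] y(2) unfolding ends[symmetric] by (intro exI[of _ y]) auto
  next
    case False
    then have yg: "y \<in> set g" using y by blast
    then have yv: "y \<in> verts X" using geodesic_list_verts[OF g(1)] by blast
    obtain z where z: "z \<in> set E2 \<union> set \<alpha>" "dd y z \<le> K"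
      using sl g E2 \<alpha> yg unfolding slim_def ends by metis
    have zv: "z \<in> verts X" using z E2v(2) geodesic_list_verts[OF \<alpha>] by blast
    have "dd t z \<le> 2 * K" using gdist_triangle[OF v(5) yv zv] y(2) z(2) by linarith
    then show ?thesis using z E2v[of z] zv unfolding ends[symmetric] by (intro exI[of _ z]) auto
  qed
qed

lemma geodesic_ball_card:
  assumes \<alpha>: "geodesic_list X \<alpha>" and c: "c \<in> set \<alpha>"
  shows "finite {y \<in> set \<alpha>. dd c y \<le> R}" "card {y \<in> set \<alpha>. dd c y \<le> R} \<le> 2 * R + 1"
proof -
  obtain i where i: "i < length \<alpha>" "\<alpha> ! i = c" using c by (metis in_set_conv_nth)
  have sub: "{y \<in> set \<alpha>. dd c y \<le> R} \<subseteq> (!) \<alpha> ` {i - R..i + R}"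
  proof
    fix y assume y: "y \<in> {y \<in> set \<alpha>. dd c y \<le> R}"
    then obtain j where j: "j < length \<alpha>" "y = \<alpha> ! j" by (auto simp: in_set_conv_nth)
    then have "j \<in> {i - R..i + R}" using y geodesic_list_nth[OF \<alpha> i(1) j(1)] i by (auto split: if_splits)
    then show "y \<in> (!) \<alpha> ` {i - R..i + R}" using j by blast
  qed
  then show "finite {y \<in> set \<alpha>. dd c y \<le> R}" by (rule finite_subset) simp
  have "card {y \<in> set \<alpha>. dd c y \<le> R} \<le> card ((!) \<alpha> ` {i - R..i + R})" by (rule card_mono[OF _ sub]) simp
  also have "\<dots> \<le> card {i - R..i + R}" by (rule card_image_le) simp
  also have "\<dots> \<le> 2 * R + 1" by simp
  finally show "card {y \<in> set \<alpha>. dd c y \<le> R} \<le> 2 * R + 1" .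
qed

end

context chamber_graph
begin

text \<open>The conclusion of \<open>window\<close>.\<close>

definition near_geodesic :: "nat \<Rightarrow> 'y list \<Rightarrow> 'y \<Rightarrow> bool" where
  "near_geodesic L \<alpha> x \<longleftrightarrow> (\<exists>h\<in>C. \<exists>R. cyc Y R \<and> set R \<subseteq> copy h \<and> length R \<le> L \<and> x \<in> set R \<and>
     (\<exists>u v. u + 3 \<le> v \<and> v < length R \<and> R ! u \<in> set \<alpha> \<and> R ! Suc u \<in> set \<alpha> \<and> R ! v \<in> set \<alpha> \<and>
        3 \<le> gdist Y (R ! u) (R ! v)))"

text \<open>The vertices \<open>R ! u\<close>, \<open>R ! Suc u\<close> and \<open>R ! v\<close> range over a ball in \<open>\<alpha>\<close>. The first and the last one determine
  the copy, the first two an edge of it, and \<open>x\<close> lies on one of the boundedly many circuits of bounded length through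
  this edge.\<close>

lemma near_geodesic_card:
  assumes f: "\<And>e. e \<in> edges \<Gamma> \<Longrightarrow> finite (circuits_through \<Gamma> e L) \<and> card (circuits_through \<Gamma> e L) \<le> N"
    and \<alpha>: "geodesic_list Y \<alpha>" and c: "c \<in> set \<alpha>"
  shows "finite {x \<in> verts Y. gdist Y c x \<le> \<Delta> \<and> near_geodesic L \<alpha> x}"
    "card {x \<in> verts Y. gdist Y c x \<le> \<Delta> \<and> near_geodesic L \<alpha> x} \<le> (2 * (L + \<Delta>) + 1) ^ 3 * (N * (L + 1))"
proof -
  define B where "B = {y \<in> set \<alpha>. gdist Y c y \<le> L + \<Delta>}"
  define good where "good t h \<longleftrightarrow> (case t of (v0, v1, v2) \<Rightarrow> h \<in> C \<and> v0 \<in> copy h \<and> v1 \<in> copy h \<and> v2 \<in> copy h \<and>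
    3 \<le> gdist Y v0 v2 \<and> adj v0 v1)" for t h
  define H where "H t = (SOME h. good t h)" for t
  define S where "S t = (case t of (v0, v1, v2) \<Rightarrow> if (\<exists>h. good t h)
     then emb (H t) ` (\<Union>p\<in>circuits_through \<Gamma> {proj v0, proj v1} L. set p) else {})" for t
  have cv: "c \<in> verts Y" using y.geodesic_list_verts[OF \<alpha>] c by blast
  have B: "finite B" "card B \<le> 2 * (L + \<Delta>) + 1" unfolding B_def by (rule y.geodesic_ball_card[OF \<alpha> c])+
  have Hg: "good t (H t)" if "good t h" for t h unfolding H_def using that by (rule someI)
  have S: "finite (S t) \<and> card (S t) \<le> N * (L + 1)" for t
  proof (cases "\<exists>h. good t h")
    case True
    obtain v0 v1 v2 where t: "t = (v0, v1, v2)" by (cases t) auto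
    have "adj v0 v1" using True t by (auto simp: good_def)
    then have e: "{proj v0, proj v1} \<in> edges \<Gamma>" by (rule proj_edge)
    let ?I = "circuits_through \<Gamma> {proj v0, proj v1} L"
    have "finite (set p) \<and> card (set p) \<le> L + 1" if "p \<in> ?I" for p
      using that card_length[of p] by (auto simp: circuits_through_def)
    then have U: "finite (\<Union>p\<in>?I. set p)" "card (\<Union>p\<in>?I. set p) \<le> card ?I * (L + 1)"
      using card_UN_bound[of ?I set "L + 1"] f[OF e] by blast+
    then have "card (\<Union>p\<in>?I. set p) \<le> N * (L + 1)" using f[OF e] by (meson le_trans mult_le_mono1)
    then have "card (emb (H t) ` (\<Union>p\<in>?I. set p)) \<le> N * (L + 1)" using card_image_le[OF U(1)] le_trans by blast
    then show ?thesis using U(1) True by (simp add: S_def t)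
  qed (auto simp: S_def split: prod.splits)
  have "{x \<in> verts Y. gdist Y c x \<le> \<Delta> \<and> near_geodesic L \<alpha> x} \<subseteq> (\<Union>t\<in>B \<times> B \<times> B. S t)"
  proof
    fix x assume "x \<in> {x \<in> verts Y. gdist Y c x \<le> \<Delta> \<and> near_geodesic L \<alpha> x}"
    then obtain h R u v where xv: "x \<in> verts Y" "gdist Y c x \<le> \<Delta>" and h: "h \<in> C"
      and R: "cyc Y R" "set R \<subseteq> copy h" "length R \<le> L" "x \<in> set R"
      and uv: "u + 3 \<le> v" "v < length R" "R ! u \<in> set \<alpha>" "R ! Suc u \<in> set \<alpha>" "R ! v \<in> set \<alpha>" "3 \<le> gdist Y (R ! u) (R ! v)"
      by (auto simp: near_geodesic_def)
    have P: "edge_path Y R" using R by (simp add: cyc_def)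
    obtain k where k: "k < length R" "R ! k = x" using R by (metis in_set_conv_nth)
    have inB: "R ! l \<in> B" if l: "l < length R" "R ! l \<in> set \<alpha>" for l
    proof -
      have lv: "R ! l \<in> verts Y" using copyD(1)[OF h] R l nth_mem by blast
      have "gdist Y x (R ! l) \<le> L"
      proof (cases "k \<le> l")
        case True
        then show ?thesis using y.gdist_path[OF P True l(1)] k(2) R(3) l(1) by simp
      next
        case False
        then show ?thesis using y.gdist_path[OF P, of l k] y.gdist_sym[OF xv(1) lv] k R(3) by simp
      qed
      then have "gdist Y c (R ! l) \<le> L + \<Delta>" using y.gdist_triangle[OF cv xv(1) lv] xv(2) by simp
      then show ?thesis using l by (simp add: B_def)
    qed
    define t where "t = (R ! u, R ! Suc u, R ! v)"
    have "adj (R ! u) (R ! Suc u)" using P uv by (simp add: edge_path_iff_nth)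
    then have g: "good t h" using h R uv by (auto simp: good_def t_def subset_iff)
    have g': "good t (H t)" by (rule Hg[OF g])
    have HC: "H t \<in> C" using g' by (simp add: good_def t_def)
    have "copy h = copy (H t)"
      using copy_unique[of h "H t" "R ! u" "R ! v"] g g' by (simp add: good_def t_def)
    then have "x \<in> copy (H t)" using R by blast
    then have x: "x = emb (H t) (proj x)" using copy_proj[OF HC] by simp
    define p where "p = map proj R @ [hd (map proj R)]"
    have "circuit \<Gamma> p" unfolding p_def by (rule circuit_of_cyc[OF cyc_copy_proj[OF R(1) h R(2)]])
    moreover have "{p ! u, p ! Suc u} = {proj (R ! u), proj (R ! Suc u)}" "Suc u < length p" using uv by (auto simp: p_def nth_append)
    ultimately have "p \<in> circuits_through \<Gamma> {proj (R ! u), proj (R ! Suc u)} L"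
      using R(3) by (auto simp: circuits_through_def p_def)
    moreover have "proj x \<in> set p" using R(4) by (simp add: p_def)
    ultimately have "x \<in> S t" using g x by (auto simp: S_def t_def intro!: image_eqI[of x _ "proj x"])
    moreover have "t \<in> B \<times> B \<times> B" using inB uv by (simp add: t_def)
    ultimately show "x \<in> (\<Union>t\<in>B \<times> B \<times> B. S t)" by blast
  qed
  moreover have fin: "finite (B \<times> B \<times> B)" using B by simp
  note un = card_UN_bound[OF fin, of S, OF S]
  ultimately show "finite {x \<in> verts Y. gdist Y c x \<le> \<Delta> \<and> near_geodesic L \<alpha> x}" using finite_subset un(1) by blast
  have "card {x \<in> verts Y. gdist Y c x \<le> \<Delta> \<and> near_geodesic L \<alpha> x} \<le> card (\<Union>t\<in>B \<times> B \<times> B. S t)"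
    by (rule card_mono[OF un(1)]) fact
  also have "\<dots> \<le> card (B \<times> B \<times> B) * (N * (L + 1))" by (rule un(2))
  also have "card (B \<times> B \<times> B) = card B ^ 3" by (simp add: card_cartesian_product power3_eq_cube)
  also have "card B ^ 3 * (N * (L + 1)) \<le> (2 * (L + \<Delta>) + 1) ^ 3 * (N * (L + 1))"
    using B(2) by (intro mult_le_mono1 power_mono) auto
  finally show "card {x \<in> verts Y. gdist Y c x \<le> \<Delta> \<and> near_geodesic L \<alpha> x} \<le> (2 * (L + \<Delta>) + 1) ^ 3 * (N * (L + 1))" .
qed

text \<open>With \<open>r = 0\<close> the geodesics have the same endpoints, and a window that reaches past an end of \<open>\<beta>\<close> meets \<open>\<alpha>\<close> there.
  Otherwise \<open>x\<close> is so far from the ends that a window around it lies in the middle part of \<open>\<beta>\<close>, where slimness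
  forces \<open>\<beta>\<close> to be close to \<open>\<alpha>\<close>.\<close>

lemma geodesic_near:
  assumes sl: "y.slim K0" and K: "K = 2 * K0" and M: "M = 2 * K + 20"
    and \<alpha>: "geodesic_list Y \<alpha>" and \<beta>: "geodesic_list Y \<beta>" and c: "c \<in> set \<alpha>" and x: "x \<in> set \<beta>"
    and cx: "gdist Y c x \<le> \<Delta>" and xa: "x \<notin> set \<alpha>"
    and r: "gdist Y (hd \<alpha>) (hd \<beta>) \<le> r" "gdist Y (last \<alpha>) (last \<beta>) \<le> r"
    and far: "r = 0 \<or> r + (\<Delta> + M + K + 1) \<le> gdist Y c (hd \<alpha>) \<and> r + (\<Delta> + M + K + 1) \<le> gdist Y c (last \<alpha>)"
  shows "near_geodesic (4 * M + 4 * K) \<alpha> x"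
proof -
  have ne: "\<alpha> \<noteq> []" "\<beta> \<noteq> []" using c x by auto
  have \<alpha>v: "set \<alpha> \<subseteq> verts Y" and \<beta>v: "set \<beta> \<subseteq> verts Y" using y.geodesic_list_verts \<alpha> \<beta> by auto
  define a b a' b' where ends: "a = hd \<alpha>" "b = last \<alpha>" "a' = hd \<beta>" "b' = last \<beta>"
  have v: "a \<in> verts Y" "b \<in> verts Y" "a' \<in> verts Y" "b' \<in> verts Y" "c \<in> verts Y" "x \<in> verts Y"
    using \<alpha>v \<beta>v ne c x by (auto simp: ends)
  have ab: "a \<in> set \<alpha>" "b \<in> set \<alpha>" using ne by (auto simp: ends)
  obtain i where i: "i < length \<beta>" "\<beta> ! i = x" using x by (metis in_set_conv_nth)
  have \<beta>0: "\<beta> ! 0 = a'" "\<beta> ! (length \<beta> - 1) = b'" using ne by (auto simp: ends hd_conv_nth last_conv_nth)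
  \<comment> \<open>For \<open>r > 0\<close> the premises are contradictory: a point near both \<open>x\<close> and an end of \<open>\<alpha>\<close> would make \<open>c\<close> too close
    to that end.\<close>
  have close: "y \<in> set \<alpha>" if y: "y \<in> verts Y" "gdist Y x y \<le> M + K" "gdist Y a y \<le> r \<or> gdist Y b y \<le> r" for y
  proof (cases "r = 0")
    case True
    then have "y = a \<or> y = b" using y(3) y.gdist_zero v(1,2) y(1) by auto
    then show ?thesis using ab by blast
  next
    case False
    have "gdist Y c y \<le> \<Delta> + (M + K)" using y.gdist_triangle[OF v(5,6) y(1)] cx y(2) by linarith
    then have "gdist Y c a \<le> \<Delta> + (M + K) + r \<or> gdist Y c b \<le> \<Delta> + (M + K) + r"
      using y(3) y.gdist_triangle[OF v(5) y(1) v(1)] y.gdist_triangle[OF v(5) y(1) v(2)]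
        y.gdist_sym[OF v(1) y(1)] y.gdist_sym[OF v(2) y(1)] by linarith
    then show ?thesis using far False by (auto simp: ends)
  qed
  have r': "gdist Y a a' \<le> r" "gdist Y b b' \<le> r" using r by (auto simp: ends)
  have quad: "\<exists>y\<in>set \<alpha>. gdist Y t y \<le> K" if t: "t \<in> set \<beta>" "gdist Y x t \<le> M" for t
  proof -
    obtain y where y: "gdist Y t y \<le> K" "y \<in> verts Y"
      "y \<in> set \<alpha> \<or> gdist Y a y \<le> gdist Y a a' \<or> gdist Y b y \<le> gdist Y b b'"
      using y.slim_quadrilateral[OF sl \<beta> \<alpha> t(1)] unfolding K ends by blast
    have "t \<in> verts Y" using t \<beta>v by blast
    then have "gdist Y x y \<le> M + K" using y.gdist_triangle[OF v(6) _ y(2), of t] t(2) y(1) by linarith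
    then have "y \<in> set \<alpha>" using y close[OF y(2)] r' le_trans by blast
    then show ?thesis using y by blast
  qed
  note \<beta>d = y.geodesic_list_nth[OF \<beta>]
  have i1: "Suc i < length \<beta>"
  proof (rule ccontr)
    assume "\<not> Suc i < length \<beta>"
    then have "i = length \<beta> - 1" using i by simp
    then have "x = b'" using i \<beta>0 by simp
    then have "x \<in> set \<alpha>" using close[of x] v(6) r' by simp
    then show False using xa by blast
  qed
  have up: "(\<exists>k. i < k \<and> k \<le> i + M \<and> k < length \<beta> \<and> \<beta> ! k \<in> set \<alpha>) \<or>
       (i + M < length \<beta> \<and> (\<exists>y\<in>set \<alpha>. gdist Y (\<beta> ! (i + M)) y \<le> K))"
  proof (cases "i + M < length \<beta>")
    case True
    then show ?thesis using quad[of "\<beta> ! (i + M)"] \<beta>d[of i "i + M"] i by auto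
  next
    case False
    let ?k = "length \<beta> - 1"
    have "?k < length \<beta>" "i \<le> ?k" using i1 by auto
    then have "gdist Y x b' = ?k - i" using \<beta>d[OF i(1), of ?k] i \<beta>0 by simp
    then have "gdist Y x b' \<le> M" using False i1 by linarith
    then have "b' \<in> set \<alpha>" using close[of b'] v r' by simp
    then show ?thesis using i1 False \<beta>0 by (intro disjI1 exI[of _ ?k]) auto
  qed
  have down: "(\<exists>k. k < i \<and> i \<le> k + M \<and> \<beta> ! k \<in> set \<alpha>) \<or>
       (M \<le> i \<and> (\<exists>y\<in>set \<alpha>. gdist Y (\<beta> ! (i - M)) y \<le> K))"
  proof (cases "M \<le> i")
    case True
    then show ?thesis using quad[of "\<beta> ! (i - M)"] \<beta>d[of i "i - M"] i by (auto split: if_splits)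
  next
    case False
    have "0 < length \<beta>" using ne by simp
    then have "gdist Y x a' = i" using \<beta>d[OF i(1), of 0] i \<beta>0 by (cases "i = 0") auto
    then have "gdist Y x a' \<le> M" using False by linarith
    then have "a' \<in> set \<alpha>" using close[of a'] v r' by simp
    moreover have "i \<noteq> 0" using calculation \<beta>0(1) i(2) xa by metis
    ultimately show ?thesis using False \<beta>0 by (intro disjI1 exI[of _ 0]) auto
  qed
  show ?thesis unfolding near_geodesic_def
    using window[OF \<alpha> \<beta> i1 _ M up down] i xa by simp
qed

lemma tight:
  assumes uf: "uniformly_fine_graph \<Gamma>" and hyp: "hyperbolic_graph \<Gamma>"
  shows "tight_graph Y"
  unfolding tight_graph_def
proof (intro conjI allI impI)
  show "hyperbolic_graph Y" using hyp hyperbolic_iff by blast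
  fix \<delta>0 :: real assume "tightness_constant Y \<delta>0"
  then have \<delta>0: "\<delta>0 > 0" by (simp add: tightness_constant_def)
  define \<Delta> where "\<Delta> = nat \<lfloor>\<delta>0\<rfloor>"
  obtain D where "fourpt \<Gamma> D" using hyp g.hyperbolic_iff_fourpt by blast
  then have sl: "y.slim (5 * D + 20)" by (rule slim_Y)
  define K M L where "K = 2 * (5 * D + 20)" and "M = 2 * K + 20" and "L = 4 * M + 4 * K"
  obtain f where f: "\<And>e n. e \<in> edges \<Gamma> \<Longrightarrow> finite (circuits_through \<Gamma> e n) \<and> card (circuits_through \<Gamma> e n) \<le> f n"
    using uf unfolding uniformly_fine_graph_def by blast
  define N where "N = (2 * (L + \<Delta>) + 1) ^ 3 * (f L * (L + 1))"
  define T where "T a b = {p. geodesic_edge_path Y a b p}" for a b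
  have ball: "x \<in> vertex_ball Y c \<delta>0 \<longleftrightarrow> x \<in> verts Y \<and> gdist Y c x \<le> \<Delta>" for c x
    unfolding vertex_ball_def \<Delta>_def using \<delta>0 by (auto simp: le_nat_floor) linarith
  have key: "finite (U \<inter> vertex_ball Y c \<delta>0) \<and> card (U \<inter> vertex_ball Y c \<delta>0) \<le> (2 * \<Delta> + 1) + N"
    if \<alpha>: "geodesic_list Y \<alpha>" "c \<in> set \<alpha>"
      and U: "\<And>x. x \<in> U \<Longrightarrow> \<exists>\<beta>. geodesic_list Y \<beta> \<and> x \<in> set \<beta> \<and> gdist Y (hd \<alpha>) (hd \<beta>) \<le> r \<and> gdist Y (last \<alpha>) (last \<beta>) \<le> r"
      and far: "r = 0 \<or> r + (\<Delta> + M + K + 1) \<le> gdist Y c (hd \<alpha>) \<and> r + (\<Delta> + M + K + 1) \<le> gdist Y c (last \<alpha>)"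
    for U c r \<alpha>
  proof -
    let ?A = "{y \<in> set \<alpha>. gdist Y c y \<le> \<Delta>}" and ?B = "{x \<in> verts Y. gdist Y c x \<le> \<Delta> \<and> near_geodesic L \<alpha> x}"
    have sub: "U \<inter> vertex_ball Y c \<delta>0 \<subseteq> ?A \<union> ?B"
    proof
      fix x assume x: "x \<in> U \<inter> vertex_ball Y c \<delta>0"
      then have xb: "x \<in> verts Y" "gdist Y c x \<le> \<Delta>" using ball by auto
      obtain \<beta> where \<beta>: "geodesic_list Y \<beta>" "x \<in> set \<beta>" "gdist Y (hd \<alpha>) (hd \<beta>) \<le> r" "gdist Y (last \<alpha>) (last \<beta>) \<le> r"
        using U x by blast
      show "x \<in> ?A \<union> ?B"
      proof (cases "x \<in> set \<alpha>")
        case True then show ?thesis using xb by simp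
      next
        case False
        have "near_geodesic (4 * M + 4 * K) \<alpha> x"
          by (rule geodesic_near[OF sl K_def M_def \<alpha>(1) \<beta>(1) \<alpha>(2) \<beta>(2) xb(2) False \<beta>(3,4) far])
        then show ?thesis using xb by (simp add: L_def)
      qed
    qed
    note A = y.geodesic_ball_card[OF \<alpha>, of \<Delta>]
    have B: "finite ?B" "card ?B \<le> N"
      unfolding N_def by (rule near_geodesic_card[OF f \<alpha>]; assumption)+
    have "card (U \<inter> vertex_ball Y c \<delta>0) \<le> card (?A \<union> ?B)" by (rule card_mono[OF _ sub]) (use A B in blast)
    also have "\<dots> \<le> card ?A + card ?B" by (rule card_Un_le)
    also have "\<dots> \<le> (2 * \<Delta> + 1) + N" using A(2) B(2) by (rule add_le_mono)
    finally show ?thesis using finite_subset[OF sub] A(1) B(1) by blast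
  qed
  have Tg: "geodesic_list Y p \<and> hd p = a \<and> last p = b" if "p \<in> T a b" for p a b
    using that y.geodesic_listI by (auto simp: T_def geodesic_edge_path_def edge_path_betw_def)
  define B where "B = (2 * \<Delta> + 1) + N"
  have i: "finite (path_verts T a b \<inter> vertex_ball Y c \<delta>0) \<and> card (path_verts T a b \<inter> vertex_ball Y c \<delta>0) \<le> B"
    if ab: "a \<in> verts Y" "b \<in> verts Y" and c: "c \<in> path_verts T a b" for a b c
  proof -
    obtain \<alpha> where \<alpha>: "\<alpha> \<in> T a b" "c \<in> set \<alpha>" using c by (auto simp: path_verts_def)
    note \<alpha>' = Tg[OF \<alpha>(1)]
    show ?thesis unfolding B_def
    proof (rule key[of \<alpha> _ _ 0])
      fix x assume "x \<in> path_verts T a b"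
      then obtain \<beta> where "\<beta> \<in> T a b" "x \<in> set \<beta>" by (auto simp: path_verts_def)
      then show "\<exists>\<beta>. geodesic_list Y \<beta> \<and> x \<in> set \<beta> \<and> gdist Y (hd \<alpha>) (hd \<beta>) \<le> 0 \<and> gdist Y (last \<alpha>) (last \<beta>) \<le> 0"
        using Tg[of \<beta>] \<alpha>' ab by (intro exI[of _ \<beta>]) auto
    qed (use \<alpha> \<alpha>' in auto)
  qed
  have ii: "finite (path_verts_near Y T a b r \<inter> vertex_ball Y c \<delta>0) \<and> card (path_verts_near Y T a b r \<inter> vertex_ball Y c \<delta>0) \<le> B"
    if c: "c \<in> path_verts T a b" and far: "r + (\<Delta> + M + K + 1) \<le> min (gdist Y c a) (gdist Y c b)" for a b c r
  proof -
    obtain \<alpha> where \<alpha>: "\<alpha> \<in> T a b" "c \<in> set \<alpha>" using c by (auto simp: path_verts_def)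
    note \<alpha>' = Tg[OF \<alpha>(1)]
    show ?thesis unfolding B_def
    proof (rule key[of \<alpha> _ _ r])
      fix x assume "x \<in> path_verts_near Y T a b r"
      then obtain a' b' \<beta> where "\<beta> \<in> T a' b'" "x \<in> set \<beta>" "gdist Y a a' \<le> r" "gdist Y b b' \<le> r"
        by (auto simp: path_verts_near_def path_verts_def)
      then show "\<exists>\<beta>. geodesic_list Y \<beta> \<and> x \<in> set \<beta> \<and> gdist Y (hd \<alpha>) (hd \<beta>) \<le> r \<and> gdist Y (last \<alpha>) (last \<beta>) \<le> r"
        using Tg[of \<beta>] \<alpha>' by (intro exI[of _ \<beta>]) auto
    qed (use \<alpha> \<alpha>' far in auto)
  qed
  have T: "T a b \<noteq> {} \<and> (\<forall>p\<in>T a b. geodesic_edge_path Y a b p)" if "a \<in> verts Y" "b \<in> verts Y" for a b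
    using y.geodesic_ex[OF that] by (auto simp: T_def)
  show "tight_wrt Y \<delta>0" unfolding tight_wrt_def
  proof (rule exI[of _ T], intro conjI)
    show "\<forall>a\<in>verts Y. \<forall>b\<in>verts Y. T a b \<noteq> {} \<and> (\<forall>p\<in>T a b. geodesic_edge_path Y a b p)"
      using T by simp
    show "\<exists>P0. \<forall>a\<in>verts Y. \<forall>b\<in>verts Y. \<forall>c\<in>path_verts T a b.
          finite (path_verts T a b \<inter> vertex_ball Y c \<delta>0) \<and> card (path_verts T a b \<inter> vertex_ball Y c \<delta>0) \<le> P0"
      by (rule exI[of _ B]) (use i in simp)
    show "\<exists>P1 k1. \<forall>r. \<forall>a\<in>verts Y. \<forall>b\<in>verts Y. \<forall>c\<in>path_verts T a b.
          r + k1 \<le> min (gdist Y c a) (gdist Y c b) \<longrightarrow>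
          finite (path_verts_near Y T a b r \<inter> vertex_ball Y c \<delta>0) \<and>
          card (path_verts_near Y T a b r \<inter> vertex_ball Y c \<delta>0) \<le> P1"
      by (rule exI[of _ B], rule exI[of _ "\<Delta> + M + K + 1"]) (use ii in blast)
  qed
qed

end

section \<open>Free products and graph products\<close>

locale vertex_groups =
  fixes V :: "'v set" and G :: "'v \<Rightarrow> ('g, 'm) monoid_scheme"
  assumes vgroup: "v \<in> V \<Longrightarrow> group (G v)"
begin

abbreviation W where "W \<equiv> syllable_words V G"
abbreviation weq where "weq \<equiv> word_eq V G"
abbreviation cl where "cl \<equiv> word_class V G"
abbreviation F where "F \<equiv> free_product V G"

lemma W_simps [simp]:
  "[] \<in> W" "(a # x) \<in> W \<longleftrightarrow> fst a \<in> V \<and> snd a \<in> carrier (G (fst a)) \<and> x \<in> W"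
  "(x @ y) \<in> W \<longleftrightarrow> x \<in> W \<and> y \<in> W"
  by (cases a; auto simp: syllable_words_def)+

lemma weq_W: "weq x y \<Longrightarrow> x \<in> W \<and> y \<in> W"
proof (induction rule: word_eq.induct)
  case (unit x y v)
  then show ?case using vgroup[of v] by (simp add: group.is_monoid monoid.one_closed)
next
  case (merge x y v g h)
  then show ?case using vgroup[of v] by (simp add: group.is_monoid monoid.m_closed)
qed auto

lemma weq_prepend: "weq x y \<Longrightarrow> z \<in> W \<Longrightarrow> weq (z @ x) (z @ y)"
proof (induction rule: word_eq.induct)
  case (unit x y v)
  then show ?case using word_eq.unit[of "z @ x" V G y v] by simp
next
  case (merge x y v g h)
  then show ?case using word_eq.merge[of "z @ x" V G y v g h] by simp
qed (auto intro: word_eq.refl word_eq.sym word_eq.trans)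

lemma weq_append: "weq x y \<Longrightarrow> z \<in> W \<Longrightarrow> weq (x @ z) (y @ z)"
proof (induction rule: word_eq.induct)
  case (unit x y v)
  then show ?case using word_eq.unit[of x V G "y @ z" v] by simp
next
  case (merge x y v g h)
  then show ?case using word_eq.merge[of x V G "y @ z" v g h] by simp
qed (auto intro: word_eq.refl word_eq.sym word_eq.trans)

lemma cl_eq_iff: "x \<in> W \<Longrightarrow> cl x = cl y \<longleftrightarrow> weq x y"
  unfolding word_class_def
  by (auto intro: word_eq.refl word_eq.sym word_eq.trans)

lemma carrier_F: "carrier F = cl ` W" by (simp add: free_product_def)

lemma one_F: "\<one>\<^bsub>F\<^esub> = cl []" by (simp add: free_product_def)

lemma cl_in_F [simp]: "x \<in> W \<Longrightarrow> cl x \<in> carrier F" by (simp add: carrier_F)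

lemma mult_cl: assumes "x \<in> W" "y \<in> W" shows "cl x \<otimes>\<^bsub>F\<^esub> cl y = cl (x @ y)"
proof -
  have *: "cl (x' @ y') = cl (x @ y)" if "weq x x'" "weq y y'" for x' y'
  proof -
    have "weq (x @ y) (x' @ y)" using that assms weq_append by blast
    moreover have "weq (x' @ y) (x' @ y')" using that weq_prepend weq_W by blast
    ultimately show ?thesis using assms cl_eq_iff[of "x @ y" "x' @ y'"] word_eq.trans[of V G "x @ y" "x' @ y" "x' @ y'"] by simp
  qed
  have "cl x \<otimes>\<^bsub>F\<^esub> cl y = (\<Union>x'\<in>{x'. weq x x'}. \<Union>y'\<in>{y'. weq y y'}. cl (x' @ y'))"
    by (simp add: free_product_def word_class_def)
  also have "\<dots> = (\<Union>x'\<in>{x'. weq x x'}. \<Union>y'\<in>{y'. weq y y'}. cl (x @ y))"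
    using * by (intro SUP_cong) auto
  also have "\<dots> = cl (x @ y)"
    using word_eq.refl[OF assms(1)] word_eq.refl[OF assms(2)] by blast
  finally show ?thesis .
qed

definition winv :: "('v \<times> 'g) list \<Rightarrow> ('v \<times> 'g) list" where
  "winv x = rev (map (\<lambda>(v, g). (v, inv\<^bsub>G v\<^esub> g)) x)"

lemma winv_W: "x \<in> W \<Longrightarrow> winv x \<in> W"
  by (induction x) (auto simp: winv_def vgroup group.inv_closed)

lemma winv_weq: "x \<in> W \<Longrightarrow> weq (winv x @ x) []"
proof (induction x)
  case Nil
  then show ?case by (simp add: winv_def word_eq.refl)
next
  case (Cons a x)
  obtain v g where a: "a = (v, g)" by force
  have v: "v \<in> V" and g: "g \<in> carrier (G v)" and x: "x \<in> W" using Cons.prems a by auto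
  interpret Gv: group "G v" using vgroup[OF v] .
  have w: "winv ((v, g) # x) = winv x @ [(v, inv\<^bsub>G v\<^esub> g)]" by (simp add: winv_def)
  have "weq (winv x @ [(v, inv\<^bsub>G v\<^esub> g), (v, g)] @ x) (winv x @ [(v, inv\<^bsub>G v\<^esub> g \<otimes>\<^bsub>G v\<^esub> g)] @ x)"
    using v g x winv_W by (intro word_eq.merge) auto
  also have "inv\<^bsub>G v\<^esub> g \<otimes>\<^bsub>G v\<^esub> g = \<one>\<^bsub>G v\<^esub>" using g by simp
  finally have "weq (winv (a # x) @ (a # x)) (winv x @ [(v, \<one>\<^bsub>G v\<^esub>)] @ x)" by (simp add: w a)
  moreover have "weq (winv x @ [(v, \<one>\<^bsub>G v\<^esub>)] @ x) (winv x @ x)"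
    using v x winv_W by (intro word_eq.unit) auto
  ultimately show ?case using Cons.IH[OF x] word_eq.trans by blast
qed

lemma group_F: "group F"
proof (rule groupI)
  show "x \<otimes>\<^bsub>F\<^esub> y \<in> carrier F" if "x \<in> carrier F" "y \<in> carrier F" for x y
    using that by (auto simp: carrier_F mult_cl)
  show "x \<otimes>\<^bsub>F\<^esub> y \<otimes>\<^bsub>F\<^esub> z = x \<otimes>\<^bsub>F\<^esub> (y \<otimes>\<^bsub>F\<^esub> z)"
    if "x \<in> carrier F" "y \<in> carrier F" "z \<in> carrier F" for x y z
    using that by (auto simp: carrier_F mult_cl)
  show "\<exists>y\<in>carrier F. y \<otimes>\<^bsub>F\<^esub> x = \<one>\<^bsub>F\<^esub>" if x: "x \<in> carrier F" for x
  proof -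
    obtain w where w: "w \<in> W" "x = cl w" using x by (auto simp: carrier_F)
    then show ?thesis
      using winv_W[of w] winv_weq[of w] cl_eq_iff[of "winv w @ w" "[]"] one_F mult_cl[of "winv w" w]
      by (intro bexI[of _ "cl (winv w)"]) auto
  qed
qed (auto simp: carrier_F one_F mult_cl)

definition word_prod :: "('b, 'n) monoid_scheme \<Rightarrow> ('v \<Rightarrow> 'g \<Rightarrow> 'b) \<Rightarrow> ('v \<times> 'g) list \<Rightarrow> 'b" where
  "word_prod H f x = foldr (\<lambda>a b. f (fst a) (snd a) \<otimes>\<^bsub>H\<^esub> b) x \<one>\<^bsub>H\<^esub>"

lemma word_prod_simps [simp]:
  "word_prod H f [] = \<one>\<^bsub>H\<^esub>" "word_prod H f (a # x) = f (fst a) (snd a) \<otimes>\<^bsub>H\<^esub> word_prod H f x"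
  by (simp_all add: word_prod_def)

context
  fixes H :: "('b, 'n) monoid_scheme" and f
  assumes H: "group H" and f: "\<And>v. v \<in> V \<Longrightarrow> f v \<in> hom (G v) H"
begin

lemma word_prod_closed: "x \<in> W \<Longrightarrow> word_prod H f x \<in> carrier H"
proof (induction x)
  case Nil
  interpret group H by (rule H)
  show ?case by simp
next
  case (Cons a x)
  interpret group H by (rule H)
  show ?case using Cons f[of "fst a"] by (auto simp: hom_in_carrier)
qed

lemma word_prod_append:
  "x \<in> W \<Longrightarrow> y \<in> W \<Longrightarrow> word_prod H f (x @ y) = word_prod H f x \<otimes>\<^bsub>H\<^esub> word_prod H f y"
proof (induction x)
  case Nil
  interpret group H by (rule H)
  show ?case using Nil word_prod_closed[of y] by simp
next
  case (Cons a x)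
  interpret group H by (rule H)
  have "f (fst a) (snd a) \<in> carrier H" using Cons f[of "fst a"] by (auto simp: hom_in_carrier)
  then show ?case using Cons word_prod_closed[of y] word_prod_closed[of x] by (auto simp: m_assoc)
qed

lemma word_prod_weq: "weq x y \<Longrightarrow> word_prod H f x = word_prod H f y"
proof (induction rule: word_eq.induct)
  case (unit x y v)
  interpret group H by (rule H)
  interpret Gv: group "G v" using unit vgroup by blast
  have "f v \<one>\<^bsub>G v\<^esub> = \<one>\<^bsub>H\<^esub>" using hom_one[OF f] unit H Gv.is_group by blast
  then show ?case using unit word_prod_closed by (simp add: word_prod_append)
next
  case (merge x y v g h)
  interpret group H by (rule H)
  interpret Gv: group "G v" using merge vgroup by blast
  have "f v (g \<otimes>\<^bsub>G v\<^esub> h) = f v g \<otimes>\<^bsub>H\<^esub> f v h" using merge f by (simp add: hom_mult)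
  moreover have "f v g \<in> carrier H" "f v h \<in> carrier H" using merge f hom_in_carrier by metis+
  ultimately show ?case using merge word_prod_closed by (simp add: word_prod_append m_assoc)
qed auto

lemma free_product_hom: "\<exists>\<phi>\<in>hom F H. \<forall>x\<in>W. \<phi> (cl x) = word_prod H f x"
proof -
  define \<phi> where "\<phi> A = word_prod H f (SOME x. x \<in> A)" for A
  have \<phi>: "\<phi> (cl x) = word_prod H f x" if "x \<in> W" for x
  proof -
    have "weq x (SOME y. y \<in> cl x)"
      using someI[of "\<lambda>y. y \<in> cl x" x] word_eq.refl[OF that] by (simp add: word_class_def)
    then show ?thesis using word_prod_weq by (simp add: \<phi>_def)
  qed
  moreover have "\<phi> \<in> hom F H"
    by (rule homI) (auto simp: carrier_F \<phi> mult_cl word_prod_append word_prod_closed)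
  ultimately show ?thesis by blast
qed

end

end

lemma (in group) normal_closure_normal: "S \<subseteq> carrier G \<Longrightarrow> normal_closure G S \<lhd> G"
proof -
  assume S: "S \<subseteq> carrier G"
  let ?A = "{N. N \<lhd> G \<and> S \<subseteq> N}"
  have c: "carrier G \<in> ?A" using S subgroup_self by (auto simp: normal_inv_iff)
  have "subgroup (\<Inter>?A) G"
    by (rule subgroups_Inter) (use c in \<open>auto simp: normal_imp_subgroup\<close>)
  moreover have "x \<otimes> h \<otimes> inv x \<in> \<Inter>?A" if "x \<in> carrier G" "h \<in> \<Inter>?A" for x h
    using that by (auto simp: normal_inv_iff)
  ultimately show ?thesis by (simp add: normal_closure_def normal_inv_iff)
qed

lemma subset_normal_closure: "S \<subseteq> normal_closure G S"
  by (auto simp: normal_closure_def)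

lemma normal_closure_subset: "N \<lhd> G \<Longrightarrow> S \<subseteq> N \<Longrightarrow> normal_closure G S \<subseteq> N"
  by (auto simp: normal_closure_def)

locale graph_product_data =
  fixes \<Gamma> :: "'v ugraph" and G :: "'v \<Rightarrow> ('g, 'm) monoid_scheme"
  assumes simplicial: "simplicial_graph \<Gamma>"
    and group_vertex: "v \<in> verts \<Gamma> \<Longrightarrow> group (G v)"

sublocale graph_product_data \<subseteq> vertex_groups "verts \<Gamma>" G
  by (intro vertex_groups.intro group_vertex)

context graph_product_data
begin

abbreviation P where "P \<equiv> graph_product \<Gamma> G"
abbreviation N where "N \<equiv> normal_closure F (graph_product_relators \<Gamma> G)"

text \<open>The element of the graph product that a syllable word represents.\<close>

definition E :: "('v \<times> 'g) list \<Rightarrow> ('v \<times> 'g) list set set" where "E x = N #>\<^bsub>F\<^esub> cl x"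
definition syl :: "'v \<Rightarrow> 'g \<Rightarrow> ('v \<times> 'g) list set set" where "syl v g = E [(v, g)]"

lemma edge_verts: "{u, v} \<in> edges \<Gamma> \<Longrightarrow> u \<in> verts \<Gamma> \<and> v \<in> verts \<Gamma> \<and> u \<noteq> v"
  using simplicial unfolding simplicial_graph_def by (metis doubleton_eq_iff)

lemma relators_subset: "graph_product_relators \<Gamma> G \<subseteq> carrier F"
proof -
  interpret F: group F by (rule group_F)
  show ?thesis
    unfolding graph_product_relators_def Let_def using edge_verts by (auto intro!: F.m_closed F.inv_closed)
qed

lemma normal_N: "N \<lhd> F"
  using group.normal_closure_normal[OF group_F relators_subset] .

lemma P_Mod: "P = F Mod N" by (simp add: graph_product_def)

lemma group_P: "group P"
  unfolding P_Mod by (rule normal.factorgroup_is_group[OF normal_N])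

sublocale P: group P by (rule group_P)

abbreviation P_mult (infixl \<open>\<odot>\<close> 70) where "x \<odot> y \<equiv> x \<otimes>\<^bsub>P\<^esub> y"
abbreviation P_inv (\<open>\<ominus> _\<close> [81] 80) where "\<ominus> x \<equiv> inv\<^bsub>P\<^esub> x"

lemma carrier_P: "carrier P = E ` W"
  unfolding P_Mod carrier_FactGroup carrier_F E_def by auto

lemma E_closed [simp]: "x \<in> W \<Longrightarrow> E x \<in> carrier P" by (simp add: carrier_P)

lemma E_append: "x \<in> W \<Longrightarrow> y \<in> W \<Longrightarrow> E (x @ y) = E x \<odot> E y"
  unfolding P_Mod mult_FactGroup E_def
  by (subst normal.rcos_sum[OF normal_N]) (auto simp: mult_cl)

lemma E_Nil [simp]: "E [] = \<one>\<^bsub>P\<^esub>"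
  by (metis E_append E_closed P.l_cancel_one W_simps(1) append.left_neutral)

lemma E_Cons: "v \<in> verts \<Gamma> \<Longrightarrow> g \<in> carrier (G v) \<Longrightarrow> x \<in> W \<Longrightarrow> E ((v, g) # x) = syl v g \<odot> E x"
  using E_append[of "[(v, g)]" x] by (simp add: syl_def)

lemma E_snoc: "v \<in> verts \<Gamma> \<Longrightarrow> g \<in> carrier (G v) \<Longrightarrow> x \<in> W \<Longrightarrow> E (x @ [(v, g)]) = E x \<odot> syl v g"
  using E_append[of x "[(v, g)]"] by (simp add: syl_def)

lemma syl_closed [simp]: "v \<in> verts \<Gamma> \<Longrightarrow> g \<in> carrier (G v) \<Longrightarrow> syl v g \<in> carrier P"
  by (simp add: syl_def)

lemma syl_hom: "v \<in> verts \<Gamma> \<Longrightarrow> syl v \<in> hom (G v) P"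
proof (rule homI)
  fix g h assume v: "v \<in> verts \<Gamma>" and gh: "g \<in> carrier (G v)" "h \<in> carrier (G v)"
  interpret Gv: group "G v" using v group_vertex by blast
  have "weq ([] @ [(v, g), (v, h)] @ []) ([] @ [(v, g \<otimes>\<^bsub>G v\<^esub> h)] @ [])"
    using v gh by (intro word_eq.merge) auto
  then have "cl [(v, g), (v, h)] = cl [(v, g \<otimes>\<^bsub>G v\<^esub> h)]"
    using cl_eq_iff[of "[(v, g), (v, h)]"] v gh by simp
  then have "E ([(v, g), (v, h)]) = E [(v, g \<otimes>\<^bsub>G v\<^esub> h)]"
    by (simp only: E_def)
  then show "syl v (g \<otimes>\<^bsub>G v\<^esub> h) = syl v g \<odot> syl v h"
    using E_Cons[of v g "[(v,h)]"] v gh by (simp add: syl_def)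
qed simp

lemma syl_mult: "v \<in> verts \<Gamma> \<Longrightarrow> g \<in> carrier (G v) \<Longrightarrow> h \<in> carrier (G v) \<Longrightarrow>
    syl v g \<odot> syl v h = syl v (g \<otimes>\<^bsub>G v\<^esub> h)"
  by (simp add: hom_mult[OF syl_hom])

lemma syl_one [simp]: "v \<in> verts \<Gamma> \<Longrightarrow> syl v \<one>\<^bsub>G v\<^esub> = \<one>\<^bsub>P\<^esub>"
  using hom_one[OF syl_hom] group_vertex group_P by blast

lemma inv_syl: "v \<in> verts \<Gamma> \<Longrightarrow> g \<in> carrier (G v) \<Longrightarrow> \<ominus> (syl v g) = syl v (inv\<^bsub>G v\<^esub> g)"
  using group_hom.hom_inv[of "G v" P "syl v" g] syl_hom group_vertex group_P
  by (simp add: group_hom_def group_hom_axioms_def)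

lemma syl_commute:
  assumes "{u, v} \<in> edges \<Gamma>" "g \<in> carrier (G u)" "h \<in> carrier (G v)"
  shows "syl u g \<odot> syl v h = syl v h \<odot> syl u g"
proof -
  interpret F: group F by (rule group_F)
  have uv: "u \<in> verts \<Gamma>" "v \<in> verts \<Gamma>" using edge_verts assms by auto
  define a b where "a = cl [(u, g)]" and "b = cl [(v, h)]"
  have ab: "a \<in> carrier F" "b \<in> carrier F" using uv assms by (auto simp: a_def b_def)
  have "a \<otimes>\<^bsub>F\<^esub> b \<otimes>\<^bsub>F\<^esub> inv\<^bsub>F\<^esub> a \<otimes>\<^bsub>F\<^esub> inv\<^bsub>F\<^esub> b \<in> graph_product_relators \<Gamma> G"
    unfolding graph_product_relators_def Let_def a_def b_def using assms by blast
  then have "a \<otimes>\<^bsub>F\<^esub> b \<otimes>\<^bsub>F\<^esub> inv\<^bsub>F\<^esub> (b \<otimes>\<^bsub>F\<^esub> a) \<in> N"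
    using subsetD[OF subset_normal_closure] ab by (auto simp: F.inv_mult_group F.m_assoc)
  then have "a \<otimes>\<^bsub>F\<^esub> b \<in> N #>\<^bsub>F\<^esub> (b \<otimes>\<^bsub>F\<^esub> a)"
    using subgroup.rcos_module_rev[OF normal_imp_subgroup[OF normal_N] group_F, of "b \<otimes>\<^bsub>F\<^esub> a" "a \<otimes>\<^bsub>F\<^esub> b"] ab by auto
  then have "N #>\<^bsub>F\<^esub> (a \<otimes>\<^bsub>F\<^esub> b) = N #>\<^bsub>F\<^esub> (b \<otimes>\<^bsub>F\<^esub> a)"
    using F.repr_independence[of _ N] ab normal_N normal_imp_subgroup F.m_closed by metis
  then have "E [(u, g), (v, h)] = E [(v, h), (u, g)]"
    using uv assms by (simp add: E_def a_def b_def mult_cl)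
  then show ?thesis using uv assms E_Cons[of u g "[(v,h)]"] E_Cons[of v h "[(u,g)]"]
    by (simp add: syl_def)
qed

lemma P_induct [consumes 1, case_names one mult]:
  assumes "x \<in> carrier P" and "Q \<one>\<^bsub>P\<^esub>"
    and "\<And>x v g. x \<in> carrier P \<Longrightarrow> Q x \<Longrightarrow> v \<in> verts \<Gamma> \<Longrightarrow> g \<in> carrier (G v) \<Longrightarrow> Q (x \<odot> syl v g)"
  shows "Q x"
proof -
  have "Q (E w)" if "w \<in> W" for w
    using that
  proof (induction w rule: rev_induct)
    case Nil then show ?case using assms(2) by simp
  next
    case (snoc a w)
    then show ?case using assms(3)[of "E w" "fst a" "snd a"] E_snoc[of "fst a" "snd a" w] by simp
  qed
  then show ?thesis using assms(1) by (auto simp: carrier_P)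
qed

text \<open>The universal property of the graph product.\<close>

lemma graph_product_hom:
  assumes H: "group H" and f: "\<And>v. v \<in> verts \<Gamma> \<Longrightarrow> f v \<in> hom (G v) H"
    and comm: "\<And>u v g h. {u, v} \<in> edges \<Gamma> \<Longrightarrow> g \<in> carrier (G u) \<Longrightarrow> h \<in> carrier (G v) \<Longrightarrow>
      f u g \<otimes>\<^bsub>H\<^esub> f v h = f v h \<otimes>\<^bsub>H\<^esub> f u g"
  shows "\<exists>\<psi>\<in>hom P H. \<forall>v\<in>verts \<Gamma>. \<forall>g\<in>carrier (G v). \<psi> (syl v g) = f v g"
proof -
  interpret F: group F by (rule group_F)
  interpret H: group H by (rule H)
  obtain \<phi> where \<phi>: "\<phi> \<in> hom F H" "\<And>x. x \<in> W \<Longrightarrow> \<phi> (cl x) = word_prod H f x"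
    using free_product_hom[of H f, OF H f] by blast
  interpret h: group_hom F H \<phi> by unfold_locales (rule \<phi>(1))
  have fc: "f v g \<in> carrier H" if "v \<in> verts \<Gamma>" "g \<in> carrier (G v)" for v g
    using f that hom_in_carrier by metis
  have \<phi>1: "\<phi> (cl [(v, g)]) = f v g" if "v \<in> verts \<Gamma>" "g \<in> carrier (G v)" for v g
    using that fc by (simp add: \<phi>(2))
  have "graph_product_relators \<Gamma> G \<subseteq> kernel F H \<phi>"
  proof
    fix r assume r: "r \<in> graph_product_relators \<Gamma> G"
    then obtain u v g h where e: "{u, v} \<in> edges \<Gamma>" "g \<in> carrier (G u)" "h \<in> carrier (G v)"
      and r': "r = cl [(u, g)] \<otimes>\<^bsub>F\<^esub> cl [(v, h)] \<otimes>\<^bsub>F\<^esub> inv\<^bsub>F\<^esub> cl [(u, g)] \<otimes>\<^bsub>F\<^esub> inv\<^bsub>F\<^esub> cl [(v, h)]"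
      unfolding graph_product_relators_def Let_def by blast
    have uv: "u \<in> verts \<Gamma>" "v \<in> verts \<Gamma>" using e edge_verts by auto
    have ab: "cl [(u, g)] \<in> carrier F" "cl [(v, h)] \<in> carrier F" using uv e by auto
    have "\<phi> r = f u g \<otimes>\<^bsub>H\<^esub> f v h \<otimes>\<^bsub>H\<^esub> inv\<^bsub>H\<^esub> f u g \<otimes>\<^bsub>H\<^esub> inv\<^bsub>H\<^esub> f v h"
      using ab uv e \<phi>1 by (simp add: r')
    also have "\<dots> = f v h \<otimes>\<^bsub>H\<^esub> (f u g \<otimes>\<^bsub>H\<^esub> inv\<^bsub>H\<^esub> f u g) \<otimes>\<^bsub>H\<^esub> inv\<^bsub>H\<^esub> f v h"
      using comm[OF e] fc uv e by (simp add: H.m_assoc)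
    also have "\<dots> = \<one>\<^bsub>H\<^esub>" using fc uv e by simp
    finally show "r \<in> kernel F H \<phi>" using r relators_subset by (auto simp: kernel_def)
  qed
  then have "N \<subseteq> kernel F H \<phi>" using normal_closure_subset h.normal_kernel by blast
  then obtain \<psi> where "\<psi> \<in> hom (F Mod N) H" "\<And>x. x \<in> carrier F \<Longrightarrow> \<psi> (N #>\<^bsub>F\<^esub> x) = \<phi> x"
    using h.FactGroup_universal_kernel[OF normal_N] by metis
  then show ?thesis using \<phi>1 by (intro bexI[of _ \<psi>]) (auto simp: P_Mod syl_def E_def)
qed

end

section \<open>Retractions and sectors\<close>

lemma BijGroup_mult: "f \<in> Bij A \<Longrightarrow> g \<in> Bij A \<Longrightarrow> f \<otimes>\<^bsub>BijGroup A\<^esub> g = compose A f g"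
  by (simp add: BijGroup_def)

lemma BijGroup_carrier: "carrier (BijGroup A) = Bij A"
  by (simp add: BijGroup_def)

context graph_product_data
begin

text \<open>The retraction onto the subgroup generated by the vertex groups in \<open>A\<close>, which kills the other vertex groups.\<close>

definition kill :: "'v set \<Rightarrow> ('v \<times> 'g) list set set \<Rightarrow> ('v \<times> 'g) list set set" where
  "kill A = (SOME \<psi>. \<psi> \<in> hom P P \<and> (\<forall>v\<in>verts \<Gamma>. \<forall>g\<in>carrier (G v).
     \<psi> (syl v g) = (if v \<in> A then syl v g else \<one>\<^bsub>P\<^esub>)))"

lemma kill_spec:
  "kill A \<in> hom P P \<and> (\<forall>v\<in>verts \<Gamma>. \<forall>g\<in>carrier (G v).
     kill A (syl v g) = (if v \<in> A then syl v g else \<one>\<^bsub>P\<^esub>))"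
proof -
  let ?f = "\<lambda>v g. if v \<in> A then syl v g else \<one>\<^bsub>P\<^esub>"
  have h: "?f v \<in> hom (G v) P" if "v \<in> verts \<Gamma>" for v
    using that by (auto intro!: homI simp: syl_mult)
  have "\<exists>\<psi>\<in>hom P P. \<forall>v\<in>verts \<Gamma>. \<forall>g\<in>carrier (G v). \<psi> (syl v g) = ?f v g"
  proof (rule graph_product_hom[OF group_P h])
    fix u v g h assume e: "{u, v} \<in> edges \<Gamma>" "g \<in> carrier (G u)" "h \<in> carrier (G v)"
    then show "?f u g \<odot> ?f v h = ?f v h \<odot> ?f u g"
      using syl_commute[OF e] edge_verts[OF e(1)] by simp
  qed
  then have "\<exists>\<psi>. \<psi> \<in> hom P P \<and> (\<forall>v\<in>verts \<Gamma>. \<forall>g\<in>carrier (G v). \<psi> (syl v g) = ?f v g)"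
    by blast
  then show ?thesis unfolding kill_def by (rule someI_ex)
qed

lemma kill_syl: "v \<in> verts \<Gamma> \<Longrightarrow> g \<in> carrier (G v) \<Longrightarrow>
    kill A (syl v g) = (if v \<in> A then syl v g else \<one>\<^bsub>P\<^esub>)"
  using kill_spec by blast

lemma kill_group_hom: "group_hom P P (kill A)"
  using kill_spec group_P by (simp add: group_hom_def group_hom_axioms_def)

lemma kill_closed [simp]: "x \<in> carrier P \<Longrightarrow> kill A x \<in> carrier P"
  using group_hom.hom_closed[OF kill_group_hom] .

lemma kill_mult [simp]: "x \<in> carrier P \<Longrightarrow> y \<in> carrier P \<Longrightarrow>
    kill A (x \<odot> y) = kill A x \<odot> kill A y"
  using group_hom.hom_mult[OF kill_group_hom] .

lemma kill_one [simp]: "kill A \<one>\<^bsub>P\<^esub> = \<one>\<^bsub>P\<^esub>"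
  using group_hom.hom_one[OF kill_group_hom] .

lemma kill_inv [simp]: "x \<in> carrier P \<Longrightarrow> kill A (\<ominus> x) = \<ominus> (kill A x)"
  using group_hom.hom_inv[OF kill_group_hom] .

lemma kill_E: "w \<in> W \<Longrightarrow> kill A (E w) = E (filter (\<lambda>a. fst a \<in> A) w)"
proof (induction w)
  case (Cons a w)
  have "filter (\<lambda>a. fst a \<in> A) w \<in> W" using Cons.prems by (auto simp: syllable_words_def)
  then show ?case using Cons by (cases a) (auto simp: E_Cons kill_syl)
qed simp

lemma kill_kill: "x \<in> carrier P \<Longrightarrow> kill A (kill B x) = kill (A \<inter> B) x"
  by (induction rule: P_induct) (auto simp: kill_syl)

text \<open>The subgroup generated by the vertex groups in \<open>A\<close>, as the fixed points of a retraction. In this form intersections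
  are easy: \<open>kill A\<close> and \<open>kill B\<close> compose to \<open>kill (A \<inter> B)\<close>.\<close>

definition span :: "'v set \<Rightarrow> ('v \<times> 'g) list set set set" where
  "span A = {x \<in> carrier P. kill A x = x}"

lemma span_closed: "x \<in> span A \<Longrightarrow> x \<in> carrier P" by (simp add: span_def)

lemma subgroup_span: "subgroup (span A) P"
  by unfold_locales (auto simp: span_def)

lemma syl_span: "v \<in> verts \<Gamma> \<Longrightarrow> g \<in> carrier (G v) \<Longrightarrow> v \<in> A \<Longrightarrow> syl v g \<in> span A"
  by (simp add: span_def kill_syl)

lemma kill_span: "x \<in> carrier P \<Longrightarrow> kill A x \<in> span A"
  by (simp add: span_def kill_kill)

lemma span_mult_iff:
  assumes "x \<in> carrier P" "y \<in> span A"
  shows "x \<odot> y \<in> span A \<longleftrightarrow> x \<in> span A" "y \<odot> x \<in> span A \<longleftrightarrow> x \<in> span A"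
  using assms by (auto simp: span_def)

lemma span_mono: "A \<subseteq> B \<Longrightarrow> span A \<subseteq> span B"
proof
  fix x assume "A \<subseteq> B" "x \<in> span A"
  then show "x \<in> span B"
    using kill_kill[of x B A] by (auto simp: span_def Int_absorb1)
qed

lemma span_int: "x \<in> span A \<Longrightarrow> x \<in> span B \<Longrightarrow> x \<in> span (A \<inter> B)"
  using kill_kill[of x A B] by (auto simp: span_def)

lemma span_word: "x \<in> span A \<Longrightarrow> \<exists>w\<in>W. E w = x \<and> fst ` set w \<subseteq> A"
proof -
  assume x: "x \<in> span A"
  then obtain w where w: "w \<in> W" "E w = x" by (auto simp: span_def carrier_P)
  have "filter (\<lambda>a. fst a \<in> A) w \<in> W" using w by (auto simp: syllable_words_def)
  moreover have "E (filter (\<lambda>a. fst a \<in> A) w) = x" using x w kill_E[of w A] by (simp add: span_def)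
  ultimately show ?thesis by (intro bexI[of _ "filter (\<lambda>a. fst a \<in> A) w"]) auto
qed

text \<open>The retraction onto a vertex group.\<close>

definition ret :: "'v \<Rightarrow> ('v \<times> 'g) list set set \<Rightarrow> 'g" where
  "ret u = (SOME \<psi>. \<psi> \<in> hom P (G u) \<and> (\<forall>v\<in>verts \<Gamma>. \<forall>g\<in>carrier (G v).
     \<psi> (syl v g) = (if v = u then g else \<one>\<^bsub>G u\<^esub>)))"

lemma ret_spec:
  assumes u: "u \<in> verts \<Gamma>"
  shows "ret u \<in> hom P (G u) \<and> (\<forall>v\<in>verts \<Gamma>. \<forall>g\<in>carrier (G v).
     ret u (syl v g) = (if v = u then g else \<one>\<^bsub>G u\<^esub>))"
proof -
  interpret Gu: group "G u" using u group_vertex by blast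
  let ?f = "\<lambda>v g. if v = u then g else \<one>\<^bsub>G u\<^esub>"
  have h: "?f v \<in> hom (G v) (G u)" if "v \<in> verts \<Gamma>" for v
    by (auto intro!: homI)
  have "\<exists>\<psi>\<in>hom P (G u). \<forall>v\<in>verts \<Gamma>. \<forall>g\<in>carrier (G v). \<psi> (syl v g) = ?f v g"
  proof (rule graph_product_hom[OF Gu.is_group h])
    fix u' v g h assume e: "{u', v} \<in> edges \<Gamma>" "g \<in> carrier (G u')" "h \<in> carrier (G v)"
    then show "?f u' g \<otimes>\<^bsub>G u\<^esub> ?f v h = ?f v h \<otimes>\<^bsub>G u\<^esub> ?f u' g"
      using edge_verts[OF e(1)] by auto
  qed
  then have "\<exists>\<psi>. \<psi> \<in> hom P (G u) \<and> (\<forall>v\<in>verts \<Gamma>. \<forall>g\<in>carrier (G v). \<psi> (syl v g) = ?f v g)"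
    by blast
  then show ?thesis unfolding ret_def by (rule someI_ex)
qed

lemma ret_syl: "u \<in> verts \<Gamma> \<Longrightarrow> v \<in> verts \<Gamma> \<Longrightarrow> g \<in> carrier (G v) \<Longrightarrow>
    ret u (syl v g) = (if v = u then g else \<one>\<^bsub>G u\<^esub>)"
  using ret_spec by blast

lemma ret_group_hom: "u \<in> verts \<Gamma> \<Longrightarrow> group_hom P (G u) (ret u)"
  using ret_spec group_P group_vertex by (simp add: group_hom_def group_hom_axioms_def)

lemma ret_conj:
  assumes "u \<in> verts \<Gamma>" "v \<in> verts \<Gamma>" "g \<in> carrier (G v)" "h \<in> carrier P"
  shows "ret u (h \<odot> syl v g \<odot> \<ominus> h) = \<one>\<^bsub>G u\<^esub> \<longleftrightarrow> v \<noteq> u \<or> g = \<one>\<^bsub>G v\<^esub>"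
proof -
  interpret group_hom P "G u" "ret u" using assms ret_group_hom by blast
  have "ret u h \<otimes>\<^bsub>G u\<^esub> g \<otimes>\<^bsub>G u\<^esub> inv\<^bsub>G u\<^esub> ret u h = \<one>\<^bsub>G u\<^esub> \<longleftrightarrow> g = \<one>\<^bsub>G u\<^esub>" if "v = u"
  proof
    assume *: "ret u h \<otimes>\<^bsub>G u\<^esub> g \<otimes>\<^bsub>G u\<^esub> inv\<^bsub>G u\<^esub> ret u h = \<one>\<^bsub>G u\<^esub>"
    have r: "ret u h \<in> carrier (G u)" and g: "g \<in> carrier (G u)" using assms that by auto
    have "ret u h \<otimes>\<^bsub>G u\<^esub> g = ret u h"
      using * r g H.inv_solve_right'[of "\<one>\<^bsub>G u\<^esub>" "ret u h \<otimes>\<^bsub>G u\<^esub> g" "ret u h"] by simp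
    then show "g = \<one>\<^bsub>G u\<^esub>" using r g by simp
  qed (use assms that in simp)
  then show ?thesis using assms by (auto simp: ret_syl)
qed

lemma syl_eq_one: "v \<in> verts \<Gamma> \<Longrightarrow> g \<in> carrier (G v) \<Longrightarrow> syl v g = \<one>\<^bsub>P\<^esub> \<longleftrightarrow> g = \<one>\<^bsub>G v\<^esub>"
  using ret_syl[of v v g] group_hom.hom_one[OF ret_group_hom, of v] by auto

definition star :: "'v \<Rightarrow> 'v set" where "star v = insert v {u. {u, v} \<in> edges \<Gamma>}"

lemma star_sub: "v \<in> verts \<Gamma> \<Longrightarrow> star v \<subseteq> verts \<Gamma>"
  using edge_verts by (auto simp: star_def)

text \<open>Right multiplication by a syllable on two coordinates. The second coordinate records crossings of the star of the
  vertex \<open>G v\<close>: it changes when a letter of \<open>G v\<close> is read while the first coordinate is in the subgroup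
  generated by the star of \<open>v\<close>. Since this subgroup is invariant under right multiplication by letters of the
  star, the action respects the relations of \<open>P\<close>.\<close>

definition wall_act :: "'v \<Rightarrow> 'v \<Rightarrow> 'g \<Rightarrow> ('v \<times> 'g) list set set \<times> 'g \<Rightarrow> ('v \<times> 'g) list set set \<times> 'g"
  where "wall_act v u t z =
    (fst z \<odot> syl u t, if u = v \<and> fst z \<in> span (star v) then snd z \<otimes>\<^bsub>G v\<^esub> t else snd z)"

context
  fixes v assumes v: "v \<in> verts \<Gamma>"
begin

abbreviation "S \<equiv> carrier P \<times> carrier (G v)"

lemma star_mult_iff:
  "x \<in> carrier P \<Longrightarrow> u \<in> star v \<Longrightarrow> t \<in> carrier (G u) \<Longrightarrow>
    x \<odot> syl u t \<in> span (star v) \<longleftrightarrow> x \<in> span (star v)"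
  using syl_span[of u t "star v"] star_sub[OF v] by (auto simp: span_mult_iff)

lemma wall_act_closed: "u \<in> verts \<Gamma> \<Longrightarrow> t \<in> carrier (G u) \<Longrightarrow> z \<in> S \<Longrightarrow> wall_act v u t z \<in> S"
  using group.is_monoid[OF group_vertex[OF v]] by (auto simp: wall_act_def monoid.m_closed)

lemma wall_act_one: "u \<in> verts \<Gamma> \<Longrightarrow> z \<in> S \<Longrightarrow> wall_act v u \<one>\<^bsub>G u\<^esub> z = z"
  using group.is_monoid[OF group_vertex[OF v]] by (auto simp: wall_act_def)

lemma wall_act_mult:
  assumes "u \<in> verts \<Gamma>" "t \<in> carrier (G u)" "s \<in> carrier (G u)" "z \<in> S"
  shows "wall_act v u s (wall_act v u t z) = wall_act v u (t \<otimes>\<^bsub>G u\<^esub> s) z"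
proof -
  interpret Gv: group "G v" using v group_vertex by blast
  have "v \<in> star v" by (simp add: star_def)
  then show ?thesis using assms star_mult_iff[of "fst z" v t]
    by (auto simp: wall_act_def P.m_assoc syl_mult Gv.m_assoc)
qed

lemma wall_act_commute:
  assumes "{u, u'} \<in> edges \<Gamma>" "t \<in> carrier (G u)" "s \<in> carrier (G u')" "z \<in> S"
  shows "wall_act v u t (wall_act v u' s z) = wall_act v u' s (wall_act v u t z)"
proof -
  have uu: "u \<in> verts \<Gamma>" "u' \<in> verts \<Gamma>" "u \<noteq> u'" using assms edge_verts by auto
  have "syl u' s \<odot> syl u t = syl u t \<odot> syl u' s" using syl_commute assms by metis
  moreover have "u' \<in> star v" if "u = v" using that assms by (simp add: star_def insert_commute)
  moreover have "u \<in> star v" if "u' = v" using that assms by (simp add: star_def)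
  ultimately show ?thesis
    using assms uu star_mult_iff[of "fst z" u t] star_mult_iff[of "fst z" u' s]
    by (auto simp: wall_act_def P.m_assoc)
qed

text \<open>Turn the right action into a homomorphism to the group of permutations by means of inverses, and read off the image of the
  base point.\<close>

lemma sector_ex: "\<exists>\<sigma>. \<sigma> \<one>\<^bsub>P\<^esub> = \<one>\<^bsub>G v\<^esub> \<and> (\<forall>x\<in>carrier P. \<sigma> x \<in> carrier (G v) \<and>
    (\<forall>u\<in>verts \<Gamma>. \<forall>t\<in>carrier (G u). \<sigma> (x \<odot> syl u t) =
       (if u = v \<and> x \<in> span (star v) then \<sigma> x \<otimes>\<^bsub>G v\<^esub> t else \<sigma> x)))"
proof -
  interpret Gv: group "G v" using v group_vertex by blast
  let ?H = "BijGroup S"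
  define f where "f u t = restrict (wall_act v u (inv\<^bsub>G u\<^esub> t)) S" for u t
  have fB: "f u t \<in> Bij S" if u: "u \<in> verts \<Gamma>" and t: "t \<in> carrier (G u)" for u t
  proof -
    interpret Gu: group "G u" using u group_vertex by blast
    have "bij_betw (wall_act v u (inv\<^bsub>G u\<^esub> t)) S S"
    proof (rule bij_betw_byWitness[where f' = "wall_act v u t"])
      show "wall_act v u (inv\<^bsub>G u\<^esub> t) ` S \<subseteq> S" "wall_act v u t ` S \<subseteq> S"
        using wall_act_closed u t Gu.inv_closed by blast+
    qed (use u t in \<open>auto simp del: mem_Sigma_iff simp: wall_act_mult wall_act_one\<close>)
    then show ?thesis by (simp add: Bij_def f_def cong: bij_betw_cong)
  qed
  have fh: "f u \<in> hom (G u) ?H" if u: "u \<in> verts \<Gamma>" for u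
  proof (rule homI)
    interpret Gu: group "G u" using u group_vertex by blast
    show "f u t \<in> carrier ?H" if "t \<in> carrier (G u)" for t using fB[OF u that] by (simp only: BijGroup_carrier)
    fix t s assume ts: "t \<in> carrier (G u)" "s \<in> carrier (G u)"
    have "f u (t \<otimes>\<^bsub>G u\<^esub> s) = compose S (f u t) (f u s)"
    proof (rule ext)
      fix z
      show "f u (t \<otimes>\<^bsub>G u\<^esub> s) z = compose S (f u t) (f u s) z"
        using wall_act_mult[of u "inv\<^bsub>G u\<^esub> s" "inv\<^bsub>G u\<^esub> t" z] wall_act_closed[of u "inv\<^bsub>G u\<^esub> s" z] u ts
        by (cases "z \<in> S") (simp_all del: mem_Sigma_iff add: f_def compose_def Gu.inv_mult_group)
    qed
    then show "f u (t \<otimes>\<^bsub>G u\<^esub> s) = f u t \<otimes>\<^bsub>?H\<^esub> f u s"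
      using fB[OF u ts(1)] fB[OF u ts(2)] by (simp only: BijGroup_mult)
  qed
  have fc: "f u t \<otimes>\<^bsub>?H\<^esub> f u' s = f u' s \<otimes>\<^bsub>?H\<^esub> f u t"
    if e: "{u, u'} \<in> edges \<Gamma>" and t: "t \<in> carrier (G u)" and s: "s \<in> carrier (G u')" for u u' t s
  proof -
    have uu: "u \<in> verts \<Gamma>" "u' \<in> verts \<Gamma>" using e edge_verts by auto
    interpret Gu: group "G u" using uu group_vertex by blast
    interpret Gu': group "G u'" using uu group_vertex by blast
    have "compose S (f u t) (f u' s) = compose S (f u' s) (f u t)"
    proof (rule ext)
      fix z
      show "compose S (f u t) (f u' s) z = compose S (f u' s) (f u t) z"
        using wall_act_commute[OF e, of "inv\<^bsub>G u\<^esub> t" "inv\<^bsub>G u'\<^esub> s" z] uu t s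
          wall_act_closed[of u "inv\<^bsub>G u\<^esub> t" z] wall_act_closed[of u' "inv\<^bsub>G u'\<^esub> s" z]
        by (cases "z \<in> S") (simp_all del: mem_Sigma_iff add: f_def compose_def)
    qed
    then show ?thesis using fB[OF uu(1) t] fB[OF uu(2) s] by (simp only: BijGroup_mult)
  qed
  obtain \<Phi> where \<Phi>: "\<Phi> \<in> hom P ?H" "\<And>u g. u \<in> verts \<Gamma> \<Longrightarrow> g \<in> carrier (G u) \<Longrightarrow> \<Phi> (syl u g) = f u g"
    using graph_product_hom[of ?H f, OF group_BijGroup fh fc] by blast
  interpret h: group_hom P ?H \<Phi>
    using \<Phi> group_P group_BijGroup by (simp add: group_hom_def group_hom_axioms_def)
  define \<tau> where "\<tau> x = \<Phi> (\<ominus> x) (\<one>\<^bsub>P\<^esub>, \<one>\<^bsub>G v\<^esub>)" for x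
  have z0: "(\<one>\<^bsub>P\<^esub>, \<one>\<^bsub>G v\<^esub>) \<in> S" by simp
  have \<tau>1: "\<tau> \<one>\<^bsub>P\<^esub> = (\<one>\<^bsub>P\<^esub>, \<one>\<^bsub>G v\<^esub>)" using z0 by (simp add: \<tau>_def BijGroup_def)
  have \<tau>S: "\<tau> x \<in> S" if "x \<in> carrier P" for x
    using h.hom_closed[of "\<ominus> x"] that z0 Bij_imp_funcset[of "\<Phi> (\<ominus> x)" S]
    by (simp only: \<tau>_def BijGroup_def partial_object.simps) (blast dest: funcset_mem)
  have \<tau>s: "\<tau> (x \<odot> syl u t) = wall_act v u t (\<tau> x)"
    if x: "x \<in> carrier P" and u: "u \<in> verts \<Gamma>" and t: "t \<in> carrier (G u)" for x u t
  proof -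
    interpret Gu: group "G u" using u group_vertex by blast
    have "\<ominus> (x \<odot> syl u t) = syl u (inv\<^bsub>G u\<^esub> t) \<odot> \<ominus> x"
      using x u t by (simp add: P.inv_mult_group inv_syl)
    then have "\<Phi> (\<ominus> (x \<odot> syl u t)) = \<Phi> (syl u (inv\<^bsub>G u\<^esub> t)) \<otimes>\<^bsub>?H\<^esub> \<Phi> (\<ominus> x)"
      using h.hom_mult[of "syl u (inv\<^bsub>G u\<^esub> t)" "\<ominus> x"] x u t by (simp only: syl_closed Gu.inv_closed P.inv_closed)
    also have "\<Phi> (syl u (inv\<^bsub>G u\<^esub> t)) = f u (inv\<^bsub>G u\<^esub> t)" by (rule \<Phi>(2)[OF u Gu.inv_closed[OF t]])
    finally have "\<Phi> (\<ominus> (x \<odot> syl u t)) = f u (inv\<^bsub>G u\<^esub> t) \<otimes>\<^bsub>?H\<^esub> \<Phi> (\<ominus> x)" .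
    also have "\<dots> = compose S (f u (inv\<^bsub>G u\<^esub> t)) (\<Phi> (\<ominus> x))"
      using h.hom_closed[OF P.inv_closed[OF x]] fB[OF u Gu.inv_closed[OF t]]
      by (intro BijGroup_mult) (simp_all only: BijGroup_carrier)
    finally have "\<tau> (x \<odot> syl u t) = f u (inv\<^bsub>G u\<^esub> t) (\<tau> x)"
      using z0 by (simp add: \<tau>_def compose_def)
    then show ?thesis using \<tau>S[OF x] t by (simp add: f_def)
  qed
  have \<tau>f: "fst (\<tau> x) = x" if "x \<in> carrier P" for x
    using that by (induction rule: P_induct) (auto simp: \<tau>1 \<tau>s wall_act_def)
  show ?thesis
  proof (intro exI[of _ "\<lambda>x. snd (\<tau> x)"] conjI ballI)
    show "snd (\<tau> x) \<in> carrier (G v)" if "x \<in> carrier P" for x using \<tau>S[OF that] by (simp add: mem_Times_iff)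
  qed (auto simp: \<tau>1 \<tau>s wall_act_def \<tau>f)
qed

end

definition sector :: "'v \<Rightarrow> ('v \<times> 'g) list set set \<Rightarrow> 'g" where
  "sector v = (SOME \<sigma>. \<sigma> \<one>\<^bsub>P\<^esub> = \<one>\<^bsub>G v\<^esub> \<and> (\<forall>x\<in>carrier P. \<sigma> x \<in> carrier (G v) \<and>
    (\<forall>u\<in>verts \<Gamma>. \<forall>t\<in>carrier (G u). \<sigma> (x \<odot> syl u t) =
       (if u = v \<and> x \<in> span (star v) then \<sigma> x \<otimes>\<^bsub>G v\<^esub> t else \<sigma> x))))"

context
  fixes v assumes v: "v \<in> verts \<Gamma>"
begin

lemma sector_one: "sector v \<one>\<^bsub>P\<^esub> = \<one>\<^bsub>G v\<^esub>"
  and sector_closed [simp]: "x \<in> carrier P \<Longrightarrow> sector v x \<in> carrier (G v)"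
  and sector_step: "x \<in> carrier P \<Longrightarrow> u \<in> verts \<Gamma> \<Longrightarrow> t \<in> carrier (G u) \<Longrightarrow> sector v (x \<odot> syl u t) =
       (if u = v \<and> x \<in> span (star v) then sector v x \<otimes>\<^bsub>G v\<^esub> t else sector v x)"
  using someI_ex[OF sector_ex[OF v]] unfolding sector_def[symmetric] by blast+

lemma sector_left:
  assumes "x \<in> carrier P" "s \<in> carrier (G v)"
  shows "sector v (syl v s \<odot> x) = s \<otimes>\<^bsub>G v\<^esub> sector v x"
  using assms(1)
proof (induction rule: P_induct)
  case one
  interpret Gv: group "G v" using v group_vertex by blast
  have "\<one>\<^bsub>P\<^esub> \<in> span (star v)" using subgroup_span subgroup.one_closed by blast
  then show ?case using sector_step[of "\<one>\<^bsub>P\<^esub>" v s] v assms sector_one by simp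
next
  case (mult x u t)
  interpret Gv: group "G v" using v group_vertex by blast
  have "syl v s \<odot> x \<in> span (star v) \<longleftrightarrow> x \<in> span (star v)"
    using syl_span[of v s "star v"] v assms mult by (auto simp: span_mult_iff star_def)
  then show ?case
    using mult v assms sector_step[of "syl v s \<odot> x" u t] sector_step[of x u t] sector_closed[of x]
    by (auto simp: P.m_assoc Gv.m_assoc)
qed

text \<open>An element of the subgroup generated by the star of \<open>v\<close> is the product of its part in \<open>G v\<close> and of a part
  that commutes with \<open>G v\<close>; the first part is its sector.\<close>

lemma star_decomp:
  assumes "x \<in> span (star v)"
  shows "x = syl v (sector v x) \<odot> kill (- {v}) x"
    and "t \<in> carrier (G v) \<Longrightarrow> kill (- {v}) x \<odot> syl v t = syl v t \<odot> kill (- {v}) x"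
proof -
  interpret Gv: group "G v" using v group_vertex by blast
  have "E w = syl v (sector v (E w)) \<odot> kill (- {v}) (E w) \<and> E w \<in> span (star v) \<and>
      (\<forall>t\<in>carrier (G v). kill (- {v}) (E w) \<odot> syl v t = syl v t \<odot> kill (- {v}) (E w))"
    if "w \<in> W" "fst ` set w \<subseteq> star v" for w
    using that
  proof (induction w rule: rev_induct)
    case Nil
    then show ?case using v sector_one subgroup.one_closed[OF subgroup_span] by simp
  next
    case (snoc a w)
    obtain u g where a: "a = (u, g)" by force
    have u: "u \<in> star v" "u \<in> verts \<Gamma>" and g: "g \<in> carrier (G u)" and w: "w \<in> W"
      using snoc.prems by (auto simp: a)
    have IH: "E w = syl v (sector v (E w)) \<odot> kill (- {v}) (E w)" "E w \<in> span (star v)"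
      "\<And>t. t \<in> carrier (G v) \<Longrightarrow> kill (- {v}) (E w) \<odot> syl v t = syl v t \<odot> kill (- {v}) (E w)"
      using snoc w by auto
    have E: "E (w @ [a]) = E w \<odot> syl u g" using a u g w by (simp add: E_snoc)
    have sp: "E (w @ [a]) \<in> span (star v)" using E star_mult_iff[OF v, of "E w" u g] IH u g w by simp
    show ?case
    proof (cases "u = v")
      case True
      have g': "g \<in> carrier (G v)" using g True by simp
      have k: "kill (- {v}) (E (w @ [a])) = kill (- {v}) (E w)"
        using E True u g w by (simp add: kill_syl)
      have s: "sector v (E (w @ [a])) = sector v (E w) \<otimes>\<^bsub>G v\<^esub> g"
        using E True u g w IH by (simp add: sector_step)
      have "E (w @ [a]) = syl v (sector v (E w)) \<odot> (kill (- {v}) (E w) \<odot> syl v g)"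
        using E True u g w v IH(1) by (metis P.m_assoc E_closed kill_closed sector_closed syl_closed)
      also have "\<dots> = syl v (sector v (E w)) \<odot> syl v g \<odot> kill (- {v}) (E w)"
        using IH(3)[OF g'] g' v w by (simp add: P.m_assoc)
      also have "\<dots> = syl v (sector v (E (w @ [a]))) \<odot> kill (- {v}) (E (w @ [a]))"
        using s k g' v w by (simp add: syl_mult)
      finally show ?thesis using sp k IH(3) by metis
    next
      case False
      have e: "{u, v} \<in> edges \<Gamma>" using u False by (auto simp: star_def)
      have k: "kill (- {v}) (E (w @ [a])) = kill (- {v}) (E w) \<odot> syl u g"
        using E False u g w by (simp add: kill_syl)
      have s: "sector v (E (w @ [a])) = sector v (E w)"
        using E False u g w IH by (simp add: sector_step)
      have "E (w @ [a]) = syl v (sector v (E (w @ [a]))) \<odot> kill (- {v}) (E (w @ [a]))"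
        unfolding s k using E u g w v IH(1) by (metis P.m_assoc E_closed kill_closed sector_closed syl_closed)
      moreover have "kill (- {v}) (E (w @ [a])) \<odot> syl v t = syl v t \<odot> kill (- {v}) (E (w @ [a]))"
        if t: "t \<in> carrier (G v)" for t
      proof -
        have "kill (- {v}) (E (w @ [a])) \<odot> syl v t = kill (- {v}) (E w) \<odot> (syl u g \<odot> syl v t)"
          using k u g v t w by (simp add: P.m_assoc)
        also have "\<dots> = kill (- {v}) (E w) \<odot> syl v t \<odot> syl u g"
          using syl_commute[OF e g t] u g v t w by (simp add: P.m_assoc)
        also have "\<dots> = syl v t \<odot> kill (- {v}) (E (w @ [a]))"
          using k IH(3)[OF t] u g v t w by (simp add: P.m_assoc)
        finally show ?thesis .
      qed
      ultimately show ?thesis using sp by blast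
    qed
  qed
  then show "x = syl v (sector v x) \<odot> kill (- {v}) x"
    and "t \<in> carrier (G v) \<Longrightarrow> kill (- {v}) x \<odot> syl v t = syl v t \<odot> kill (- {v}) x"
    using span_word[OF assms] by metis+
qed

text \<open>Read the word from the left. The sector changes only while the prefix is in the subgroup generated by the star of
  \<open>v\<close>, and in such a prefix the letters of \<open>G v\<close> can be collected in front, as a single letter.\<close>

lemma sector_shorten:
  "w \<in> W \<Longrightarrow> sector v (E w) \<noteq> \<one>\<^bsub>G v\<^esub> \<Longrightarrow>
    \<exists>w'\<in>W. length w' < length w \<and> E w' = \<ominus> (syl v (sector v (E w))) \<odot> E w"
proof (induction w rule: rev_induct)
  case Nil
  then show ?case using sector_one by simp
next
  case (snoc a w)
  obtain u g where a: "a = (u, g)" by force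
  have u: "u \<in> verts \<Gamma>" and g: "g \<in> carrier (G u)" and w: "w \<in> W"
    using snoc.prems by (auto simp: a)
  have E: "E (w @ [a]) = E w \<odot> syl u g" using a u g w by (simp add: E_snoc)
  show ?case
  proof (cases "u = v \<and> E w \<in> span (star v)")
    case True
    have sp: "E (w @ [a]) \<in> span (star v)"
      using E star_mult_iff[OF v, of "E w" u g] True u g w by (simp add: star_def)
    have W': "filter (\<lambda>a. fst a \<in> - {v}) (w @ [a]) \<in> W" using snoc.prems(1) by (auto simp: syllable_words_def)
    have "\<ominus> (syl v (sector v (E (w @ [a])))) \<odot> E (w @ [a]) = kill (- {v}) (E (w @ [a]))"
      using star_decomp(1)[OF sp] snoc.prems(1) v
      by (metis E_closed P.inv_solve_left kill_closed sector_closed syl_closed)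
    also have "\<dots> = E (filter (\<lambda>a. fst a \<in> - {v}) (w @ [a]))" using snoc.prems(1) kill_E by blast
    finally have "E (filter (\<lambda>a. fst a \<in> - {v}) (w @ [a])) =
        \<ominus> (syl v (sector v (E (w @ [a])))) \<odot> E (w @ [a])" by simp
    moreover have "length (filter (\<lambda>a. fst a \<in> - {v}) (w @ [a])) < length (w @ [a])"
      using True a by (simp add: le_imp_less_Suc)
    ultimately show ?thesis using W' by blast
  next
    case False
    have s: "sector v (E (w @ [a])) = sector v (E w)" using False u g w by (auto simp: E sector_step)
    then obtain w' where w': "w' \<in> W" "length w' < length w"
      "E w' = \<ominus> (syl v (sector v (E w))) \<odot> E w"
      using snoc.IH[OF w] snoc.prems by auto
    then have "E (w' @ [a]) = \<ominus> (syl v (sector v (E (w @ [a])))) \<odot> E (w @ [a])"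
      unfolding s using E u g w v by (simp add: a E_snoc P.m_assoc)
    then show ?thesis using w' u g by (intro bexI[of _ "w' @ [a]"]) (auto simp: a)
  qed
qed

end

end

section \<open>The extension graph\<close>

context group
begin

lemma inv_cancel [simp]:
  assumes "x \<in> carrier G" "y \<in> carrier G"
  shows "inv x \<otimes> (x \<otimes> y) = y" "x \<otimes> (inv x \<otimes> y) = y"
  using assms by (simp_all add: m_assoc[symmetric])

lemma conj_mult:
  assumes "h \<in> carrier G" "x \<in> carrier G" "y \<in> carrier G"
  shows "h \<otimes> x \<otimes> inv h \<otimes> (h \<otimes> y \<otimes> inv h) = h \<otimes> (x \<otimes> y) \<otimes> inv h"
  using assms by (simp add: m_assoc)

end

locale extension_data = graph_product_data \<Gamma> G
  for \<Gamma> :: "'v ugraph" and G :: "'v \<Rightarrow> ('g, 'm) monoid_scheme" +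
  assumes nontrivial: "v \<in> verts \<Gamma> \<Longrightarrow> carrier (G v) \<noteq> {\<one>\<^bsub>G v\<^esub>}"
begin

abbreviation X where "X \<equiv> extension_graph \<Gamma> G"

definition conjs where "conjs g A = (\<lambda>x. g \<odot> x \<odot> \<ominus> g) ` A"

definition vtx where "vtx h v = conjs h (syl v ` carrier (G v))"

lemma vertex_group_eq: "vertex_group \<Gamma> G v = syl v ` carrier (G v)"
  by (simp add: vertex_group_def syl_def E_def Let_def)

lemma verts_X: "verts X = {vtx h v | h v. h \<in> carrier P \<and> v \<in> verts \<Gamma>}"
  unfolding extension_graph_def extension_verts_def vtx_def conjs_def vertex_group_eq Let_def by auto

lemma vtx_in_X [simp]: "h \<in> carrier P \<Longrightarrow> v \<in> verts \<Gamma> \<Longrightarrow> vtx h v \<in> verts X"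
  by (auto simp: verts_X)

lemma edges_X: "{A, B} \<in> edges X \<longleftrightarrow> A \<in> verts X \<and> B \<in> verts X \<and> A \<noteq> B \<and>
    (\<forall>a\<in>A. \<forall>b\<in>B. a \<odot> b = b \<odot> a)" (is "?L \<longleftrightarrow> ?R")
proof
  assume ?L
  then obtain A' B' where "{A, B} = {A', B'}" "A' \<in> verts X" "B' \<in> verts X" "A' \<noteq> B'"
    "\<forall>a\<in>A'. \<forall>b\<in>B'. a \<odot> b = b \<odot> a"
    by (auto simp: extension_graph_def)
  then show ?R by (auto simp: doubleton_eq_iff)
qed (auto simp: extension_graph_def)

lemma vtx_elem: "x \<in> vtx h v \<longleftrightarrow> (\<exists>g\<in>carrier (G v). x = h \<odot> syl v g \<odot> \<ominus> h)"
  by (auto simp: vtx_def conjs_def)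

lemma nontrivial_ex: "v \<in> verts \<Gamma> \<Longrightarrow> \<exists>g\<in>carrier (G v). g \<noteq> \<one>\<^bsub>G v\<^esub>"
  using nontrivial[of v] group.is_monoid[OF group_vertex, of v] monoid.one_closed[of "G v"] by blast

lemma vtx_eq_imp_eq:
  assumes "h \<in> carrier P" "k \<in> carrier P" "u \<in> verts \<Gamma>" "v \<in> verts \<Gamma>" "vtx h u = vtx k v"
  shows "u = v"
proof -
  obtain g where g: "g \<in> carrier (G u)" "g \<noteq> \<one>\<^bsub>G u\<^esub>" using nontrivial_ex assms by blast
  then have "h \<odot> syl u g \<odot> \<ominus> h \<in> vtx k v" using assms vtx_elem by metis
  then obtain g' where g': "g' \<in> carrier (G v)"
    "h \<odot> syl u g \<odot> \<ominus> h = k \<odot> syl v g' \<odot> \<ominus> k"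
    using vtx_elem by blast
  have "ret u (k \<odot> syl v g' \<odot> \<ominus> k) \<noteq> \<one>\<^bsub>G u\<^esub>"
    using ret_conj[of u u g h] g g' assms by simp
  then show ?thesis using ret_conj[of u v g' k] g' assms by auto
qed

lemma conj_span:
  assumes "v \<in> verts \<Gamma>" "c \<in> span (star v)" "g \<in> carrier (G v)"
  shows "\<exists>g'\<in>carrier (G v). c \<odot> syl v g \<odot> \<ominus> c = syl v g'"
proof -
  interpret Gv: group "G v" using assms group_vertex by blast
  define s \<kappa> where "s = sector v c" and "\<kappa> = kill (- {v}) c"
  have cc: "c \<in> carrier P" using assms span_closed by blast
  have s: "s \<in> carrier (G v)" and \<kappa>: "\<kappa> \<in> carrier P"
    using cc assms sector_closed[of v c] by (auto simp: s_def \<kappa>_def)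
  have c: "c = syl v s \<odot> \<kappa>" using star_decomp(1) assms s_def \<kappa>_def by blast
  have "c \<odot> syl v g = syl v s \<odot> (\<kappa> \<odot> syl v g)"
    unfolding c using s \<kappa> assms by (simp add: P.m_assoc)
  also have "\<kappa> \<odot> syl v g = syl v g \<odot> \<kappa>"
    using star_decomp(2) assms \<kappa>_def by blast
  also have "\<kappa> = \<ominus> (syl v s) \<odot> c"
    using P.inv_solve_left[of \<kappa> "syl v s" c] c s \<kappa> cc assms by simp
  also have "syl v s \<odot> (syl v g \<odot> (\<ominus> (syl v s) \<odot> c)) =
      syl v (s \<otimes>\<^bsub>G v\<^esub> g \<otimes>\<^bsub>G v\<^esub> inv\<^bsub>G v\<^esub> s) \<odot> c"
    using s cc assms by (simp add: inv_syl P.m_assoc[symmetric] syl_mult Gv.m_assoc)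
  finally have "c \<odot> syl v g \<odot> \<ominus> c = syl v (s \<otimes>\<^bsub>G v\<^esub> g \<otimes>\<^bsub>G v\<^esub> inv\<^bsub>G v\<^esub> s)"
    using s cc assms by (simp add: P.m_assoc)
  then show ?thesis using s assms by (intro bexI[of _ "s \<otimes>\<^bsub>G v\<^esub> g \<otimes>\<^bsub>G v\<^esub> inv\<^bsub>G v\<^esub> s"]) auto
qed

lemma vtx_span_sub:
  assumes "v \<in> verts \<Gamma>" "c \<in> span (star v)" "h \<in> carrier P"
  shows "vtx (h \<odot> c) v \<subseteq> vtx h v"
proof
  fix x assume "x \<in> vtx (h \<odot> c) v"
  then obtain g where g: "g \<in> carrier (G v)" "x = h \<odot> c \<odot> syl v g \<odot> \<ominus> (h \<odot> c)"
    by (auto simp: vtx_elem)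
  have cc: "c \<in> carrier P" using assms span_closed by blast
  have "x = h \<odot> (c \<odot> syl v g \<odot> \<ominus> c) \<odot> \<ominus> h"
    using g cc assms by (simp add: P.inv_mult_group P.m_assoc)
  then show "x \<in> vtx h v" using conj_span[OF assms(1,2) g(1)] by (auto simp: vtx_elem)
qed

lemma vtx_span:
  assumes "v \<in> verts \<Gamma>" "c \<in> span (star v)" "h \<in> carrier P"
  shows "vtx (h \<odot> c) v = vtx h v"
proof
  have cc: "c \<in> carrier P" using assms span_closed by blast
  have "\<ominus> c \<in> span (star v)" using assms subgroup.m_inv_closed[OF subgroup_span] by blast
  then have "vtx (h \<odot> c \<odot> \<ominus> c) v \<subseteq> vtx (h \<odot> c) v"
    using assms cc by (intro vtx_span_sub) auto
  then show "vtx h v \<subseteq> vtx (h \<odot> c) v" using assms cc by (simp add: P.m_assoc)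
qed (rule vtx_span_sub[OF assms])

text \<open>Comparing sectors: left multiplication by \<open>syl v s\<close> changes the sector of \<open>m\<close>, so right multiplication by
  \<open>syl v g\<close> must do so, too, which is only possible in the subgroup generated by the star of \<open>v\<close>.\<close>

lemma normaliser_span:
  assumes v: "v \<in> verts \<Gamma>" and m: "m \<in> carrier P" and g: "g \<in> carrier (G v)" "g \<noteq> \<one>\<^bsub>G v\<^esub>"
    and s: "s \<in> carrier (G v)" "m \<odot> syl v g = syl v s \<odot> m"
  shows "m \<in> span (star v)"
proof (rule ccontr)
  interpret Gv: group "G v" using v group_vertex by blast
  assume "m \<notin> span (star v)"
  then have "sector v (syl v s \<odot> m) = sector v m"
    using sector_step[OF v m v g(1)] s by simp
  then have "s \<otimes>\<^bsub>G v\<^esub> sector v m = sector v m" using sector_left[OF v m s(1)] by simp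
  then have "s = \<one>\<^bsub>G v\<^esub>" using s sector_closed[OF v m] by simp
  then have "syl v g = \<one>\<^bsub>P\<^esub>" using s m v g by simp
  then show False using syl_eq_one v g by blast
qed

lemma vtx_eq_iff:
  assumes "v \<in> verts \<Gamma>" "h \<in> carrier P" "k \<in> carrier P"
  shows "vtx h v = vtx k v \<longleftrightarrow> \<ominus> h \<odot> k \<in> span (star v)"
proof
  assume "\<ominus> h \<odot> k \<in> span (star v)"
  then have "vtx (h \<odot> (\<ominus> h \<odot> k)) v = vtx h v" using vtx_span assms by blast
  then show "vtx h v = vtx k v" using assms by (simp add: P.m_assoc[symmetric])
next
  assume eq: "vtx h v = vtx k v"
  obtain g where g: "g \<in> carrier (G v)" "g \<noteq> \<one>\<^bsub>G v\<^esub>" using nontrivial_ex assms by blast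
  then have "k \<odot> syl v g \<odot> \<ominus> k \<in> vtx h v" using eq vtx_elem by metis
  then obtain s where s: "s \<in> carrier (G v)"
    "k \<odot> syl v g \<odot> \<ominus> k = h \<odot> syl v s \<odot> \<ominus> h" using vtx_elem by blast
  have "\<ominus> h \<odot> k \<odot> syl v g = \<ominus> h \<odot> (k \<odot> syl v g \<odot> \<ominus> k) \<odot> k"
    using g assms by (simp add: P.m_assoc)
  also have "\<dots> = \<ominus> h \<odot> h \<odot> (syl v s \<odot> (\<ominus> h \<odot> k))"
    unfolding s(2) using s(1) assms by (simp add: P.m_assoc)
  also have "\<dots> = syl v s \<odot> (\<ominus> h \<odot> k)" using s assms by simp
  finally show "\<ominus> h \<odot> k \<in> span (star v)"
    using normaliser_span[of v "\<ominus> h \<odot> k" g s] assms g s by simp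
qed

lemma edge_vtx:
  assumes e: "{u, v} \<in> edges \<Gamma>" and h: "h \<in> carrier P"
  shows "{vtx h u, vtx h v} \<in> edges X"
proof -
  have uv: "u \<in> verts \<Gamma>" "v \<in> verts \<Gamma>" "u \<noteq> v" using e edge_verts by auto
  have "a \<odot> b = b \<odot> a" if ab: "a \<in> vtx h u" "b \<in> vtx h v" for a b
  proof -
    obtain g g' where g: "g \<in> carrier (G u)" "a = h \<odot> syl u g \<odot> \<ominus> h"
      and g': "g' \<in> carrier (G v)" "b = h \<odot> syl v g' \<odot> \<ominus> h"
      using ab by (auto simp: vtx_elem)
    show ?thesis unfolding g(2) g'(2) using g(1) g'(1) uv h syl_commute[OF e g(1) g'(1)] by (simp only: P.conj_mult syl_closed)
  qed
  moreover have "vtx h u \<noteq> vtx h v" using vtx_eq_imp_eq h uv by blast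
  ultimately show ?thesis unfolding edges_X using uv h vtx_in_X by blast
qed

text \<open>Let \<open>m\<close> be such that \<open>G v\<close> commutes with \<open>m G\<^sub>u m\<^sup>-\<^sup>1\<close>. By \<open>normaliser_span\<close> the latter is contained in the subgroup
  generated by the star of \<open>v\<close>, so \<open>u\<close> is in the star; and \<open>u = v\<close> is impossible, as it would make the two vertices
  equal. The retraction \<open>\<rho>\<close> of \<open>m\<close> to this subgroup conjugates \<open>G u\<close> in the same way as \<open>m\<close>, so that
  \<open>\<rho>\<^sup>-\<^sup>1 m\<close> normalises \<open>G u\<close>, and \<open>h \<rho>\<close> is a common conjugator.\<close>

lemma edge_X_common:
  assumes "{A, B} \<in> edges X"
  shows "\<exists>h\<in>carrier P. \<exists>u v. {u, v} \<in> edges \<Gamma> \<and> A = vtx h u \<and> B = vtx h v"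
proof -
  have AB: "A \<noteq> B" "\<forall>a\<in>A. \<forall>b\<in>B. a \<odot> b = b \<odot> a" and ABv: "A \<in> verts X" "B \<in> verts X"
    using assms unfolding edges_X by blast+
  obtain h v k u where A: "A = vtx h v" and B: "B = vtx k u"
    and h: "h \<in> carrier P" and v: "v \<in> verts \<Gamma>" and k: "k \<in> carrier P" and u: "u \<in> verts \<Gamma>"
    using ABv unfolding verts_X by blast
  interpret Gv: group "G v" using v group_vertex by blast
  define m where "m = \<ominus> h \<odot> k"
  have m: "m \<in> carrier P" and k': "k = h \<odot> m" using h k by (auto simp: m_def P.m_assoc[symmetric])
  have comm: "syl v s \<odot> (m \<odot> syl u t \<odot> \<ominus> m) = m \<odot> syl u t \<odot> \<ominus> m \<odot> syl v s"
    if s: "s \<in> carrier (G v)" and t: "t \<in> carrier (G u)" for s t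
  proof -
    define a b where "a = syl v s" and "b = m \<odot> syl u t \<odot> \<ominus> m"
    have ab: "a \<in> carrier P" "b \<in> carrier P" using s t u v m by (auto simp: a_def b_def)
    have "h \<odot> a \<odot> \<ominus> h \<in> A" unfolding A a_def using s vtx_elem by blast
    moreover have "h \<odot> b \<odot> \<ominus> h = k \<odot> syl u t \<odot> \<ominus> k"
      unfolding k' b_def using h m t u by (simp add: P.inv_mult_group P.m_assoc)
    moreover have "h \<odot> b \<odot> \<ominus> h \<in> B"
      unfolding B calculation(2) using t vtx_elem by blast
    ultimately have "h \<odot> a \<odot> \<ominus> h \<odot> (h \<odot> b \<odot> \<ominus> h) =
        h \<odot> b \<odot> \<ominus> h \<odot> (h \<odot> a \<odot> \<ominus> h)"
      using AB(2) by blast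
    then have "h \<odot> (a \<odot> b) \<odot> \<ominus> h = h \<odot> (b \<odot> a) \<odot> \<ominus> h"
      using ab h by (simp only: P.conj_mult)
    then show ?thesis using ab h unfolding a_def[symmetric] b_def[symmetric] by simp
  qed
  have inC: "m \<odot> syl u t \<odot> \<ominus> m \<in> span (star v)" if t: "t \<in> carrier (G u)" for t
  proof -
    obtain s where s: "s \<in> carrier (G v)" "s \<noteq> \<one>\<^bsub>G v\<^esub>" using nontrivial_ex v by blast
    show ?thesis using normaliser_span[OF v _ s s(1)] comm[OF s(1) t] m t u by simp
  qed
  obtain t where t: "t \<in> carrier (G u)" "t \<noteq> \<one>\<^bsub>G u\<^esub>" using nontrivial_ex u by blast
  define x where "x = m \<odot> syl u t \<odot> \<ominus> m"
  have x: "x \<in> carrier P" "x \<in> span (star v)" using inC t m u by (auto simp: x_def)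
  have x1: "x \<noteq> \<one>\<^bsub>P\<^esub>"
    using ret_conj[OF u u t(1) m] t group_hom.hom_one[OF ret_group_hom[OF u]] by (auto simp: x_def)
  have uS: "u \<in> star v"
  proof (rule ccontr)
    assume "u \<notin> star v"
    then have "kill (star v) x = \<one>\<^bsub>P\<^esub>" using m t u by (simp add: x_def kill_syl)
    then show False using x x1 by (simp add: span_def)
  qed
  have "u \<noteq> v"
  proof
    assume uv: "u = v"
    then have "kill (- {v}) x = \<one>\<^bsub>P\<^esub>" using m t u by (simp add: x_def kill_syl)
    then have "x = syl v (sector v x)" using star_decomp(1)[OF v x(2)] v x by simp
    then have "m \<odot> syl v t = syl v (sector v x) \<odot> m"
      using P.inv_solve_right'[of x "m \<odot> syl v t" m] m t u uv x by (simp add: x_def)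
    then have "m \<in> span (star v)"
      using normaliser_span[OF v m, of t "sector v x"] t uv sector_closed[OF v x(1)] by simp
    then show False using AB(1) vtx_eq_iff[OF v h k] A B uv by (simp add: m_def)
  qed
  then have e: "{u, v} \<in> edges \<Gamma>" using uS by (auto simp: star_def)
  define \<rho> where "\<rho> = kill (star v) m"
  have \<rho>: "\<rho> \<in> carrier P" "\<rho> \<in> span (star v)" using m kill_span by (auto simp: \<rho>_def)
  have "kill (star v) x = x" using x by (simp add: span_def)
  then have eq: "\<rho> \<odot> syl u t \<odot> \<ominus> \<rho> = m \<odot> syl u t \<odot> \<ominus> m"
    using m t u uS by (simp add: x_def kill_syl \<rho>_def)
  have "\<ominus> \<rho> \<odot> m \<odot> syl u t = \<ominus> \<rho> \<odot> (m \<odot> syl u t \<odot> \<ominus> m) \<odot> m"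
    using m \<rho> t u by (simp add: P.m_assoc)
  also have "\<dots> = syl u t \<odot> (\<ominus> \<rho> \<odot> m)"
    unfolding eq[symmetric] using m \<rho> t u by (simp add: P.m_assoc)
  finally have "\<ominus> \<rho> \<odot> m \<in> span (star u)"
    using normaliser_span[OF u _ t t(1)] m \<rho> by simp
  then have "\<ominus> (h \<odot> \<rho>) \<odot> k \<in> span (star u)"
  proof -
    have "\<ominus> (h \<odot> \<rho>) \<odot> k = \<ominus> \<rho> \<odot> m"
      unfolding k' using h m \<rho> by (simp add: P.inv_mult_group P.m_assoc)
    then show ?thesis using \<open>\<ominus> \<rho> \<odot> m \<in> span (star u)\<close> by simp
  qed
  then have "B = vtx (h \<odot> \<rho>) u" using vtx_eq_iff[OF u, of "h \<odot> \<rho>" k] h \<rho> k B by simp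
  moreover have "A = vtx (h \<odot> \<rho>) v" using vtx_span[OF v \<rho>(2) h] A by simp
  moreover have "{v, u} \<in> edges \<Gamma>" using e by (simp add: insert_commute)
  ultimately show ?thesis using P.m_closed[OF h \<rho>(1)] by blast
qed

end

section \<open>Distances between chambers and vertices\<close>

context graph_product_data
begin

definition len :: "('v \<times> 'g) list set set \<Rightarrow> nat" where
  "len x = (LEAST n. \<exists>w\<in>W. E w = x \<and> length w = n)"

lemma len_word: "x \<in> carrier P \<Longrightarrow> \<exists>w\<in>W. E w = x \<and> length w = len x"
  unfolding len_def by (rule LeastI_ex) (auto simp: carrier_P)

lemma len_le: "w \<in> W \<Longrightarrow> len (E w) \<le> length w"
  unfolding len_def by (rule Least_le) auto

lemma len_one: "len \<one>\<^bsub>P\<^esub> = 0"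
  using len_le[of "[]"] by simp

lemma len_zero: "x \<in> carrier P \<Longrightarrow> len x = 0 \<Longrightarrow> x = \<one>\<^bsub>P\<^esub>"
  using len_word[of x] by auto

lemma len_syl:
  assumes "v \<in> verts \<Gamma>" "s \<in> carrier (G v)" "x \<in> carrier P"
  shows "len (syl v s \<odot> x) \<le> Suc (len x)"
proof -
  obtain w where "w \<in> W" "E w = x" "length w = len x" using len_word assms by blast
  then show ?thesis using len_le[of "(v, s) # w"] assms by (simp add: E_Cons)
qed

lemma len_sector:
  assumes "v \<in> verts \<Gamma>" "x \<in> carrier P" "sector v x \<noteq> \<one>\<^bsub>G v\<^esub>"
  shows "len (\<ominus> (syl v (sector v x)) \<odot> x) < len x"
proof -
  obtain w where w: "w \<in> W" "E w = x" "length w = len x" using len_word assms by blast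
  then show ?thesis using sector_shorten[OF assms(1) w(1)] len_le assms by fastforce
qed

end

context extension_data
begin

text \<open>The word distance from \<open>h\<close> to the coset of those \<open>k\<close> whose copy contains \<open>y\<close>.\<close>

definition dst :: "('v \<times> 'g) list set set \<Rightarrow> ('v \<times> 'g) list set set set \<Rightarrow> nat" where
  "dst h y = (LEAST n. \<exists>k\<in>carrier P. \<exists>v\<in>verts \<Gamma>. y = vtx k v \<and> len (\<ominus> h \<odot> k) = n)"

lemma dst_ex:
  assumes "y \<in> verts X"
  shows "\<exists>k\<in>carrier P. \<exists>v\<in>verts \<Gamma>. y = vtx k v \<and> len (\<ominus> h \<odot> k) = dst h y"
  unfolding dst_def by (rule LeastI_ex) (use assms verts_X in auto)

lemma dst_le: "k \<in> carrier P \<Longrightarrow> v \<in> verts \<Gamma> \<Longrightarrow> dst h (vtx k v) \<le> len (\<ominus> h \<odot> k)"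
  unfolding dst_def by (rule Least_le) auto

lemma dst_zero: "h \<in> carrier P \<Longrightarrow> v \<in> verts \<Gamma> \<Longrightarrow> dst h (vtx h v) = 0"
  using dst_le[of h v h] by (simp add: len_one)

lemma dst_zeroD:
  assumes "h \<in> carrier P" "y \<in> verts X" "dst h y = 0"
  shows "\<exists>v\<in>verts \<Gamma>. y = vtx h v"
proof -
  obtain k v where k: "k \<in> carrier P" "v \<in> verts \<Gamma>" "y = vtx k v" "len (\<ominus> h \<odot> k) = 0"
    using dst_ex assms by metis
  then have "\<ominus> h \<odot> k = \<one>\<^bsub>P\<^esub>" using len_zero assms by simp
  then have "k = h" using assms k P.inv_solve_left[of "\<one>\<^bsub>P\<^esub>" h k] by simp
  then show ?thesis using k by blast
qed

lemma conjs_vtx: "g \<in> carrier P \<Longrightarrow> k \<in> carrier P \<Longrightarrow> v \<in> verts \<Gamma> \<Longrightarrow> conjs g (vtx k v) = vtx (g \<odot> k) v"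
proof -
  assume a: "g \<in> carrier P" "k \<in> carrier P" "v \<in> verts \<Gamma>"
  have "g \<odot> (k \<odot> syl v x \<odot> \<ominus> k) \<odot> \<ominus> g = g \<odot> k \<odot> syl v x \<odot> \<ominus> (g \<odot> k)"
    if "x \<in> carrier (G v)" for x
    using a that by (simp add: P.inv_mult_group P.m_assoc)
  then show ?thesis unfolding vtx_def conjs_def image_image by (intro image_cong) auto
qed

definition in_star where "in_star x z \<longleftrightarrow> x = z \<or> {x, z} \<in> edges X"

lemma conjs_star:
  assumes h: "h \<in> carrier P" and v: "v \<in> verts \<Gamma>" and s: "s \<in> carrier (G v)"
    and x: "x \<in> verts X" "in_star x (vtx h v)"
  shows "conjs (h \<odot> syl v s \<odot> \<ominus> h) x = x"
proof -
  define g where "g = h \<odot> syl v s \<odot> \<ominus> h"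
  have g: "g \<in> carrier P" using h v s by (simp add: g_def)
  have gv: "g \<in> vtx h v" using s vtx_elem g_def by blast
  show ?thesis
  proof (cases "x = vtx h v")
    case True
    have "conjs g x = vtx (h \<odot> syl v s) v"
      unfolding True conjs_vtx[OF g h v] using h v s by (simp add: g_def P.m_assoc)
    also have "\<dots> = vtx h v" by (rule vtx_span[OF v _ h]) (use v s in \<open>auto intro: syl_span simp: star_def\<close>)
    finally show ?thesis using True g_def by simp
  next
    case False
    then have "\<forall>a\<in>x. \<forall>b\<in>vtx h v. a \<odot> b = b \<odot> a"
      using x unfolding in_star_def edges_X by blast
    then have c: "a \<odot> g = g \<odot> a" if "a \<in> x" for a using that gv by blast
    have ax: "a \<in> carrier P" if "a \<in> x" for a
      using that x(1) by (auto simp: verts_X vtx_elem)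
    have "g \<odot> a \<odot> \<ominus> g = a" if "a \<in> x" for a
      using c[OF that, symmetric] ax[OF that] g by (simp add: P.m_assoc)
    then show ?thesis unfolding conjs_def g_def[symmetric] by auto
  qed
qed

text \<open>Conjugation by an element of the vertex group \<open>z\<close> fixes all vertices in the star of \<open>z\<close>, and moves \<open>h\<close> to
  \<open>h \<odot> syl v s\<close>.\<close>

lemma dst_star:
  assumes h: "h \<in> carrier P" and v: "v \<in> verts \<Gamma>" and s: "s \<in> carrier (G v)"
    and x: "x \<in> verts X" "in_star x (vtx h v)"
  shows "dst (h \<odot> syl v s) x = dst h x"
proof -
  have *: "dst h' x \<le> dst (h' \<odot> syl v s') x"
    if h': "h' \<in> carrier P" and s': "s' \<in> carrier (G v)" and z: "in_star x (vtx h' v)" for h' s'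
  proof -
    define g where "g = h' \<odot> syl v s' \<odot> \<ominus> h'"
    have g: "g \<in> carrier P" using h' v s' by (simp add: g_def)
    have gx: "conjs g x = x" using conjs_star[OF h' v s' x(1) z] by (simp add: g_def)
    obtain k u where k: "k \<in> carrier P" "u \<in> verts \<Gamma>" "x = vtx k u"
      "len (\<ominus> (h' \<odot> syl v s') \<odot> k) = dst (h' \<odot> syl v s') x" using dst_ex[OF x(1)] by blast
    have "vtx (g \<odot> (\<ominus> g \<odot> k)) u = vtx (g \<odot> k) u" using gx k g conjs_vtx[of g k u] by simp
    then have "conjs (\<ominus> g) (vtx k u) = conjs (\<ominus> g) (vtx (g \<odot> k) u)" using g k by simp
    then have "vtx (\<ominus> g \<odot> k) u = x" using g k by (simp add: conjs_vtx)
    moreover have "\<ominus> h' \<odot> (\<ominus> g \<odot> k) = \<ominus> (h' \<odot> syl v s') \<odot> k"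
      using h' v s' k by (simp add: g_def P.inv_mult_group P.m_assoc)
    ultimately show ?thesis using dst_le[of "\<ominus> g \<odot> k" u h'] k g by simp
  qed
  interpret Gv: group "G v" using v group_vertex by blast
  have e: "vtx (h \<odot> syl v s) v = vtx h v"
    by (rule vtx_span[OF v _ h]) (use v s in \<open>auto intro: syl_span simp: star_def\<close>)
  have "dst (h \<odot> syl v s) x \<le> dst (h \<odot> syl v s \<odot> syl v (inv\<^bsub>G v\<^esub> s)) x"
    using *[of "h \<odot> syl v s" "inv\<^bsub>G v\<^esub> s"] h v s x e by simp
  also have "h \<odot> syl v s \<odot> syl v (inv\<^bsub>G v\<^esub> s) = h"
    using h v s by (simp add: P.m_assoc inv_syl[symmetric])
  finally show ?thesis using *[OF h s x(2)] by simp
qed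

lemma in_star_vtx:
  "u \<in> star v \<Longrightarrow> k \<in> carrier P \<Longrightarrow> v \<in> verts \<Gamma> \<Longrightarrow> in_star (vtx k u) (vtx k v)"
  by (auto simp: star_def in_star_def edge_vtx)

text \<open>The copies that contain a vertex differ by elements of the subgroup generated by a star, and none of the letters
  involved crosses the star of \<open>vtx h v\<close>, which does not contain this vertex.\<close>

lemma sector_const:
  assumes h: "h \<in> carrier P" and v: "v \<in> verts \<Gamma>" and k: "k \<in> carrier P" and a: "a \<in> verts \<Gamma>"
    and k': "k' \<in> carrier P" "vtx k a = vtx k' a" and ns: "\<not> in_star (vtx k a) (vtx h v)"
  shows "sector v (\<ominus> h \<odot> k') = sector v (\<ominus> h \<odot> k)"
proof -
  have "sector v (\<ominus> h \<odot> (k \<odot> E w)) = sector v (\<ominus> h \<odot> k)"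
    if "w \<in> W" "fst ` set w \<subseteq> star a" for w
    using that
  proof (induction w rule: rev_induct)
    case Nil
    then show ?case using k by simp
  next
    case (snoc p w)
    obtain u t where p: "p = (u, t)" by force
    have u: "u \<in> star a" "u \<in> verts \<Gamma>" and t: "t \<in> carrier (G u)" and w: "w \<in> W" "fst ` set w \<subseteq> star a"
      using snoc.prems by (auto simp: p)
    have Ew: "E w \<in> span (star a)"
      using w kill_E[of w "star a"] by (simp add: span_def filter_id_conv[THEN iffD2] image_subset_iff)
    have no: "\<not> (u = v \<and> \<ominus> h \<odot> (k \<odot> E w) \<in> span (star v))"
    proof
      assume *: "u = v \<and> \<ominus> h \<odot> (k \<odot> E w) \<in> span (star v)"
      then have "vtx h v = vtx (k \<odot> E w) v" using vtx_eq_iff[OF v h] k w by simp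
      moreover have "vtx k a = vtx (k \<odot> E w) a" using vtx_span[OF a Ew k] by simp
      moreover have "a \<in> star v" using * u by (auto simp: star_def insert_commute)
      ultimately show False using ns in_star_vtx[of a v "k \<odot> E w"] k w v by simp
    qed
    have "\<ominus> h \<odot> (k \<odot> E (w @ [p])) = \<ominus> h \<odot> (k \<odot> E w) \<odot> syl u t"
      using h k w u t by (simp add: p E_snoc P.m_assoc)
    then show ?case
      using sector_step[OF v _ u(2) t, of "\<ominus> h \<odot> (k \<odot> E w)"] no snoc.IH[OF w] h k w by simp
  qed
  moreover have "\<ominus> k \<odot> k' \<in> span (star a)" using vtx_eq_iff[OF a k k'(1)] k' by simp
  then obtain w where "w \<in> W" "E w = \<ominus> k \<odot> k'" "fst ` set w \<subseteq> star a" using span_word by blast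
  ultimately show ?thesis using k k' by fastforce
qed

text \<open>A shortest word from \<open>h\<close> to the coset can be chosen to begin with its sector, by \<open>len_sector\<close>.\<close>

lemma dst_decrease_iff:
  assumes h: "h \<in> carrier P" and v: "v \<in> verts \<Gamma>" and s: "s \<in> carrier (G v)" "s \<noteq> \<one>\<^bsub>G v\<^esub>"
    and k: "k \<in> carrier P" and a: "a \<in> verts \<Gamma>" and ns: "\<not> in_star (vtx k a) (vtx h v)"
  shows "dst (h \<odot> syl v s) (vtx k a) < dst h (vtx k a) \<longleftrightarrow> sector v (\<ominus> h \<odot> k) = s"
proof -
  interpret Gv: group "G v" using v group_vertex by blast
  define h' where "h' = h \<odot> syl v s"
  have h': "h' \<in> carrier P" using h v s by (simp add: h'_def)
  have hh: "\<ominus> h' \<odot> x = \<ominus> (syl v s) \<odot> (\<ominus> h \<odot> x)" if "x \<in> carrier P" for x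
    using that h v s by (simp add: h'_def P.inv_mult_group P.m_assoc)
  show ?thesis unfolding h'_def[symmetric]
  proof
    assume lt: "dst h' (vtx k a) < dst h (vtx k a)"
    obtain k1 a1 where k1: "k1 \<in> carrier P" "a1 \<in> verts \<Gamma>" "vtx k a = vtx k1 a1"
      "len (\<ominus> h' \<odot> k1) = dst h' (vtx k a)" using dst_ex[of "vtx k a" h'] k a by auto
    have a1: "a1 = a" using vtx_eq_imp_eq[OF k k1(1) a k1(2,3)] by simp
    define x' where "x' = \<ominus> h' \<odot> k1"
    have x': "x' \<in> carrier P" using h' k1 by (simp add: x'_def)
    have sx: "\<ominus> h \<odot> k1 = syl v s \<odot> x'" unfolding x'_def hh[OF k1(1)] using h k1 v s by simp
    have "sector v x' = \<one>\<^bsub>G v\<^esub>"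
    proof (rule ccontr)
      assume r: "sector v x' \<noteq> \<one>\<^bsub>G v\<^esub>"
      define r where "r = sector v x'"
      have rc: "r \<in> carrier (G v)" using sector_closed[OF v x'] r_def by simp
      define x'' where "x'' = \<ominus> (syl v r) \<odot> x'"
      have x'': "x'' \<in> carrier P" using rc v x' by (simp add: x''_def)
      have l: "len x'' < len x'" using len_sector[OF v x'] r by (simp add: x''_def r_def)
      have "x' = syl v r \<odot> x''" using rc v x' by (simp add: x''_def)
      then have "\<ominus> h \<odot> k1 = syl v (s \<otimes>\<^bsub>G v\<^esub> r) \<odot> x''"
        using sx s rc v x'' by (simp add: syl_mult[symmetric] P.m_assoc)
      then have "len (\<ominus> h \<odot> k1) \<le> len x'"
        using len_syl[OF v _ x'', of "s \<otimes>\<^bsub>G v\<^esub> r"] s rc l by simp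
      moreover have "dst h (vtx k a) \<le> len (\<ominus> h \<odot> k1)"
        using dst_le[OF k1(1,2), of h] k1(3) by simp
      ultimately show False using lt k1(4) by (simp add: x'_def)
    qed
    then have "sector v (\<ominus> h \<odot> k1) = s" using sx sector_left[OF v x' s(1)] s by simp
    then show "sector v (\<ominus> h \<odot> k) = s" using sector_const[OF h v k a k1(1) _ ns] k1(3) a1 by simp
  next
    assume sk: "sector v (\<ominus> h \<odot> k) = s"
    obtain k1 a1 where k1: "k1 \<in> carrier P" "a1 \<in> verts \<Gamma>" "vtx k a = vtx k1 a1"
      "len (\<ominus> h \<odot> k1) = dst h (vtx k a)" using dst_ex[of "vtx k a" h] k a by auto
    have a1: "a1 = a" using vtx_eq_imp_eq[OF k k1(1) a k1(2,3)] by simp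
    have s1: "sector v (\<ominus> h \<odot> k1) = s" using sector_const[OF h v k a k1(1) _ ns] k1(3) a1 sk by simp
    have "len (\<ominus> h' \<odot> k1) < len (\<ominus> h \<odot> k1)"
      unfolding hh[OF k1(1)] using len_sector[OF v, of "\<ominus> h \<odot> k1"] s1 s h k1 by simp
    then show "dst h' (vtx k a) < dst h (vtx k a)"
      using dst_le[OF k1(1,2), of h'] k1 by simp
  qed
qed

text \<open>Move by the first letter of a shortest word.\<close>

lemma chamber_step:
  assumes h: "h \<in> carrier P" and y: "y \<in> verts X" and d: "dst h y > 0"
  shows "\<exists>h'\<in>carrier P. \<exists>v\<in>verts \<Gamma>. dst h' y < dst h y \<and>
     (\<forall>x\<in>verts X. in_star x (vtx h v) \<longrightarrow> dst h' x = dst h x) \<and>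
     (\<forall>k\<in>carrier P. \<forall>a\<in>verts \<Gamma>. \<forall>b\<in>verts \<Gamma>. dst h' (vtx k a) < dst h (vtx k a) \<longrightarrow>
        \<not> in_star (vtx k b) (vtx h v) \<longrightarrow> dst h' (vtx k b) < dst h (vtx k b))"
proof -
  obtain k u where k: "k \<in> carrier P" "u \<in> verts \<Gamma>" "y = vtx k u"
      "len (\<ominus> h \<odot> k) = dst h y" using dst_ex[OF y, of h] by blast
  obtain w where w: "w \<in> W" "E w = \<ominus> h \<odot> k" "length w = dst h y"
    using len_word[of "\<ominus> h \<odot> k"] h k by auto
  then obtain v s w' where w': "w = (v, s) # w'" using d by (cases w) auto
  have v: "v \<in> verts \<Gamma>" and s: "s \<in> carrier (G v)" and w'W: "w' \<in> W" using w w' by auto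
  have Ew: "E w = syl v s \<odot> E w'" using v s w'W w' by (simp add: E_Cons)
  have s1: "s \<noteq> \<one>\<^bsub>G v\<^esub>"
  proof
    assume "s = \<one>\<^bsub>G v\<^esub>"
    then have "E w' = \<ominus> h \<odot> k" using Ew w v w'W by simp
    then show False using len_le[OF w'W] k w w' by simp
  qed
  define h' where "h' = h \<odot> syl v s"
  have h': "h' \<in> carrier P" using h v s by (simp add: h'_def)
  have "\<ominus> h' \<odot> k = \<ominus> (syl v s) \<odot> (\<ominus> h \<odot> k)"
    using k h v s by (simp add: h'_def P.inv_mult_group P.m_assoc)
  also have "\<dots> = E w'" unfolding w(2)[symmetric] Ew using v s w'W by simp
  finally have "dst h' y < dst h y" using dst_le[OF k(1,2), of h'] len_le[OF w'W] k w w' by simp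
  moreover have st: "\<forall>x\<in>verts X. in_star x (vtx h v) \<longrightarrow> dst h' x = dst h x"
    using dst_star[OF h v s] by (simp add: h'_def)
  moreover have "dst h' (vtx k b) < dst h (vtx k b)"
    if "k \<in> carrier P" "a \<in> verts \<Gamma>" "b \<in> verts \<Gamma>" "dst h' (vtx k a) < dst h (vtx k a)"
       "\<not> in_star (vtx k b) (vtx h v)" for k a b
  proof -
    have "\<not> in_star (vtx k a) (vtx h v)" using st that vtx_in_X[of k a] by auto
    then show ?thesis
      using that dst_decrease_iff[OF h v s s1 that(1)] unfolding h'_def by blast
  qed
  ultimately show ?thesis using h' v by blast
qed

text \<open>Without triangles, the stars of \<open>u\<close> and \<open>v\<close> meet only in these two vertices, so two chambers whose copies contain
  the edge differ by an element of \<open>G u\<close> times an element of \<open>G v\<close>.\<close>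

lemma finite_chambers:
  assumes e: "{u, v} \<in> edges \<Gamma>" and tri: "\<And>w. {w, u} \<in> edges \<Gamma> \<Longrightarrow> {w, v} \<in> edges \<Gamma> \<Longrightarrow> False"
    and fin: "finite (carrier (G u))" "finite (carrier (G v))" and h: "h \<in> carrier P"
  shows "finite {k \<in> carrier P. vtx k u = vtx h u \<and> vtx k v = vtx h v}" (is "finite ?K")
proof -
  have uv: "u \<in> verts \<Gamma>" "v \<in> verts \<Gamma>" "u \<noteq> v" using e edge_verts by auto
  interpret Gu: group "G u" using uv group_vertex by blast
  interpret Gv: group "G v" using uv group_vertex by blast
  let ?B = "(\<lambda>(s, t). syl u s \<odot> syl v t) ` (carrier (G u) \<times> carrier (G v))"
  have int: "star u \<inter> star v \<subseteq> {u, v}" using tri by (auto simp: star_def)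
  have B: "E w \<in> ?B" if "w \<in> W" "fst ` set w \<subseteq> {u, v}" for w
    using that
  proof (induction w)
    case Nil
    have "\<one>\<^bsub>P\<^esub> = syl u \<one>\<^bsub>G u\<^esub> \<odot> syl v \<one>\<^bsub>G v\<^esub>" using uv by simp
    then show ?case by (intro image_eqI[of _ _ "(\<one>\<^bsub>G u\<^esub>, \<one>\<^bsub>G v\<^esub>)"]) auto
  next
    case (Cons p w)
    obtain x g where p: "p = (x, g)" by force
    obtain s t where st: "s \<in> carrier (G u)" "t \<in> carrier (G v)" "E w = syl u s \<odot> syl v t"
      using Cons by auto
    have xg: "x = u \<or> x = v" "g \<in> carrier (G x)" "w \<in> W" using Cons.prems p by auto
    show ?case
    proof (cases "x = u")
      case True
      have "E (p # w) = syl u (g \<otimes>\<^bsub>G u\<^esub> s) \<odot> syl v t"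
        using True xg st uv p by (simp add: E_Cons syl_mult[symmetric] P.m_assoc)
      then show ?thesis using True xg st by (intro image_eqI[of _ _ "(g \<otimes>\<^bsub>G u\<^esub> s, t)"]) auto
    next
      case False
      then have x: "x = v" using xg by simp
      have gv: "g \<in> carrier (G v)" using xg x by simp
      have "E (p # w) = syl v g \<odot> syl u s \<odot> syl v t"
        using x xg st uv p by (simp add: E_Cons P.m_assoc)
      also have "syl v g \<odot> syl u s = syl u s \<odot> syl v g" using syl_commute[OF e st(1) gv] by simp
      also have "syl u s \<odot> syl v g \<odot> syl v t = syl u s \<odot> syl v (g \<otimes>\<^bsub>G v\<^esub> t)"
        using st gv uv by (simp add: P.m_assoc syl_mult)
      finally show ?thesis using gv st by (intro image_eqI[of _ _ "(s, g \<otimes>\<^bsub>G v\<^esub> t)"]) auto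
    qed
  qed
  have "?K \<subseteq> (\<lambda>b. h \<odot> b) ` ?B"
  proof
    fix k assume k: "k \<in> ?K"
    then have "\<ominus> h \<odot> k \<in> span (star u)" "\<ominus> h \<odot> k \<in> span (star v)"
      using vtx_eq_iff[OF uv(1) h, of k] vtx_eq_iff[OF uv(2) h, of k] by auto
    then have "\<ominus> h \<odot> k \<in> span {u, v}" using span_int span_mono[OF int] by blast
    then have "\<ominus> h \<odot> k \<in> ?B" using B span_word by metis
    then show "k \<in> (\<lambda>b. h \<odot> b) ` ?B"
      using k h by (intro image_eqI[where x = "\<ominus> h \<odot> k"]) simp_all
  qed
  then show ?thesis using fin finite_subset by (meson finite_SigmaI finite_imageI)
qed

end

section \<open>The theorem\<close>

context extension_data
begin

definition vertex_label :: "('v \<times> 'g) list set set set \<Rightarrow> 'v" where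
  "vertex_label y = (SOME v. v \<in> verts \<Gamma> \<and> (\<exists>h\<in>carrier P. y = vtx h v))"

lemma vertex_label_vtx:
  assumes "h \<in> carrier P" "v \<in> verts \<Gamma>" shows "vertex_label (vtx h v) = v"
proof -
  have "vertex_label (vtx h v) \<in> verts \<Gamma> \<and> (\<exists>k\<in>carrier P. vtx h v = vtx k (vertex_label (vtx h v)))"
    unfolding vertex_label_def by (rule someI[of _ v]) (use assms in blast)
  then show ?thesis using vtx_eq_imp_eq assms by metis
qed

lemma simplicial_X: "simplicial_graph X"
  unfolding simplicial_graph_def by (simp add: extension_graph_def) blast

lemma chamber_graph_X:
  assumes "connected_graph \<Gamma>" "girth \<Gamma> > 20"
  shows "chamber_graph \<Gamma> X (carrier P) vtx vertex_label dst"
proof (rule chamber_graph.intro, goal_cases)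
  case 1 show ?case by (rule simplicial)
next
  case 2 show ?case by (rule assms)
next
  case 3 show ?case by (rule assms)
next
  case 4 show ?case by (rule simplicial_X)
next
  case 5 show ?case using P.one_closed by blast
next
  case 6 then show ?case by (rule vtx_in_X)
next
  case 7 then show ?case by (rule vertex_label_vtx)
next
  case 8 then show ?case by (intro edge_vtx)
next
  case 9 then show ?case unfolding verts_X by blast
next
  case 10 then show ?case by (rule edge_X_common)
next
  case 11 then show ?case by (rule dst_zero)
next
  case 12 then show ?case by (rule dst_zeroD)
next
  case 13 then show ?case by (rule chamber_step[unfolded in_star_def])
qed

end

theorem theorem1p2:
  fixes \<Gamma> :: "'v ugraph" and G :: "'v \<Rightarrow> ('g, 'm) monoid_scheme"
  assumes "simplicial_graph \<Gamma>" and "connected_graph \<Gamma>" and "girth \<Gamma> > 20"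
    and "\<And>v. v \<in> verts \<Gamma> \<Longrightarrow> group (G v)"
    and "\<And>v. v \<in> verts \<Gamma> \<Longrightarrow> carrier (G v) \<noteq> {\<one>\<^bsub>G v\<^esub>}"
  shows "(hyperbolic_graph \<Gamma> \<longleftrightarrow> hyperbolic_graph (extension_graph \<Gamma> G)) \<and>
    (uniformly_fine_graph \<Gamma> \<and> hyperbolic_graph \<Gamma> \<longrightarrow> tight_graph (extension_graph \<Gamma> G)) \<and>
    (fine_graph \<Gamma> \<and> (\<forall>v\<in>verts \<Gamma>. finite (carrier (G v))) \<longrightarrow> fine_graph (extension_graph \<Gamma> G))"
proof -
  interpret extension_data \<Gamma> G
    using assms by (simp add: extension_data_def graph_product_data_def extension_data_axioms_def)
  interpret chamber_graph \<Gamma> X "carrier P" vtx vertex_label dst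
    by (rule chamber_graph_X[OF assms(2,3)])
  have "fine_graph X" if "fine_graph \<Gamma>" and fin: "\<forall>v\<in>verts \<Gamma>. finite (carrier (G v))"
  proof (rule fine[OF that(1)])
    fix x y assume "{x, y} \<in> edges X"
    then obtain h u v where h: "h \<in> carrier P" "{u, v} \<in> edges \<Gamma>" "x = vtx h u" "y = vtx h v"
      using edge_X_common by blast
    have uv: "u \<in> verts \<Gamma>" "v \<in> verts \<Gamma>" using edge_verts h by auto
    have tri: False if "{w, u} \<in> edges \<Gamma>" "{w, v} \<in> edges \<Gamma>" for w
      by (rule \<Gamma>_triangle[OF that(1) h(2)]) (use that(2) in \<open>simp add: insert_commute\<close>)
    have "finite {k \<in> carrier P. vtx k u = vtx h u \<and> vtx k v = vtx h v}"
      by (rule finite_chambers[OF h(2) tri _ _ h(1)]) (use fin uv in blast)+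
    moreover have "vtx k w = vtx h w" if k: "k \<in> carrier P" "vtx h w \<in> copy k" "w \<in> verts \<Gamma>" for k w
    proof -
      obtain w' where w': "w' \<in> verts \<Gamma>" "vtx h w = vtx k w'" using k(2) unfolding copy_def by blast
      then have "w = w'" using vtx_eq_imp_eq[OF h(1) k(1,3)] by blast
      then show ?thesis using w' by simp
    qed
    then have "{k \<in> carrier P. x \<in> copy k \<and> y \<in> copy k} \<subseteq> {k \<in> carrier P. vtx k u = vtx h u \<and> vtx k v = vtx h v}"
      unfolding h(3,4) using uv by blast
    ultimately show "finite {k \<in> carrier P. x \<in> copy k \<and> y \<in> copy k}" using finite_subset by blast
  qed
  then show ?thesis using hyperbolic_iff tight by blast
qed

end
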